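(* Let $E$ be a (real or complex) Banach space and let $f\in E^{**}$ be strongly affine. Then, with $B_{E^*}$ endowed with the weak* topology and with $f\in\mathcal F(B_{E^*})$ meaning $f|_{B_{E^*}}\in \mathcal F(B_{E^*})$: \begin{itemize} \item for $\alpha\in[1,\omega_1)$, $f|_{\overline{\operatorname{ext} B_{E^*}}}\in \operatorname{Hf}_\alpha(\overline{\operatorname{ext} B_{E^*}})$ if and only if $f\in \operatorname{Hf}_\alpha(B_{E^*})$; \item for $\alpha\in[1,\omega_1)$, $f|_{\overline{\operatorname{ext} B_{E^*}}}\in \operatorname{Bof}_\alpha(\overline{\operatorname{ext} B_{E^*}})$ if and only if $f\in \operatorname{Bof}_\alpha(B_{E^*})$; \item for $\alpha\in[0,\omega_1)$, $f|_{\overline{\operatorname{ext} B_{E^*}}}\in \mathcal C_\alpha(\overline{\operatorname{ext} B_{E^*}})$ if and only if $f\in \mathcal C_\alpha(B_{E^*})$. \end{itemize}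
   Context: $B_{E^*}$ is the closed unit ball of $E^*$ with the weak* topology (a compact convex set); $\operatorname{ext} B_{E^*}$ is its set of extreme points and closures are weak* closures. Subsets carry the subspace topology. All topological spaces are Tychonoff (completely regular Hausdorff). Radon measures on a compact space $K$ are complete finite (in total variation) measures defined at least on the Borel sets and inner regular with respect to compact sets; $\mathcal M^1(K)$ is the set of Radon probability measures. A function on $K$ is universally measurable if it is $\mu$-measurable for every Radon measure $\mu$ on $K$. For a compact convex subset $X$ of a locally convex space, the barycenter $r(\mu)\in X$ of $\mu\in\mathcal M^1(X)$ is the unique point with $\int h\,d\mu=h(r(\mu))$ for all continuous affine functions $h$ on $X$. A function $f:X\to\mathbb C$ is strongly affine if it is universally measurable and $\int f\,d\mu=f(r(\mu))$ for every $\mu\in\mathcal M^1(X)$. An element $f\in E^{**}$ is strongly affine if $f|_{B_{E^*}}$ is strongly affine. For a topological space $Y$: $\operatorname{Bos}(Y)$ is the algebra of sets generated by the open sets. A set $A\subset Y$ is resolvable if for every nonempty $B\subset Y$ there is a nonempty relatively open $U\subset B$ with $U\subset A$ or $U\cap A=\emptyset$; $\operatorname{Hs}(Y)$ is the algebra of all resolvable sets. $\Sigma_2(\mathcal F)$ denotes the family of countable unions of sets from $\mathcal F$. $\operatorname{Bof}_1(Y)$ (resp. $\operatorname{Hf}_1(Y)$) is the family of functions $g:Y\to\mathbb C$ such that $g^{-1}(U)\in\Sigma_2(\operatorname{Bos}(Y))$ (resp. $\Sigma_2(\operatorname{Hs}(Y))$) for every open $U\subset\mathbb C$. For $\alpha\in(1,\omega_1)$,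 $\operatorname{Bof}_\alpha(Y)$ (resp. $\operatorname{Hf}_\alpha(Y)$) consists of all pointwise limits of sequences from $\bigcup_{1\le\beta<\alpha}\operatorname{Bof}_\beta(Y)$ (resp. $\bigcup_{1\le\beta<\alpha}\operatorname{Hf}_\beta(Y)$). $\mathcal C_0(Y)=\mathcal C(Y)$ is the family of continuous functions on $Y$, and for $\alpha\in(0,\omega_1)$, $\mathcal C_\alpha(Y)$ consists of all pointwise limits of sequences from $\bigcup_{\beta<\alpha}\mathcal C_\beta(Y)$. *)

theory Defs
  imports
    "HOL-Analysis.Analysis"
    "HOL-Probability.Probability_Measure"
    "HOL-Library.Countable_Set_Type"
begin

section \<open>Countable ordinals\<close>

text \<open>The type \<open>omega1\<close> is the first uncountable ordinal: the cardinal successor of \<open>\<omega>\<close>,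
  regarded as a well-ordered set. Its elements are the ordinals in \<open>[0, \<omega>\<^sub>1)\<close>.\<close>

lemma cardSuc_natLeq_Well_order: "Well_order (cardSuc natLeq)"
  using cardSuc_Card_order[OF natLeq_Card_order] by (simp add: card_order_on_well_order_on)

lemma cardSuc_natLeq_infinite: "infinite (Field (cardSuc natLeq))"
  using cardSuc_finite[OF natLeq_Card_order] by (simp add: Field_natLeq)

typedef omega1 = "Field (cardSuc natLeq)"
  using cardSuc_natLeq_infinite by (metis ex_in_conv finite.emptyI)

instantiation omega1 :: wellorder
begin

definition less_eq_omega1 :: "omega1 \<Rightarrow> omega1 \<Rightarrow> bool" where
  "\<alpha> \<le> \<beta> \<longleftrightarrow> (Rep_omega1 \<alpha>, Rep_omega1 \<beta>) \<in> cardSuc natLeq"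

definition less_omega1 :: "omega1 \<Rightarrow> omega1 \<Rightarrow> bool" where
  "(\<alpha>::omega1) < \<beta> \<longleftrightarrow> \<alpha> \<le> \<beta> \<and> \<alpha> \<noteq> \<beta>"

instance
proof
  let ?r = "cardSuc natLeq"
  note wo = cardSuc_natLeq_Well_order
  have antisym: "antisym ?r" and trans: "trans ?r" and total: "Total ?r" and wf: "wf (?r - Id)"
    and refl: "\<And>x. (Rep_omega1 x, Rep_omega1 x) \<in> ?r"
    using wo Rep_omega1
    by (auto simp: well_order_on_def linear_order_on_def partial_order_on_def preorder_on_def
        dest: refl_onD)
  have anti: "x = y" if "x \<le> y" "y \<le> x" for x y :: omega1
    using that antisym unfolding less_eq_omega1_def by (metis antisymD Rep_omega1_inject)
  fix x y z :: omega1
  show "x < y \<longleftrightarrow> x \<le> y \<and> \<not> y \<le> x"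
    using anti[of x y] refl[of x] by (auto simp: less_omega1_def less_eq_omega1_def)
  show "x \<le> x"
    using refl by (simp add: less_eq_omega1_def)
  show "x \<le> y \<Longrightarrow> y \<le> z \<Longrightarrow> x \<le> z"
    using trans unfolding less_eq_omega1_def by (rule transD)
  show "x \<le> y \<Longrightarrow> y \<le> x \<Longrightarrow> x = y"
    by (rule anti)
  show "x \<le> y \<or> y \<le> x"
    using total refl[of x] Rep_omega1[of x] Rep_omega1[of y] Rep_omega1_inject[of x y]
    unfolding less_eq_omega1_def total_on_def by metis
  show "P a" if step: "\<And>x. (\<And>y. y < x \<Longrightarrow> P y) \<Longrightarrow> P x" for P :: "omega1 \<Rightarrow> bool" and a
  proof -
    have "wf (inv_image (?r - Id) Rep_omega1)"
      using wf by (rule wf_inv_image)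
    then show ?thesis
    proof (induction a rule: wf_induct_rule)
      case (less x)
      show ?case
      proof (rule step)
        fix y assume "y < x"
        then have "(Rep_omega1 y, Rep_omega1 x) \<in> ?r" "Rep_omega1 y \<noteq> Rep_omega1 x"
          unfolding less_omega1_def less_eq_omega1_def Rep_omega1_inject by blast+
        then show "P y"
          by (intro less) simp
      qed
    qed
  qed
qed

end

instantiation omega1 :: "{zero, one}"
begin

definition zero_omega1 :: omega1 where "0 = (LEAST \<alpha>::omega1. True)"

definition one_omega1 :: omega1 where "1 = (LEAST \<alpha>::omega1. 0 < \<alpha>)"

instance ..

end

lemma omega1_countable_below:
  includes cardinal_syntax
  shows "countable {..<\<alpha>::omega1}"
proof -
  let ?r = "cardSuc natLeq"
  have "|underS ?r (Rep_omega1 \<alpha>)| <o ?r"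
    by (intro card_of_underS cardSuc_Card_order natLeq_Card_order Rep_omega1)
  then have "|underS ?r (Rep_omega1 \<alpha>)| \<le>o natLeq"
    using cardSuc_ordLeq_ordLess[OF natLeq_Card_order card_of_Card_order] by blast
  then have "countable (underS ?r (Rep_omega1 \<alpha>))"
    by (simp add: countable_card_le_natLeq)
  moreover have "Rep_omega1 ` {..<\<alpha>} \<subseteq> underS ?r (Rep_omega1 \<alpha>)"
    by (auto simp: underS_def less_omega1_def less_eq_omega1_def Rep_omega1_inject)
  ultimately have "countable (Rep_omega1 ` {..<\<alpha>})"
    by (rule countable_subset[rotated])
  then show ?thesis
    by (rule countable_image_inj_on) (simp add: inj_on_def Rep_omega1_inject)
qed

lemma omega1_uncountable:
  includes cardinal_syntax
  shows "uncountable (UNIV :: omega1 set)"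
proof
  assume "countable (UNIV :: omega1 set)"
  then have "countable (range Rep_omega1)"
    by (rule countable_image)
  then have "countable (Field (cardSuc natLeq))"
    by (metis type_definition.Rep_range type_definition_omega1)
  then have "|Field (cardSuc natLeq)| \<le>o natLeq"
    by (simp add: countable_card_le_natLeq)
  moreover have "|Field (cardSuc natLeq)| =o cardSuc natLeq"
    by (intro card_of_Field_ordIso cardSuc_Card_order natLeq_Card_order)
  moreover have "natLeq <o cardSuc natLeq"
    by (intro cardSuc_greater natLeq_Card_order)
  ultimately show False
    using not_ordLess_ordLeq ordIso_ordLeq_trans ordIso_symmetric by blast
qed

lemma omega1_zero_le: "0 \<le> (\<alpha>::omega1)"
  unfolding zero_omega1_def by (rule Least_le) simp

lemma omega1_ex_greater: "\<exists>\<beta>. (\<alpha>::omega1) < \<beta>"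
proof (rule ccontr)
  assume "\<nexists>\<beta>. \<alpha> < \<beta>"
  then have "UNIV = insert \<alpha> {..<\<alpha>}"
    by (auto simp: not_less le_less)
  then show False
    using omega1_uncountable omega1_countable_below countable_insert by metis
qed

lemma omega1_one_le_iff: "1 \<le> (\<alpha>::omega1) \<longleftrightarrow> 0 < \<alpha>"
proof
  have "0 < (1::omega1)"
    unfolding one_omega1_def using omega1_ex_greater by (rule LeastI_ex)
  then show "1 \<le> \<alpha> \<Longrightarrow> 0 < \<alpha>" by simp
  show "0 < \<alpha> \<Longrightarrow> 1 \<le> \<alpha>"
    unfolding one_omega1_def by (rule Least_le)
qed


section \<open>Function classes on a topological space\<close>

text \<open>A function on the space \<open>Y\<close> is represented by a total function whose values outside
  \<open>topspace Y\<close> are irrelevant: membership in each class below depends only on its restriction to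
  \<open>topspace Y\<close>. Hence for a subspace \<open>S\<close> of \<open>Y\<close>, membership of \<open>g\<close> in a class over
  \<open>subtopology Y S\<close> is a statement about the restriction of \<open>g\<close> to \<open>S\<close>.\<close>

definition Bos :: "'a topology \<Rightarrow> 'a set set" where
  "Bos Y = \<Inter>{M. algebra (topspace Y) M \<and> {U. openin Y U} \<subseteq> M}"

definition resolvable_in :: "'a topology \<Rightarrow> 'a set \<Rightarrow> bool" where
  "resolvable_in Y A \<longleftrightarrow> A \<subseteq> topspace Y \<and>
     (\<forall>B. B \<subseteq> topspace Y \<and> B \<noteq> {} \<longrightarrow>
        (\<exists>U. openin (subtopology Y B) U \<and> U \<noteq> {} \<and> (U \<subseteq> A \<or> U \<inter> A = {})))"

definition Hs :: "'a topology \<Rightarrow> 'a set set" where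
  "Hs Y = {A. resolvable_in Y A}"

definition Sigma2 :: "'a set set \<Rightarrow> 'a set set" where
  "Sigma2 \<F> = {\<Union>\<A> |\<A>. countable \<A> \<and> \<A> \<subseteq> \<F>}"

definition preimage_class :: "'a topology \<Rightarrow> 'a set set \<Rightarrow> ('a \<Rightarrow> complex) set" where
  "preimage_class Y \<S> = {g. \<forall>U. open U \<longrightarrow> {x \<in> topspace Y. g x \<in> U} \<in> \<S>}"

definition pointwise_limits :: "'a set \<Rightarrow> ('a \<Rightarrow> complex) set \<Rightarrow> ('a \<Rightarrow> complex) set" where
  "pointwise_limits S \<G> =
     {g. \<exists>h. (\<forall>n::nat. h n \<in> \<G>) \<and> (\<forall>x\<in>S. (\<lambda>n. h n x) \<longlonglongrightarrow> g x)}"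

text \<open>The transfinite hierarchy with initial class \<open>\<B>\<close> at level \<open>\<gamma>\<close>. It is only meant for
  \<open>\<alpha> \<ge> \<gamma>\<close>; the value at \<open>\<alpha> < \<gamma>\<close> is a dummy.\<close>

function limit_hierarchy ::
  "'a set \<Rightarrow> omega1 \<Rightarrow> ('a \<Rightarrow> complex) set \<Rightarrow> omega1 \<Rightarrow> ('a \<Rightarrow> complex) set" where
  "limit_hierarchy S \<gamma> \<B> \<alpha> =
     (if \<alpha> \<le> \<gamma> then \<B>
      else pointwise_limits S (\<Union>\<beta>\<in>{\<gamma>..<\<alpha>}. limit_hierarchy S \<gamma> \<B> \<beta>))"
  by auto
termination
  by (relation "inv_image {(x, y). x < y} (\<lambda>(S, \<gamma>, \<B>, \<alpha>). \<alpha>)") (auto intro: wf)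

declare limit_hierarchy.simps [simp del]

definition Bof :: "omega1 \<Rightarrow> 'a topology \<Rightarrow> ('a \<Rightarrow> complex) set" where
  "Bof \<alpha> Y = limit_hierarchy (topspace Y) 1 (preimage_class Y (Sigma2 (Bos Y))) \<alpha>"

definition Hf :: "omega1 \<Rightarrow> 'a topology \<Rightarrow> ('a \<Rightarrow> complex) set" where
  "Hf \<alpha> Y = limit_hierarchy (topspace Y) 1 (preimage_class Y (Sigma2 (Hs Y))) \<alpha>"

definition Baire_class :: "omega1 \<Rightarrow> 'a topology \<Rightarrow> ('a \<Rightarrow> complex) set" where
  "Baire_class \<alpha> Y = limit_hierarchy (topspace Y) 0 {g. continuous_map Y euclidean g} \<alpha>"


section \<open>Radon measures and strongly affine functions\<close>

text \<open>Only nonnegative measures are considered: measurability with respect to a signed or complex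
  Radon measure is measurability with respect to its total variation.\<close>

definition radon_measure :: "'a topology \<Rightarrow> 'a measure \<Rightarrow> bool" where
  "radon_measure X \<mu> \<longleftrightarrow>
     space \<mu> = topspace X \<and> finite_measure \<mu> \<and> complete_measure \<mu> \<and>
     (\<forall>U. openin X U \<longrightarrow> U \<in> sets \<mu>) \<and>
     (\<forall>A\<in>sets \<mu>. emeasure \<mu> A = (SUP C\<in>{C. compactin X C \<and> C \<subseteq> A}. emeasure \<mu> C))"

definition radon_probability :: "'a topology \<Rightarrow> 'a measure \<Rightarrow> bool" where
  "radon_probability X \<mu> \<longleftrightarrow> radon_measure X \<mu> \<and> prob_space \<mu>"

definition universally_measurable :: "'a topology \<Rightarrow> ('a \<Rightarrow> complex) \<Rightarrow> bool" where
  "universally_measurable X g \<longleftrightarrow> (\<forall>\<mu>. radon_measure X \<mu> \<longrightarrow> g \<in> borel_measurable \<mu>)"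

text \<open>A compact convex set is given by its topology \<open>X\<close>; the convex structure of \<open>topspace X\<close> is the
  one of the ambient real vector space.\<close>

definition continuous_affine :: "'v::real_vector topology \<Rightarrow> ('v \<Rightarrow> complex) \<Rightarrow> bool" where
  "continuous_affine X h \<longleftrightarrow> continuous_map X euclidean h \<and>
     (\<forall>x\<in>topspace X. \<forall>y\<in>topspace X. \<forall>t\<in>{0..1}.
        h ((1 - t) *\<^sub>R x + t *\<^sub>R y) = (1 - t) *\<^sub>R h x + t *\<^sub>R h y)"

definition barycenter :: "'v::real_vector topology \<Rightarrow> 'v measure \<Rightarrow> 'v" where
  "barycenter X \<mu> =
     (THE x. x \<in> topspace X \<and> (\<forall>h. continuous_affine X h \<longrightarrow> (LINT y|\<mu>. h y) = h x))"

definition strongly_affine :: "'v::real_vector topology \<Rightarrow> ('v \<Rightarrow> complex) \<Rightarrow> bool" where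
  "strongly_affine X g \<longleftrightarrow> universally_measurable X g \<and>
     (\<forall>\<mu>. radon_probability X \<mu> \<longrightarrow>
        integrable \<mu> g \<and> (LINT y|\<mu>. g y) = g (barycenter X \<mu>))"


section \<open>Real and complex Banach spaces and their duals\<close>

text \<open>The field of scalars is a subset \<open>K\<close> of the complex numbers, either the set of reals or
  everything, so that functionals on real and on complex spaces are both complex-valued
  functions. Only the values \<open>smul c\<close> with \<open>c \<in> K\<close> matter; in the real case \<open>smul\<close> is thus
  the scalar multiplication of the type class.\<close>

locale scalar_banach_space =
  fixes K :: "complex set" and smul :: "complex \<Rightarrow> 'e::banach \<Rightarrow> 'e"
  assumes scalars: "K = \<real> \<or> K = UNIV"
    and smul_add_right: "c \<in> K \<Longrightarrow> smul c (x + y) = smul c x + smul c y"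
    and smul_add_left: "c \<in> K \<Longrightarrow> d \<in> K \<Longrightarrow> smul (c + d) x = smul c x + smul d x"
    and smul_smul: "c \<in> K \<Longrightarrow> d \<in> K \<Longrightarrow> smul c (smul d x) = smul (c * d) x"
    and smul_of_real: "smul (of_real r) x = r *\<^sub>R x"
    and norm_smul: "c \<in> K \<Longrightarrow> norm (smul c x) = cmod c * norm x"

definition dual_space ::
  "complex set \<Rightarrow> (complex \<Rightarrow> 'e::real_normed_vector \<Rightarrow> 'e) \<Rightarrow> ('e \<Rightarrow>\<^sub>L complex) set" where
  "dual_space K smul =
     {\<phi>. range (blinfun_apply \<phi>) \<subseteq> K \<and> (\<forall>c\<in>K. \<forall>x. \<phi> (smul c x) = c * \<phi> x)}"

text \<open>The composition \<open>blinfun_mult_right c o\<^sub>L \<phi>\<close> is the functional \<open>c \<phi>\<close>.\<close>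

definition bidual_space ::
  "complex set \<Rightarrow> (complex \<Rightarrow> 'e::real_normed_vector \<Rightarrow> 'e) \<Rightarrow> (('e \<Rightarrow>\<^sub>L complex) \<Rightarrow> complex) set" where
  "bidual_space K smul =
     {f. (\<forall>\<phi>\<in>dual_space K smul. f \<phi> \<in> K) \<and>
         (\<forall>\<phi>\<in>dual_space K smul. \<forall>\<psi>\<in>dual_space K smul. f (\<phi> + \<psi>) = f \<phi> + f \<psi>) \<and>
         (\<forall>c\<in>K. \<forall>\<phi>\<in>dual_space K smul. f (blinfun_mult_right c o\<^sub>L \<phi>) = c * f \<phi>) \<and>
         (\<exists>C. \<forall>\<phi>\<in>dual_space K smul. cmod (f \<phi>) \<le> C * norm \<phi>)}"

text \<open>For functionals, the strong operator topology is the topology of pointwise convergence.\<close>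

definition weak_star ::
  "complex set \<Rightarrow> (complex \<Rightarrow> 'e::real_normed_vector \<Rightarrow> 'e) \<Rightarrow> ('e \<Rightarrow>\<^sub>L complex) topology" where
  "weak_star K smul = subtopology strong_operator_topology (dual_space K smul)"

definition dual_ball ::
  "complex set \<Rightarrow> (complex \<Rightarrow> 'e::real_normed_vector \<Rightarrow> 'e) \<Rightarrow> ('e \<Rightarrow>\<^sub>L complex) set" where
  "dual_ball K smul = {\<phi> \<in> dual_space K smul. norm \<phi> \<le> 1}"

definition ball_top ::
  "complex set \<Rightarrow> (complex \<Rightarrow> 'e::real_normed_vector \<Rightarrow> 'e) \<Rightarrow> ('e \<Rightarrow>\<^sub>L complex) topology" where
  "ball_top K smul = subtopology (weak_star K smul) (dual_ball K smul)"

definition ext_closure_top ::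
  "complex set \<Rightarrow> (complex \<Rightarrow> 'e::real_normed_vector \<Rightarrow> 'e) \<Rightarrow> ('e \<Rightarrow>\<^sub>L complex) topology" where
  "ext_closure_top K smul = subtopology (weak_star K smul)
     (weak_star K smul closure_of {\<phi>. \<phi> extreme_point_of dual_ball K smul})"

end

theory Submission
  imports Defs
begin

text \<open>Every point of the dual ball is the barycenter of a Radon probability concentrated on the weak* closure
  of the extreme points. To avoid the Riesz theorem, these probabilities are parametrized by the compact
  space of finitely additive probabilities on all subsets of that closure: the resultant map from this space onto
  the ball is continuous, and \<open>f\<close> composed with it is \<open>m \<mapsto> \<integral> f d\<mu>\<^sub>m\<close>, which belongs to the same class as the
  restriction of \<open>f\<close>. It remains to descend along a continuous surjection of compact spaces. For \<open>Hf\<close> and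
  \<open>Bof\<close> one composes with a section for which the preimages of the countably many resolvable (open) sets
  generating the given function are resolvable (in \<open>Bos\<close>). A Baire function \<open>f\<close> depends only on countably
  many coordinates, by a Lindelof argument in \<open>X \<times> \<nat>\<^sup>\<nat>\<close>; hence \<open>f\<close> factors through a compact metrizable
  space, where the Baire classes coincide with the \<open>Bof\<close> classes.\<close>

section \<open>Limit hierarchies\<close>

text \<open>A section of the resultant map with good preimages is constructed only relative to
  countably many sets. That suffices because a single function of a transfinite class is built from
  countably many sets: the plane has a countable base, and each level adds one sequence. Such a
  section is in general far from continuous, so it cannot carry Baire classes; hence the detour
  through a metrizable image, where approximability by continuous functions becomes a property of
  preimages again. Finite additivity has two benefits. The parameter space is cut out of a cube by
  conditions on finitely many coordinates, hence is compact by Tychonoff; and the regularized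
  measure of an open set is a supremum of coordinates, hence lower semicontinuous. Boundedness of
  \<open>f\<close> on the ball enters through truncation: all functions used to build
  \<open>f\<close> may share one bound, so that integration commutes with every limit involved.
  Strong affinity enters only where an integral over the closure of the extreme points is read as a
  value of \<open>f\<close> at a barycenter.\<close>

lemma limit_hierarchy_base [simp]: "limit_hierarchy S \<gamma> B \<gamma> = B"
  by (simp add: limit_hierarchy.simps)

lemma limit_hierarchy_iff:
  assumes "\<gamma> < \<alpha>"
  shows "g \<in> limit_hierarchy S \<gamma> B \<alpha> \<longleftrightarrow>
    (\<exists>h. (\<forall>n::nat. \<exists>\<beta>. \<gamma> \<le> \<beta> \<and> \<beta> < \<alpha> \<and> h n \<in> limit_hierarchy S \<gamma> B \<beta>) \<and>
         (\<forall>x\<in>S. (\<lambda>n. h n x) \<longlonglongrightarrow> g x))"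
  using assms by (subst limit_hierarchy.simps) (auto simp: pointwise_limits_def Bex_def)

lemma limit_hierarchy_induct [consumes 2, case_names base step]:
  assumes "\<gamma> \<le> \<alpha>" and "g \<in> limit_hierarchy S \<gamma> B \<alpha>"
    and base: "\<And>h. h \<in> B \<Longrightarrow> P \<gamma> h"
    and step: "\<And>\<alpha> h g. \<gamma> < \<alpha> \<Longrightarrow> (\<And>x. x \<in> S \<Longrightarrow> (\<lambda>n. h n x) \<longlonglongrightarrow> g x) \<Longrightarrow>
      (\<And>n::nat. \<exists>\<beta>. \<gamma> \<le> \<beta> \<and> \<beta> < \<alpha> \<and> P \<beta> (h n)) \<Longrightarrow> P \<alpha> g"
  shows "P \<alpha> g"
  using assms(1,2)
proof (induction \<alpha> arbitrary: g rule: less_induct)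
  case (less \<alpha>)
  show ?case
  proof (cases "\<alpha> = \<gamma>")
    case True
    then show ?thesis using less.prems base by simp
  next
    case False
    then have "\<gamma> < \<alpha>" using less.prems by simp
    then obtain h where h: "\<And>n::nat. \<exists>\<beta>. \<gamma> \<le> \<beta> \<and> \<beta> < \<alpha> \<and> h n \<in> limit_hierarchy S \<gamma> B \<beta>"
        "\<And>x. x \<in> S \<Longrightarrow> (\<lambda>n. h n x) \<longlonglongrightarrow> g x"
      using less.prems(2) unfolding limit_hierarchy_iff[OF \<open>\<gamma> < \<alpha>\<close>] by blast
    show ?thesis
    proof (rule step[OF \<open>\<gamma> < \<alpha>\<close>, of h])
      fix n
      obtain \<beta> where "\<gamma> \<le> \<beta>" "\<beta> < \<alpha>" "h n \<in> limit_hierarchy S \<gamma> B \<beta>" using h(1) by blast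
      then show "\<exists>\<beta>. \<gamma> \<le> \<beta> \<and> \<beta> < \<alpha> \<and> P \<beta> (h n)"
        using less.IH[of \<beta> "h n"] by auto
    qed (rule h(2))
  qed
qed

text \<open>The invariant \<open>Q\<close> carries what makes \<open>\<Psi>\<close> commute with
  pointwise limits, such as a common bound and measurability when \<open>\<Psi>\<close> is
  integration. Composition, restriction and truncation take \<open>Q\<close> trivial.\<close>

lemma limit_hierarchy_transport:
  assumes \<alpha>: "\<gamma> \<le> \<alpha>" and g: "g \<in> limit_hierarchy S \<gamma> B \<alpha>"
    and base: "\<And>h. h \<in> B \<Longrightarrow> Q h \<and> \<Psi> h \<in> B'"
    and lim: "\<And>h g. (\<And>n::nat. Q (h n)) \<Longrightarrow> (\<And>x. x \<in> S \<Longrightarrow> (\<lambda>n. h n x) \<longlonglongrightarrow> g x) \<Longrightarrow>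
      Q g \<and> (\<forall>y\<in>S'. (\<lambda>n. \<Psi> (h n) y) \<longlonglongrightarrow> \<Psi> g y)"
  shows "Q g \<and> \<Psi> g \<in> limit_hierarchy S' \<gamma> B' \<alpha>"
  using \<alpha> g
proof (induction rule: limit_hierarchy_induct)
  case (base h)
  then show ?case using assms(3) by simp
next
  case (step \<alpha> h g)
  then have "Q (h n)" for n by blast
  from lim[of h, OF this step(2)]
  have *: "Q g" "\<forall>y\<in>S'. (\<lambda>n. \<Psi> (h n) y) \<longlonglongrightarrow> \<Psi> g y" by blast+
  have "\<exists>\<beta>. \<gamma> \<le> \<beta> \<and> \<beta> < \<alpha> \<and> \<Psi> (h n) \<in> limit_hierarchy S' \<gamma> B' \<beta>" for n
    using step(3)[of n] by blast
  then have "\<Psi> g \<in> limit_hierarchy S' \<gamma> B' \<alpha>"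
    using *(2) unfolding limit_hierarchy_iff[OF step(1)]
    by (intro exI[of _ "\<lambda>n. \<Psi> (h n)"]) simp
  then show ?case using *(1) by blast
qed

lemma limit_hierarchy_compose:
  assumes "\<gamma> \<le> \<alpha>" "g \<in> limit_hierarchy S \<gamma> B \<alpha>" "s ` S' \<subseteq> S"
    and "\<And>h. h \<in> B \<Longrightarrow> h \<circ> s \<in> B'"
  shows "g \<circ> s \<in> limit_hierarchy S' \<gamma> B' \<alpha>"
  using limit_hierarchy_transport[of \<gamma> \<alpha> g S B "\<lambda>_. True" "\<lambda>h. h \<circ> s" B' S'] assms by auto

lemma limit_hierarchy_mono:
  assumes "\<gamma> \<le> \<alpha>" "g \<in> limit_hierarchy S \<gamma> B \<alpha>" "S' \<subseteq> S" "B \<subseteq> B'"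
  shows "g \<in> limit_hierarchy S' \<gamma> B' \<alpha>"
  using limit_hierarchy_transport[of \<gamma> \<alpha> g S B "\<lambda>_. True" "\<lambda>h. h" B' S'] assms by auto

lemma limit_hierarchy_cong:
  assumes "\<gamma> \<le> \<alpha>" "g \<in> limit_hierarchy S \<gamma> B \<alpha>" "\<And>x. x \<in> S \<Longrightarrow> g' x = g x"
    and B: "\<And>h h'. h \<in> B \<Longrightarrow> (\<And>x. x \<in> S \<Longrightarrow> h' x = h x) \<Longrightarrow> h' \<in> B"
  shows "g' \<in> limit_hierarchy S \<gamma> B \<alpha>"
proof (cases "\<alpha> = \<gamma>")
  case True
  then show ?thesis using assms by auto
next
  case False
  then have "\<gamma> < \<alpha>" using assms(1) by simp
  then show ?thesis
    using assms(2,3) unfolding limit_hierarchy_iff[OF \<open>\<gamma> < \<alpha>\<close>] by metis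
qed

text \<open>Functions of level 0 reappear at level 1 as limits of constant sequences, and nothing
  lies strictly between the two levels. This gives the Baire hierarchy the same starting level as
  \<open>Bof\<close>, so that the two can be compared through their first classes.\<close>

lemma limit_hierarchy_zero_one:
  assumes "1 \<le> \<alpha>"
  shows "limit_hierarchy S 0 B \<alpha> = limit_hierarchy S 1 (limit_hierarchy S 0 B 1) \<alpha>"
  using assms
proof (induction \<alpha> rule: less_induct)
  case (less \<alpha>)
  have 0: "0 < (1::omega1)" using omega1_one_le_iff[of 1] by simp
  show ?case
  proof (cases "\<alpha> = 1")
    case True
    then show ?thesis by simp
  next
    case False
    then have 1: "1 < \<alpha>" using less.prems by simp
    have B: "h \<in> limit_hierarchy S 0 B 1" if "h \<in> B" for h
      unfolding limit_hierarchy_iff[OF 0] using that 0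
      by (intro exI[of _ "\<lambda>_. h"]) (auto intro!: exI[of _ 0])
    have "(\<exists>\<beta>. 0 \<le> \<beta> \<and> \<beta> < \<alpha> \<and> h \<in> limit_hierarchy S 0 B \<beta>) \<longleftrightarrow>
          (\<exists>\<beta>. 1 \<le> \<beta> \<and> \<beta> < \<alpha> \<and> h \<in> limit_hierarchy S 1 (limit_hierarchy S 0 B 1) \<beta>)" for h
    proof
      assume "\<exists>\<beta>. 0 \<le> \<beta> \<and> \<beta> < \<alpha> \<and> h \<in> limit_hierarchy S 0 B \<beta>"
      then obtain \<beta> where \<beta>: "\<beta> < \<alpha>" "h \<in> limit_hierarchy S 0 B \<beta>" by blast
      show "\<exists>\<beta>. 1 \<le> \<beta> \<and> \<beta> < \<alpha> \<and> h \<in> limit_hierarchy S 1 (limit_hierarchy S 0 B 1) \<beta>"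
      proof (cases "1 \<le> \<beta>")
        case True
        then show ?thesis using \<beta> less.IH by blast
      next
        case False
        then have "\<beta> = 0"
          using omega1_one_le_iff[of \<beta>] omega1_zero_le[of \<beta>] by auto
        then show ?thesis
          using \<beta> B 1 by (intro exI[of _ 1]) auto
      qed
    next
      assume "\<exists>\<beta>. 1 \<le> \<beta> \<and> \<beta> < \<alpha> \<and> h \<in> limit_hierarchy S 1 (limit_hierarchy S 0 B 1) \<beta>"
      then show "\<exists>\<beta>. 0 \<le> \<beta> \<and> \<beta> < \<alpha> \<and> h \<in> limit_hierarchy S 0 B \<beta>"
        using less.IH omega1_zero_le by blast
    qed
    then show ?thesis
      using limit_hierarchy_iff[of 0 \<alpha> _ S B] limit_hierarchy_iff[OF 1, of _ S] 0 1
      by (intro set_eqI) (simp add: order_less_trans[OF 0 1])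
  qed
qed

section \<open>Truncation of a hierarchy to uniformly bounded functions\<close>

definition clip :: "real \<Rightarrow> complex \<Rightarrow> complex" where
  "clip M = closest_point (cball 0 M)"

lemma norm_clip_le: "0 \<le> M \<Longrightarrow> cmod (clip M z) \<le> M"
  using closest_point_in_set[of "cball 0 M :: complex set" z] by (auto simp: clip_def)

lemma clip_eq: "cmod z \<le> M \<Longrightarrow> clip M z = z"
  by (simp add: clip_def closest_point_self)

lemma continuous_on_clip: "0 \<le> M \<Longrightarrow> continuous_on UNIV (clip M)"
  unfolding clip_def by (intro continuous_on_closest_point) auto

text \<open>A bounded \<open>g\<close> may a priori arise from unbounded functions. The continuous
  retraction \<open>clip M\<close> onto the disc commutes with pointwise limits and fixes the values
  of \<open>g\<close>, so applying it throughout the hierarchy makes every function obey the bound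
  of \<open>g\<close>.\<close>

lemma limit_hierarchy_truncate:
  assumes \<alpha>: "\<gamma> \<le> \<alpha>" and g: "g \<in> limit_hierarchy S \<gamma> B \<alpha>"
    and M: "0 \<le> M" "\<And>x. x \<in> S \<Longrightarrow> cmod (g x) \<le> M"
    and clip: "\<And>h. h \<in> B \<Longrightarrow> clip M \<circ> h \<in> B"
    and cong: "\<And>h h'. h \<in> B \<Longrightarrow> (\<And>x. x \<in> S \<Longrightarrow> h' x = h x) \<Longrightarrow> h' \<in> B"
  shows "g \<in> limit_hierarchy S \<gamma> {h \<in> B. \<forall>x\<in>S. cmod (h x) \<le> M} \<alpha>"
proof -
  let ?B = "{h \<in> B. \<forall>x\<in>S. cmod (h x) \<le> M}"
  have "clip M \<circ> g \<in> limit_hierarchy S \<gamma> ?B \<alpha>"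
  proof (rule conjunct2[OF limit_hierarchy_transport[OF \<alpha> g, where Q = "\<lambda>_. True"]])
    fix h :: "nat \<Rightarrow> 'a \<Rightarrow> complex" and g assume "\<And>x. x \<in> S \<Longrightarrow> (\<lambda>n. h n x) \<longlonglongrightarrow> g x"
    then show "True \<and> (\<forall>y\<in>S. (\<lambda>n. (clip M \<circ> h n) y) \<longlonglongrightarrow> (clip M \<circ> g) y)"
      using continuous_on_tendsto_compose[OF continuous_on_clip[OF M(1)]] by auto
  qed (use clip[unfolded comp_def] M norm_clip_le in \<open>auto simp: comp_def\<close>)
  then show ?thesis
    by (rule limit_hierarchy_cong[OF \<alpha>]) (use M clip_eq cong in auto)
qed

section \<open>Lattices of sets and preimage classes\<close>

text \<open>The common structure of a topology and of \<open>Sigma2\<close> of an algebra;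
  complements are deliberately absent. It allows the passage from functions to their integrals to be
  proved once for all three families.\<close>

definition sigma_lattice :: "'a set \<Rightarrow> 'a set set \<Rightarrow> bool" where
  "sigma_lattice \<Omega> \<Sigma> \<longleftrightarrow> \<Omega> \<in> \<Sigma> \<and> \<Sigma> \<subseteq> Pow \<Omega> \<and> (\<forall>A\<in>\<Sigma>. \<forall>B\<in>\<Sigma>. A \<inter> B \<in> \<Sigma>) \<and>
     (\<forall>\<A>. countable \<A> \<and> \<A> \<subseteq> \<Sigma> \<longrightarrow> \<Union>\<A> \<in> \<Sigma>)"

lemma sigma_lattice_Int: "sigma_lattice \<Omega> \<Sigma> \<Longrightarrow> A \<in> \<Sigma> \<Longrightarrow> B \<in> \<Sigma> \<Longrightarrow> A \<inter> B \<in> \<Sigma>"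
  and sigma_lattice_Union: "sigma_lattice \<Omega> \<Sigma> \<Longrightarrow> countable \<A> \<Longrightarrow> \<A> \<subseteq> \<Sigma> \<Longrightarrow> \<Union>\<A> \<in> \<Sigma>"
  and sigma_lattice_space: "sigma_lattice \<Omega> \<Sigma> \<Longrightarrow> \<Omega> \<in> \<Sigma>"
  by (auto simp: sigma_lattice_def)

lemma sigma_lattice_empty: "sigma_lattice \<Omega> \<Sigma> \<Longrightarrow> {} \<in> \<Sigma>"
  using sigma_lattice_Union[of \<Omega> \<Sigma> "{}"] by simp

lemma sigma_lattice_UN:
  "sigma_lattice \<Omega> \<Sigma> \<Longrightarrow> countable I \<Longrightarrow> (\<And>i. i \<in> I \<Longrightarrow> A i \<in> \<Sigma>) \<Longrightarrow> (\<Union>i\<in>I. A i) \<in> \<Sigma>"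
  by (intro sigma_lattice_Union) auto

lemma sigma_lattice_openin: "sigma_lattice (topspace Y) (Collect (openin Y))"
  unfolding sigma_lattice_def
  by (intro conjI ballI allI impI subsetI) (auto simp: subset_eq intro!: openin_Union dest: openin_subset)

lemma subset_Sigma2: "\<F> \<subseteq> Sigma2 \<F>"
  unfolding Sigma2_def by (auto intro!: exI[of _ "{_}"])

lemma Sigma2_UN:
  assumes "countable I" "\<And>i. i \<in> I \<Longrightarrow> A i \<in> \<F>"
  shows "(\<Union>i\<in>I. A i) \<in> Sigma2 \<F>"
  using assms by (auto simp: Sigma2_def)

lemma sigma_lattice_Sigma2:
  assumes "algebra \<Omega> \<F>"
  shows "sigma_lattice \<Omega> (Sigma2 \<F>)"
proof -
  interpret algebra \<Omega> \<F> by fact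
  have "A \<inter> B \<in> Sigma2 \<F>" if "A \<in> Sigma2 \<F>" "B \<in> Sigma2 \<F>" for A B
  proof -
    obtain \<A> where A: "countable \<A>" "\<A> \<subseteq> \<F>" "A = \<Union>\<A>"
      using \<open>A \<in> Sigma2 \<F>\<close> by (auto simp: Sigma2_def)
    obtain \<B> where B: "countable \<B>" "\<B> \<subseteq> \<F>" "B = \<Union>\<B>"
      using \<open>B \<in> Sigma2 \<F>\<close> by (auto simp: Sigma2_def)
    note * = A B
    have "A \<inter> B = (\<Union>p\<in>\<A> \<times> \<B>. fst p \<inter> snd p)" using * by auto
    also have "\<dots> \<in> Sigma2 \<F>"
    proof (rule Sigma2_UN)
      show "fst p \<inter> snd p \<in> \<F>" if "p \<in> \<A> \<times> \<B>" for p using * that by (intro Int) auto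
    qed (use * in simp)
    finally show ?thesis .
  qed
  moreover have "\<Union>\<A> \<in> Sigma2 \<F>" if "countable \<A>" "\<A> \<subseteq> Sigma2 \<F>" for \<A>
  proof -
    have "\<forall>A\<in>\<A>. \<exists>\<B>. countable \<B> \<and> \<B> \<subseteq> \<F> \<and> \<Union>\<B> = A" using that by (auto simp: Sigma2_def)
    from bchoice[OF this] obtain \<B> where \<B>: "\<forall>A\<in>\<A>. countable (\<B> A) \<and> \<B> A \<subseteq> \<F> \<and> \<Union>(\<B> A) = A"
      by (elim exE)
    then have "\<Union>\<A> = (\<Union>A\<in>\<A>. \<Union>(\<B> A))" by simp
    also have "\<dots> = (\<Union>A\<in>(\<Union>A\<in>\<A>. \<B> A). A)" by auto
    also have "\<dots> \<in> Sigma2 \<F>" using \<B> that by (intro Sigma2_UN) auto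
    finally show ?thesis .
  qed
  moreover have "Sigma2 \<F> \<subseteq> Pow \<Omega>"
    using space_closed by (auto simp: Sigma2_def)
  ultimately show ?thesis
    using subsetD[OF subset_Sigma2 top] by (simp add: sigma_lattice_def)
qed

lemma preimage_class_cong:
  "h \<in> preimage_class Y \<Sigma> \<Longrightarrow> (\<And>x. x \<in> topspace Y \<Longrightarrow> h' x = h x) \<Longrightarrow> h' \<in> preimage_class Y \<Sigma>"
  unfolding preimage_class_def
  by (smt (verit, best) Collect_cong mem_Collect_eq)

lemma preimage_class_compose_continuous:
  assumes "h \<in> preimage_class Y \<Sigma>" "continuous_on UNIV \<phi>"
  shows "\<phi> \<circ> h \<in> preimage_class Y \<Sigma>"
proof -
  have "{x \<in> topspace Y. (\<phi> \<circ> h) x \<in> U} \<in> \<Sigma>" if "open U" for U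
  proof -
    have "open (\<phi> -` U)" using assms(2) that by (simp add: open_vimage)
    then have "{x \<in> topspace Y. h x \<in> \<phi> -` U} \<in> \<Sigma>"
      using assms(1) unfolding preimage_class_def by blast
    then show ?thesis by simp
  qed
  then show ?thesis by (simp add: preimage_class_def)
qed

text \<open>Puts continuity into the form shared by the base classes of \<open>Hf\<close> and
  \<open>Bof\<close>, so that the Baire case uses the same integration lemmas.\<close>

lemma continuous_map_eq_preimage_class:
  "{g. continuous_map Y euclidean g} = preimage_class Y (Collect (openin Y))"
  by (auto simp: preimage_class_def continuous_map_def)

lemma limit_hierarchy_preimage_class_truncate:
  assumes "\<gamma> \<le> \<alpha>" "g \<in> limit_hierarchy (topspace Y) \<gamma> (preimage_class Y \<Sigma>) \<alpha>"
    and "0 \<le> M" "\<And>x. x \<in> topspace Y \<Longrightarrow> cmod (g x) \<le> M"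
  shows "g \<in> limit_hierarchy (topspace Y) \<gamma>
    {h \<in> preimage_class Y \<Sigma>. \<forall>x\<in>topspace Y. cmod (h x) \<le> M} \<alpha>"
  using assms preimage_class_cong preimage_class_compose_continuous continuous_on_clip
  by (intro limit_hierarchy_truncate) blast+

text \<open>An open box is a finite intersection of half planes, and an open set is a countable
  union of open boxes. Both directions of each inequality are required since \<open>\<Sigma>\<close>
  need not be closed under complements.\<close>

lemma preimage_class_boxI:
  assumes \<Sigma>: "sigma_lattice (topspace Y) \<Sigma>"
    and "\<And>c. {x \<in> topspace Y. c < Re (h x)} \<in> \<Sigma>" "\<And>c. {x \<in> topspace Y. Re (h x) < c} \<in> \<Sigma>"
    and "\<And>c. {x \<in> topspace Y. c < Im (h x)} \<in> \<Sigma>" "\<And>c. {x \<in> topspace Y. Im (h x) < c} \<in> \<Sigma>"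
  shows "h \<in> preimage_class Y \<Sigma>"
  unfolding preimage_class_def
proof safe
  fix U :: "complex set" assume "open U"
  then obtain \<D> where \<D>: "countable \<D>" "\<D> \<subseteq> Pow U" "\<And>X. X \<in> \<D> \<Longrightarrow> \<exists>a b. X = box a b" "\<Union>\<D> = U"
    using open_countable_Union_open_box by metis
  have box: "{x \<in> topspace Y. h x \<in> X} \<in> \<Sigma>" if X: "X \<in> \<D>" for X
  proof -
    obtain a b where X: "X = box a b" using \<D>(3)[OF X] by (elim exE)
    have "{x \<in> topspace Y. h x \<in> X} =
      ({x \<in> topspace Y. Re a < Re (h x)} \<inter> {x \<in> topspace Y. Re (h x) < Re b}) \<inter>
      ({x \<in> topspace Y. Im a < Im (h x)} \<inter> {x \<in> topspace Y. Im (h x) < Im b})"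
      by (auto simp: X in_box_complex_iff)
    also have "\<dots> \<in> \<Sigma>"
      using assms by (intro sigma_lattice_Int[OF \<Sigma>]) auto
    finally show ?thesis .
  qed
  have "{x \<in> topspace Y. h x \<in> U} = (\<Union>X\<in>\<D>. {x \<in> topspace Y. h x \<in> X})"
    using \<D>(4) by auto
  also have "\<dots> \<in> \<Sigma>"
    using box \<D>(1) by (intro sigma_lattice_UN[OF \<Sigma>]) auto
  finally show "{x \<in> topspace Y. h x \<in> U} \<in> \<Sigma>" .
qed

section \<open>Resolvable sets and scattered partitions\<close>

lemma resolvable_openin: "openin Y A \<Longrightarrow> resolvable_in Y A"
  unfolding resolvable_in_def
proof (intro conjI allI impI)
  fix B assume A: "openin Y A" and B: "B \<subseteq> topspace Y \<and> B \<noteq> {}"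
  show "\<exists>U. openin (subtopology Y B) U \<and> U \<noteq> {} \<and> (U \<subseteq> A \<or> U \<inter> A = {})"
  proof (cases "A \<inter> B = {}")
    case True
    then show ?thesis using B by (intro exI[of _ B]) (auto simp: openin_subtopology_refl)
  next
    case False
    then show ?thesis using A by (intro exI[of _ "A \<inter> B"]) (auto simp: openin_subtopology_Int)
  qed
qed (simp add: openin_subset)

text \<open>For a union one shrinks twice: \<open>U\<close> decides membership in \<open>A\<close>,
  and inside \<open>U\<close> a relatively open \<open>V\<close> decides membership in
  \<open>A'\<close>.\<close>

lemma algebra_Hs: "algebra (topspace Y) (Hs Y)"
proof (unfold algebra_iff_Un Hs_def, safe)
  fix A x assume "resolvable_in Y A" "x \<in> A"
  then show "x \<in> topspace Y" by (auto simp: resolvable_in_def)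
next
  show "resolvable_in Y {}" by (simp add: resolvable_openin)
next
  fix A assume A: "resolvable_in Y A"
  show "resolvable_in Y (topspace Y - A)"
    unfolding resolvable_in_def
  proof (intro conjI allI impI)
    fix B assume B: "B \<subseteq> topspace Y \<and> B \<noteq> {}"
    with A obtain U where "openin (subtopology Y B) U" "U \<noteq> {}" "U \<subseteq> A \<or> U \<inter> A = {}"
      unfolding resolvable_in_def by blast
    moreover from this have "U \<subseteq> topspace Y" using openin_subset by fastforce
    ultimately show "\<exists>U. openin (subtopology Y B) U \<and> U \<noteq> {} \<and>
        (U \<subseteq> topspace Y - A \<or> U \<inter> (topspace Y - A) = {})" by blast
  qed auto
next
  fix A A' assume A: "resolvable_in Y A" "resolvable_in Y A'"
  show "resolvable_in Y (A \<union> A')"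
    unfolding resolvable_in_def
  proof (intro conjI allI impI)
    fix B assume B: "B \<subseteq> topspace Y \<and> B \<noteq> {}"
    with A(1) obtain U where U: "openin (subtopology Y B) U" "U \<noteq> {}" "U \<subseteq> A \<or> U \<inter> A = {}"
      unfolding resolvable_in_def by blast
    then have UB: "U \<subseteq> B" "U \<subseteq> topspace Y" using openin_subset by fastforce+
    with A(2) U obtain V where V: "openin (subtopology Y U) V" "V \<noteq> {}" "V \<subseteq> A' \<or> V \<inter> A' = {}"
      unfolding resolvable_in_def by blast
    then have "V \<subseteq> U" using openin_subset by fastforce
    have "openin (subtopology Y B) V"
      using V(1) U(1) UB by (metis inf.absorb_iff2 openin_trans_full subtopology_subtopology)
    then show "\<exists>U. openin (subtopology Y B) U \<and> U \<noteq> {} \<and> (U \<subseteq> A \<union> A' \<or> U \<inter> (A \<union> A') = {})"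
      using V U \<open>V \<subseteq> U\<close> by (intro exI[of _ V]) blast
  qed (use A in \<open>auto simp: resolvable_in_def\<close>)
qed

section \<open>Scattered partitions and fragmented functions\<close>

lemma openin_subtopology_trans:
  assumes "openin (subtopology Y B) U" "openin (subtopology Y U) V"
  shows "openin (subtopology Y B) V"
proof -
  have "U \<subseteq> B" using assms(1) openin_subset by fastforce
  then show ?thesis
    using assms by (metis inf.absorb_iff2 openin_trans_full subtopology_subtopology)
qed

text \<open>Replaces the differences of consecutive members of a well-ordered increasing sequence of
  open sets exhausting the space. The last clause encodes the well-ordering without ordinals: it
  plays the role of the first difference that meets \<open>B\<close>.\<close>

definition scattered_partition :: "'a topology \<Rightarrow> 'a set set \<Rightarrow> bool" where
  "scattered_partition Y \<P> \<longleftrightarrow> pairwise disjnt \<P> \<and> \<Union>\<P> = topspace Y \<and>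
     (\<forall>B. B \<subseteq> topspace Y \<and> B \<noteq> {} \<longrightarrow> (\<exists>P\<in>\<P>. openin (subtopology Y B) (P \<inter> B) \<and> P \<inter> B \<noteq> {}))"

lemma scattered_partition_Union: "scattered_partition Y \<P> \<Longrightarrow> \<Union>\<P> = topspace Y"
  and scattered_partition_disjoint:
    "scattered_partition Y \<P> \<Longrightarrow> P \<in> \<P> \<Longrightarrow> P' \<in> \<P> \<Longrightarrow> y \<in> P \<Longrightarrow> y \<in> P' \<Longrightarrow> P = P'"
  and scattered_partition_open: "scattered_partition Y \<P> \<Longrightarrow> B \<subseteq> topspace Y \<Longrightarrow> B \<noteq> {} \<Longrightarrow>
    \<exists>P\<in>\<P>. openin (subtopology Y B) (P \<inter> B) \<and> P \<inter> B \<noteq> {}"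
  by (simp_all add: scattered_partition_def pairwise_def disjnt_iff) blast

text \<open>A maximal partial partition with open union is total: otherwise a piece of the complement
  could be added.\<close>

lemma scattered_partition_exists:
  assumes Q: "\<And>B. B \<subseteq> topspace Y \<Longrightarrow> B \<noteq> {} \<Longrightarrow> \<exists>V. openin (subtopology Y B) V \<and> V \<noteq> {} \<and> Q V"
  shows "\<exists>\<P>. scattered_partition Y \<P> \<and> (\<forall>P\<in>\<P>. Q P)"
proof -
  define good where "good \<P> \<longleftrightarrow> pairwise disjnt \<P> \<and> openin Y (\<Union>\<P>) \<and> (\<forall>P\<in>\<P>. Q P) \<and>
    (\<forall>B. B \<subseteq> topspace Y \<and> B \<inter> \<Union>\<P> \<noteq> {} \<longrightarrow>
       (\<exists>P\<in>\<P>. openin (subtopology Y B) (P \<inter> B) \<and> P \<inter> B \<noteq> {}))" for \<P>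
  have "\<exists>M\<in>Collect good. \<forall>X\<in>Collect good. M \<subseteq> X \<longrightarrow> X = M"
  proof (rule subset_Zorn_nonempty)
    have "good {}" by (simp add: good_def)
    then show "Collect good \<noteq> {}" by blast
  next
    fix \<C> assume \<C>: "\<C> \<noteq> {}" "subset.chain (Collect good) \<C>"
    then have g: "good \<P>" if "\<P> \<in> \<C>" for \<P> using that by (auto simp: subset_chain_def)
    have chain: "\<P> \<subseteq> \<P>' \<or> \<P>' \<subseteq> \<P>" if "\<P> \<in> \<C>" "\<P>' \<in> \<C>" for \<P> \<P>'
      using \<C> that by (auto simp: subset_chain_def)
    have "good (\<Union>\<C>)"
      unfolding good_def
    proof (intro conjI allI impI)
      show "pairwise disjnt (\<Union>\<C>)"
      proof (rule pairwiseI)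
        fix A B assume "A \<in> \<Union>\<C>" "B \<in> \<Union>\<C>" "A \<noteq> B"
        then obtain \<P> where "\<P> \<in> \<C>" "A \<in> \<P>" "B \<in> \<P>" using chain by blast
        then show "disjnt A B" using g \<open>A \<noteq> B\<close> unfolding good_def pairwise_def by blast
      qed
      have "\<Union>(\<Union>\<C>) = \<Union>(Union ` \<C>)" by blast
      also have "openin Y \<dots>" using g by (intro openin_Union) (auto simp: good_def)
      finally show "openin Y (\<Union>(\<Union>\<C>))" .
      show "\<forall>P\<in>\<Union>\<C>. Q P" using g by (auto simp: good_def)
    next
      fix B assume B: "B \<subseteq> topspace Y \<and> B \<inter> \<Union>(\<Union>\<C>) \<noteq> {}"
      then obtain \<P> where "\<P> \<in> \<C>" "B \<inter> \<Union>\<P> \<noteq> {}" by blast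
      then show "\<exists>P\<in>\<Union>\<C>. openin (subtopology Y B) (P \<inter> B) \<and> P \<inter> B \<noteq> {}"
        using g[of \<P>] B unfolding good_def by blast
    qed
    then show "\<Union>\<C> \<in> Collect good" by simp
  qed
  then obtain \<P> where \<P>: "good \<P>" and max: "\<And>\<P>'. good \<P>' \<Longrightarrow> \<P> \<subseteq> \<P>' \<Longrightarrow> \<P>' = \<P>" by auto
  have "\<Union>\<P> = topspace Y"
  proof (rule ccontr)
    assume ne: "\<Union>\<P> \<noteq> topspace Y"
    have op: "openin Y (\<Union>\<P>)" using \<P> by (simp add: good_def)
    define B where "B = topspace Y - \<Union>\<P>"
    have "B \<subseteq> topspace Y" "B \<noteq> {}" using ne openin_subset[OF op] by (auto simp: B_def)
    from Q[OF this] obtain V where V: "openin (subtopology Y B) V" "V \<noteq> {}" "Q V" by blast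
    then obtain W where W: "openin Y W" "V = W \<inter> B" by (auto simp: openin_subtopology)
    then have VU: "V \<inter> \<Union>\<P> = {}" "V \<subseteq> topspace Y" by (auto simp: B_def)
    \<comment> \<open>The new piece \<open>V\<close> need not be open, but together with the old
      open union it fills the open set \<open>\<Union>\<P> \<union> W\<close>.\<close>
    have un: "\<Union>(insert V \<P>) = \<Union>\<P> \<union> W"
      using W openin_subset[OF W(1)] by (auto simp: B_def)
    have "good (insert V \<P>)"
      unfolding good_def
    proof (intro conjI allI impI)
      show "pairwise disjnt (insert V \<P>)"
        using \<P> VU unfolding good_def pairwise_insert by (auto simp: disjnt_def)
      show "openin Y (\<Union>(insert V \<P>))" unfolding un using op W by auto
      show "\<forall>P\<in>insert V \<P>. Q P" using \<P> V by (auto simp: good_def)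
    next
      fix C assume C: "C \<subseteq> topspace Y \<and> C \<inter> \<Union>(insert V \<P>) \<noteq> {}"
      show "\<exists>P\<in>insert V \<P>. openin (subtopology Y C) (P \<inter> C) \<and> P \<inter> C \<noteq> {}"
      proof (cases "C \<inter> \<Union>\<P> = {}")
        case True
        then have "V \<inter> C = W \<inter> C" using W C by (auto simp: B_def)
        then have "openin (subtopology Y C) (V \<inter> C)" "V \<inter> C \<noteq> {}"
          using W(1) True C by (auto simp: openin_subtopology_Int)
        then show ?thesis by blast
      next
        case False
        then show ?thesis using \<P> C unfolding good_def by blast
      qed
    qed
    then have "V \<in> \<P>" using max by blast
    then show False using VU V(2) by blast
  qed
  then have "scattered_partition Y \<P>"
    using \<P> unfolding scattered_partition_def good_def by (metis inf.absorb1)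
  then show ?thesis using \<P> by (auto simp: good_def)
qed

text \<open>The piece that is relatively open in \<open>B\<close> either belongs to
  \<open>\<Q>\<close> or is disjoint from all members of \<open>\<Q>\<close>. No bound on the number
  of pieces is involved, so arbitrary selections of pieces give resolvable sets.\<close>

lemma scattered_partition_resolvable:
  assumes P: "scattered_partition Y \<P>" and "\<Q> \<subseteq> \<P>"
  shows "resolvable_in Y (\<Union>\<Q>)"
  unfolding resolvable_in_def
proof (intro conjI allI impI)
  show "\<Union>\<Q> \<subseteq> topspace Y" using assms(2) scattered_partition_Union[OF P] by blast
  fix B assume "B \<subseteq> topspace Y \<and> B \<noteq> {}"
  then obtain P where P': "P \<in> \<P>" "openin (subtopology Y B) (P \<inter> B)" "P \<inter> B \<noteq> {}"
    using scattered_partition_open[OF P] by blast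
  have "P \<subseteq> \<Union>\<Q> \<or> P \<inter> \<Union>\<Q> = {}"
  proof (cases "P \<in> \<Q>")
    case False
    then show ?thesis
      using scattered_partition_disjoint[OF P P'(1)] \<open>\<Q> \<subseteq> \<P>\<close> by blast
  qed blast
  then show "\<exists>U. openin (subtopology Y B) U \<and> U \<noteq> {} \<and> (U \<subseteq> \<Union>\<Q> \<or> U \<inter> \<Union>\<Q> = {})"
    using P'(2,3) by blast
qed

text \<open>The real-valued analogue of resolvability: for a subset of the space, its indicator is
  fragmented exactly when the set is resolvable.\<close>

definition fragmented :: "'a topology \<Rightarrow> ('a \<Rightarrow> real) \<Rightarrow> bool" where
  "fragmented Y \<phi> \<longleftrightarrow> (\<forall>B \<epsilon>. B \<subseteq> topspace Y \<and> B \<noteq> {} \<and> 0 < \<epsilon> \<longrightarrow>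
     (\<exists>V. openin (subtopology Y B) V \<and> V \<noteq> {} \<and> (\<forall>x\<in>V. \<forall>y\<in>V. \<bar>\<phi> x - \<phi> y\<bar> < \<epsilon>)))"

text \<open>For each \<open>n\<close>, partition the space into pieces of oscillation below
  \<open>1 / Suc n\<close> and collect the pieces that meet \<open>{c + 1 / Suc n < \<phi>}\<close>.
  This resolvable set lies between that superlevel set and \<open>{c < \<phi>}\<close>; the union
  over \<open>n\<close> is the latter.\<close>

lemma fragmented_superlevel:
  assumes "fragmented Y \<phi>"
  shows "{x \<in> topspace Y. c < \<phi> x} \<in> Sigma2 (Hs Y)"
proof -
  have "\<exists>R. resolvable_in Y R \<and> {x \<in> topspace Y. c + 1 / Suc n < \<phi> x} \<subseteq> R \<and>
      R \<subseteq> {x \<in> topspace Y. c < \<phi> x}" for n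
  proof -
    let ?\<epsilon> = "1 / real (Suc n)"
    have "\<exists>V. openin (subtopology Y B) V \<and> V \<noteq> {} \<and> (\<forall>x\<in>V. \<forall>y\<in>V. \<bar>\<phi> x - \<phi> y\<bar> < ?\<epsilon>)"
      if "B \<subseteq> topspace Y" "B \<noteq> {}" for B
      using assms[unfolded fragmented_def, rule_format, of B ?\<epsilon>] that by simp
    then have "\<exists>\<P>. scattered_partition Y \<P> \<and> (\<forall>P\<in>\<P>. \<forall>x\<in>P. \<forall>y\<in>P. \<bar>\<phi> x - \<phi> y\<bar> < ?\<epsilon>)"
      by (rule scattered_partition_exists)
    then obtain \<P> where \<P>: "scattered_partition Y \<P>"
      "\<forall>P\<in>\<P>. \<forall>x\<in>P. \<forall>y\<in>P. \<bar>\<phi> x - \<phi> y\<bar> < ?\<epsilon>" by (elim exE conjE)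
    let ?R = "\<Union>{P\<in>\<P>. \<exists>x\<in>P. c + ?\<epsilon> < \<phi> x}"
    have "resolvable_in Y ?R"
      by (rule scattered_partition_resolvable[OF \<P>(1)]) auto
    moreover have "{x \<in> topspace Y. c + ?\<epsilon> < \<phi> x} \<subseteq> ?R"
      using scattered_partition_Union[OF \<P>(1)] by auto
    moreover have "?R \<subseteq> {x \<in> topspace Y. c < \<phi> x}"
    proof
      fix y assume "y \<in> ?R"
      then obtain P x where P: "P \<in> \<P>" "x \<in> P" "y \<in> P" "c + ?\<epsilon> < \<phi> x" by auto
      then have "\<bar>\<phi> x - \<phi> y\<bar> < ?\<epsilon>" using \<P>(2) by blast
      moreover have "y \<in> topspace Y" using P scattered_partition_Union[OF \<P>(1)] by auto
      ultimately show "y \<in> {x \<in> topspace Y. c < \<phi> x}" using P(4) by auto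
    qed
    ultimately show ?thesis by blast
  qed
  then have "\<forall>n. \<exists>R. resolvable_in Y R \<and> {x \<in> topspace Y. c + 1 / Suc n < \<phi> x} \<subseteq> R \<and>
      R \<subseteq> {x \<in> topspace Y. c < \<phi> x}" by (rule allI)
  from choice[OF this] obtain R where R': "\<forall>n. resolvable_in Y (R n) \<and>
      {x \<in> topspace Y. c + 1 / Suc n < \<phi> x} \<subseteq> R n \<and> R n \<subseteq> {x \<in> topspace Y. c < \<phi> x}" by (elim exE)
  have R: "resolvable_in Y (R n)" "{x \<in> topspace Y. c + 1 / Suc n < \<phi> x} \<subseteq> R n"
      "R n \<subseteq> {x \<in> topspace Y. c < \<phi> x}" for n using R' by blast+
  have "{x \<in> topspace Y. c < \<phi> x} = (\<Union>n. R n)"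
  proof
    show "{x \<in> topspace Y. c < \<phi> x} \<subseteq> (\<Union>n. R n)"
    proof
      fix x assume x: "x \<in> {x \<in> topspace Y. c < \<phi> x}"
      then obtain n where "1 / Suc n < \<phi> x - c"
        using nat_approx_posE[of "\<phi> x - c"] by auto
      then have "x \<in> R n" using R(2)[of n] x by auto
      then show "x \<in> (\<Union>n. R n)" by blast
    qed
  qed (use R(3) in blast)
  also have "\<dots> \<in> Sigma2 (Hs Y)"
    using R(1) by (intro Sigma2_UN) (auto simp: Hs_def)
  finally show ?thesis .
qed

section \<open>The algebra generated by the open sets\<close>

lemma Bos_openin: "openin Y U \<Longrightarrow> U \<in> Bos Y"
  by (auto simp: Bos_def)

lemma Bos_induct:
  assumes "A \<in> Bos Y" "algebra (topspace Y) {A. A \<subseteq> topspace Y \<and> P A}" "\<And>U. openin Y U \<Longrightarrow> P U"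
  shows "P A"
  using assms unfolding Bos_def by (auto dest: openin_subset)

lemma algebra_Bos: "algebra (topspace Y) (Bos Y)"
proof -
  have *: "algebra (topspace Y) (Pow (topspace Y))" by (rule algebra_Pow)
  have "Bos Y \<subseteq> Pow (topspace Y)"
    unfolding Bos_def using * by (intro Inter_lower) (auto dest: openin_subset)
  then show ?thesis
    unfolding algebra_iff_Un by (auto simp: Bos_def algebra_iff_Un)
qed

section \<open>Sections of continuous surjections between compact spaces\<close>

text \<open>The sets \<open>C n\<close> shrink the fibres so much that a point of \<open>\<Inter>n. C n\<close> lies in the \<open>n\<close>-th set of
  \<open>\<G>\<close> or not depending only on its image in \<open>Y\<close>.\<close>

lemma section_of_shrinking:
  assumes X: "compact_space X" and "countable \<G>"
    and I0: "I (topspace X)"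
    and fibre: "\<And>C y. I C \<Longrightarrow> y \<in> topspace Y \<Longrightarrow>
      closedin X {x \<in> C. x \<in> topspace X \<and> r x = y} \<and> {x \<in> C. x \<in> topspace X \<and> r x = y} \<noteq> {}"
    and step: "\<And>C G. I C \<Longrightarrow> G \<in> \<G> \<Longrightarrow> \<exists>C'\<subseteq>C. I C' \<and> (\<exists>A\<in>\<A>. \<forall>x\<in>C'. x \<in> G \<longleftrightarrow> r x \<in> A)"
    and \<A>: "\<A> \<subseteq> Pow (topspace Y)"
  shows "\<exists>s. (\<forall>y\<in>topspace Y. s y \<in> topspace X \<and> r (s y) = y) \<and>
             (\<forall>G\<in>\<G>. {y \<in> topspace Y. s y \<in> G} \<in> \<A>)"
proof (cases "\<G> = {}")
  case True
  have "\<exists>x. x \<in> topspace X \<and> r x = y" if "y \<in> topspace Y" for y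
    using fibre[OF I0 that] by blast
  then obtain s where "\<And>y. y \<in> topspace Y \<Longrightarrow> s y \<in> topspace X \<and> r (s y) = y" by metis
  then show ?thesis using True by blast
next
  case False
  define G where "G = from_nat_into \<G>"
  have G: "G n \<in> \<G>" for n using False by (simp add: G_def from_nat_into)
  \<comment> \<open>The passage from \<open>C n\<close> to \<open>C (Suc n)\<close> settles
    membership in the \<open>n\<close>-th set of \<open>\<G>\<close>. Later shrinking cannot undo
    this, since the sets decrease.\<close>
  have "\<exists>C. \<forall>n. I (C n) \<and> (C (Suc n) \<subseteq> C n \<and> (\<exists>A\<in>\<A>. \<forall>x\<in>C (Suc n). x \<in> G n \<longleftrightarrow> r x \<in> A))"
  proof (rule dependent_nat_choice)
    show "\<exists>C. I C" using I0 by blast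
    show "\<exists>C'. I C' \<and> (C' \<subseteq> C \<and> (\<exists>A\<in>\<A>. \<forall>x\<in>C'. x \<in> G n \<longleftrightarrow> r x \<in> A))" if "I C" for C n
      using step[OF that G[of n]] by blast
  qed
  then obtain C where C: "\<And>n. I (C n)" "\<And>n. C (Suc n) \<subseteq> C n"
      "\<And>n. \<exists>A\<in>\<A>. \<forall>x\<in>C (Suc n). x \<in> G n \<longleftrightarrow> r x \<in> A" by blast
  have "\<exists>x. x \<in> topspace X \<and> r x = y \<and> (\<forall>n. x \<in> C n)" if y: "y \<in> topspace Y" for y
  proof -
    \<comment> \<open>On a single fibre the traces of the \<open>C n\<close> are closed, nonempty
      and decreasing; compactness provides the value of the section, although the \<open>C n\<close>
      themselves need not be closed.\<close>
    have "(\<Inter>n. {x \<in> C n. x \<in> topspace X \<and> r x = y}) \<noteq> {}"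
    proof (rule compact_space_imp_nest[OF X])
      show "decseq (\<lambda>n. {x \<in> C n. x \<in> topspace X \<and> r x = y})"
        using C(2) by (intro decseq_SucI) auto
    qed (use fibre[OF C(1) y] in auto)
    then show ?thesis by blast
  qed
  then obtain s where s: "\<And>y. y \<in> topspace Y \<Longrightarrow> s y \<in> topspace X \<and> r (s y) = y \<and> (\<forall>n. s y \<in> C n)"
    by metis
  have "{y \<in> topspace Y. s y \<in> H} \<in> \<A>" if H: "H \<in> \<G>" for H
  proof -
    obtain n where n: "H = G n"
      using from_nat_into_surj[OF \<open>countable \<G>\<close> H] by (auto simp: G_def)
    obtain A where A: "A \<in> \<A>" "\<forall>x\<in>C (Suc n). x \<in> G n \<longleftrightarrow> r x \<in> A" using C(3) by blast
    have "{y \<in> topspace Y. s y \<in> H} = A"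
    proof (intro set_eqI iffI)
      fix y assume "y \<in> A"
      moreover from this have "y \<in> topspace Y" using A(1) \<A> by blast
      ultimately show "y \<in> {y \<in> topspace Y. s y \<in> H}"
        using A(2) s[of y] unfolding n by auto
    next
      fix y assume "y \<in> {y \<in> topspace Y. s y \<in> H}"
      then show "y \<in> A" using A(2) s[of y] unfolding n by auto
    qed
    then show ?thesis using A by simp
  qed
  then show ?thesis using s by blast
qed

lemma closedin_fibre:
  assumes "continuous_map X Y r" "Hausdorff_space Y" "y \<in> topspace Y"
  shows "closedin X {x \<in> topspace X. r x = y}"
proof -
  have "closedin Y {y}" using assms by (simp add: closedin_Hausdorff_singleton)
  then have "closedin X {x \<in> topspace X. r x \<in> {y}}"
    by (rule closedin_continuous_map_preimage[OF assms(1)])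
  then show ?thesis by simp
qed

text \<open>Choose a point outside the open set whenever the fibre permits it.\<close>

lemma Bos_section:
  assumes X: "compact_space X" and Y: "Hausdorff_space Y" and r: "continuous_map X Y r"
    and onto: "r ` topspace X = topspace Y"
    and \<G>: "countable \<G>" "\<And>G. G \<in> \<G> \<Longrightarrow> openin X G"
  shows "\<exists>s. (\<forall>y\<in>topspace Y. s y \<in> topspace X \<and> r (s y) = y) \<and>
             (\<forall>G\<in>\<G>. {y \<in> topspace Y. s y \<in> G} \<in> Bos Y)"
proof -
  interpret algebra "topspace Y" "Bos Y" by (rule algebra_Bos)
  have cl: "closed_map X Y r" using r X Y by (rule continuous_imp_closed_map)
  \<comment> \<open>\<open>lc C P\<close> says that above \<open>P\<close> the set \<open>C\<close>
    agrees with a closed set. The shrunken sets lose closedness because the choice differs above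
    different parts of \<open>Y\<close>; a finite cover by sets of \<open>Bos Y\<close> with
    \<open>lc\<close> still yields closed fibres and survives the next shrinking.\<close>
  define lc where "lc C P \<longleftrightarrow> (\<exists>D. closedin X D \<and> (\<forall>x\<in>topspace X. r x \<in> P \<longrightarrow> (x \<in> C \<longleftrightarrow> x \<in> D)))" for C P
  define I where "I C \<longleftrightarrow> C \<subseteq> topspace X \<and> r ` C = topspace Y \<and>
    (\<exists>\<P>. finite \<P> \<and> \<P> \<subseteq> Bos Y \<and> \<Union>\<P> = topspace Y \<and> (\<forall>P\<in>\<P>. lc C P))" for C
  show ?thesis
  proof (rule section_of_shrinking[where I = I])
    show "I (topspace X)"
      unfolding I_def lc_def using onto
      by (auto intro!: exI[of _ "{topspace Y}"] exI[of _ "topspace X"])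
    show "closedin X {x \<in> C. x \<in> topspace X \<and> r x = y} \<and> {x \<in> C. x \<in> topspace X \<and> r x = y} \<noteq> {}"
      if C: "I C" and y: "y \<in> topspace Y" for C y
    proof -
      obtain P where "y \<in> P" "lc C P" using C y unfolding I_def by blast
      then obtain D where D: "closedin X D" "\<And>x. x \<in> topspace X \<Longrightarrow> r x \<in> P \<Longrightarrow> x \<in> C \<longleftrightarrow> x \<in> D"
        unfolding lc_def by blast
      have "{x \<in> C. x \<in> topspace X \<and> r x = y} = D \<inter> {x \<in> topspace X. r x = y}"
        using D(2) \<open>y \<in> P\<close> by auto
      then have "closedin X {x \<in> C. x \<in> topspace X \<and> r x = y}"
        using D(1) closedin_fibre[OF r Y y] by auto
      moreover have "y \<in> r ` C" "C \<subseteq> topspace X" using C y by (simp_all add: I_def)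
      ultimately show ?thesis by auto
    qed
    show "Bos Y \<subseteq> Pow (topspace Y)" using space_closed .
  next
    fix C G assume C: "I C" and G: "G \<in> \<G>"
    \<comment> \<open>\<open>A\<close> consists of the points whose entire fibre in \<open>C\<close>
      lies in \<open>G\<close>. Only there is a point of \<open>G\<close> kept; elsewhere the fibre
      still has a point outside \<open>G\<close>.\<close>
    define A where "A = {y \<in> topspace Y. \<forall>z\<in>C. r z = y \<longrightarrow> z \<in> G}"
    define C' where "C' = {x \<in> C. x \<in> G \<longrightarrow> r x \<in> A}"
    obtain \<P> where \<P>: "finite \<P>" "\<P> \<subseteq> Bos Y" "\<Union>\<P> = topspace Y" "\<And>P. P \<in> \<P> \<Longrightarrow> lc C P"
      using C unfolding I_def by (elim conjE exE) simp
    have CX: "C \<subseteq> topspace X" "r ` C = topspace Y" using C by (simp_all add: I_def)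
    have key: "P \<inter> A \<in> Bos Y \<and> P - A \<in> Bos Y \<and> lc C' (P \<inter> A) \<and> lc C' (P - A)" if P: "P \<in> \<P>" for P
    proof -
      obtain D where D: "closedin X D" "\<And>x. x \<in> topspace X \<Longrightarrow> r x \<in> P \<Longrightarrow> x \<in> C \<longleftrightarrow> x \<in> D"
        using \<P>(4)[OF P] unfolding lc_def by blast
      have cD: "closedin X (D - G)" using D(1) \<G>(2)[OF G] by (rule closedin_diff)
      then have "closedin Y (r ` (D - G))" using cl by (simp add: closed_map_def)
      then have "topspace Y - r ` (D - G) \<in> Bos Y" by (intro Bos_openin) auto
      moreover have PB: "P \<in> Bos Y" "P \<subseteq> topspace Y" using P \<P> by auto
      \<comment> \<open>Above \<open>P\<close> the fibres of \<open>C\<close> are those of the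
        closed set \<open>D\<close>, so a point of \<open>P\<close> fails to be in \<open>A\<close>
        exactly when it lies in the image of \<open>D - G\<close>, which is closed because
        \<open>r\<close> is a closed map.\<close>
      moreover have PA: "P \<inter> A = P \<inter> (topspace Y - r ` (D - G))"
      proof (intro set_eqI iffI)
        fix y assume y: "y \<in> P \<inter> A"
        then have "y \<notin> r ` (D - G)"
          using D closedin_subset[OF D(1)] by (auto simp: A_def)
        then show "y \<in> P \<inter> (topspace Y - r ` (D - G))" using y PB by auto
      next
        fix y assume y: "y \<in> P \<inter> (topspace Y - r ` (D - G))"
        then show "y \<in> P \<inter> A" using D CX by (auto simp: A_def image_iff)
      qed
      ultimately have "P \<inter> A \<in> Bos Y" by (simp only: Int)
      moreover from this have "P - (P \<inter> A) \<in> Bos Y" using PB by (intro Diff)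
      then have "P - A \<in> Bos Y" by (simp only: Diff_Int_distrib Diff_Int Diff_cancel Un_empty_left)
      moreover have "lc C' (P \<inter> A)"
        unfolding lc_def using D by (intro exI[of _ D]) (auto simp: C'_def)
      moreover have "lc C' (P - A)"
        unfolding lc_def using cD D(2) by (intro exI[of _ "D - G"]) (auto simp: C'_def)
      ultimately show ?thesis by blast
    qed
    \<comment> \<open>Here finiteness of the cover matters: \<open>Bos Y\<close> is only an
      algebra.\<close>
    have "A = (\<Union>P\<in>\<P>. P \<inter> A)" using \<P>(3) by (auto simp: A_def)
    also have "\<dots> \<in> Bos Y" using key \<P>(1) by (intro finite_UN) auto
    finally have AB: "A \<in> Bos Y" .
    have onto': "r ` C' = topspace Y"
    proof
      show "topspace Y \<subseteq> r ` C'"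
      proof
        fix y assume y: "y \<in> topspace Y"
        show "y \<in> r ` C'"
        proof (cases "y \<in> A")
          case True
          then show ?thesis using CX y by (force simp: C'_def)
        next
          case False
          then show ?thesis using y by (auto simp: C'_def A_def)
        qed
      qed
    qed (use CX in \<open>auto simp: C'_def\<close>)
    have "I C'"
      unfolding I_def
    proof (intro conjI exI)
      let ?P = "(\<lambda>P. P \<inter> A) ` \<P> \<union> (\<lambda>P. P - A) ` \<P>"
      show "finite ?P" using \<P> by simp
      show "?P \<subseteq> Bos Y" "\<forall>P\<in>?P. lc C' P" using key by auto
      show "\<Union>?P = topspace Y" using \<P>(3) by auto
      show "r ` C' = topspace Y" by (rule onto')
    qed (use CX in \<open>auto simp: C'_def\<close>)
    moreover have "\<forall>x\<in>C'. x \<in> G \<longleftrightarrow> r x \<in> A" by (auto simp: C'_def A_def)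
    moreover have "C' \<subseteq> C" by (auto simp: C'_def)
    ultimately show "\<exists>C'\<subseteq>C. I C' \<and> (\<exists>A\<in>Bos Y. \<forall>x\<in>C'. x \<in> G \<longleftrightarrow> r x \<in> A)"
      by (intro exI[of _ C'] conjI bexI[OF _ AB]) simp_all
  qed (use assms in auto)
qed

text \<open>Zorn's lemma is applied upwards to the open sets that can be removed from
  \<open>D\<close> while still covering \<open>V\<close>. A chain of them passes to its union
  because each fibre over a point of \<open>V\<close> is closed in a compact space. Minimality makes
  \<open>r\<close> irreducible on \<open>E\<close> over \<open>V\<close>: removing an open set that
  meets \<open>E\<close> uncovers a point of \<open>V\<close>.\<close>

lemma minimal_closed_cover:
  assumes X: "compact_space X" and Y: "Hausdorff_space Y" and r: "continuous_map X Y r"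
    and D: "closedin X D" "V \<subseteq> r ` D" "V \<subseteq> topspace Y"
  obtains E where "closedin X E" "E \<subseteq> D" "V \<subseteq> r ` E"
    "\<And>E'. closedin X E' \<Longrightarrow> E' \<subseteq> E \<Longrightarrow> V \<subseteq> r ` E' \<Longrightarrow> E' = E"
proof -
  define \<F> where "\<F> = {U. openin X U \<and> V \<subseteq> r ` (D - U)}"
  have "\<exists>M\<in>\<F>. \<forall>U\<in>\<F>. M \<subseteq> U \<longrightarrow> U = M"
  proof (rule subset_Zorn_nonempty)
    have "{} \<in> \<F>" using D by (simp add: \<F>_def)
    then show "\<F> \<noteq> {}" by blast
  next
    fix \<C> assume \<C>: "\<C> \<noteq> {}" "subset.chain \<F> \<C>"
    then have \<C>F: "\<C> \<subseteq> \<F>" and chain: "\<And>U U'. U \<in> \<C> \<Longrightarrow> U' \<in> \<C> \<Longrightarrow> U \<subseteq> U' \<or> U' \<subseteq> U"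
      by (auto simp: subset_chain_def)
    have "v \<in> r ` (D - \<Union>\<C>)" if v: "v \<in> V" for v
    proof -
      let ?f = "\<lambda>U. (D - U) \<inter> {x \<in> topspace X. r x = v}"
      have DX: "D \<subseteq> topspace X" using D(1) by (rule closedin_subset)
      have "\<Inter>(?f ` \<C>) \<noteq> {}"
      proof (rule compact_space_fip[THEN iffD1, OF X, rule_format], intro conjI ballI allI impI)
        fix K assume "K \<in> ?f ` \<C>"
        then show "closedin X K"
          using \<C>F D closedin_fibre[OF r Y] v by (auto simp: \<F>_def intro!: closedin_Int closedin_diff)
      next
        fix \<K> assume fin: "finite \<K> \<and> \<K> \<subseteq> ?f ` \<C>"
        then obtain \<D> where \<D>: "finite \<D>" "\<D> \<subseteq> \<C>" "\<K> = ?f ` \<D>" by (meson finite_subset_image)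
        show "\<Inter>\<K> \<noteq> {}"
        proof (cases "\<D> = {}")
          case False
          have "\<Union>\<D> \<in> \<C>"
            using \<D>(1) False \<D>(2)
          proof (induction rule: finite_ne_induct)
            case (insert U \<U>)
            then have "U \<union> \<Union>\<U> = U \<or> U \<union> \<Union>\<U> = \<Union>\<U>" using chain[of U "\<Union>\<U>"] by blast
            then show ?case using insert by auto
          qed auto
          then have "v \<in> r ` (D - \<Union>\<D>)" using \<C>F v by (auto simp: \<F>_def)
          then obtain x where "x \<in> D - \<Union>\<D>" "r x = v" by blast
          then have "x \<in> \<Inter>\<K>" using \<D>(3) DX by auto
          then show ?thesis by blast
        qed (use \<D> in auto)
      qed
      then obtain x where "x \<in> \<Inter>(?f ` \<C>)" by blast
      then have "x \<in> D - \<Union>\<C>" "r x = v" using \<open>\<C> \<noteq> {}\<close> by auto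
      then show ?thesis by blast
    qed
    moreover have "openin X (\<Union>\<C>)" using \<C>F by (intro openin_Union) (auto simp: \<F>_def)
    ultimately show "\<Union>\<C> \<in> \<F>" by (auto simp: \<F>_def)
  qed
  then obtain M where M: "openin X M" "V \<subseteq> r ` (D - M)"
    and max: "\<And>U. openin X U \<Longrightarrow> V \<subseteq> r ` (D - U) \<Longrightarrow> M \<subseteq> U \<Longrightarrow> U = M" by (auto simp: \<F>_def)
  show ?thesis
  proof (rule that[of "D - M"])
    fix E' assume E': "closedin X E'" "E' \<subseteq> D - M" "V \<subseteq> r ` E'"
    have "D - (topspace X - E') = E'"
      using E' closedin_subset[OF E'(1)] closedin_subset[OF D(1)] by blast
    then have "topspace X - E' = M"
      using max[of "topspace X - E'"] E' openin_subset[OF M(1)] by auto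
    then show "E' = D - M" using E' closedin_subset[OF D(1)] by blast
  qed (use D M in \<open>auto intro: closedin_diff\<close>)
qed

text \<open>A resolvable \<open>R\<close> is decided only on small relatively open sets upstairs,
  and these must be pushed down to \<open>Y\<close>. Take \<open>E\<close> closed and minimal above
  a piece \<open>V0\<close>, and let \<open>W\<close> be a nonempty relatively open part of
  \<open>E\<close> above \<open>V0\<close> lying inside or outside \<open>R\<close>. By minimality
  the points of \<open>V0\<close> whose whole fibre in \<open>E\<close> lies in \<open>W\<close>
  form a nonempty relatively open set.\<close>

lemma Hs_section:
  assumes X: "compact_space X" and Y: "Hausdorff_space Y" and r: "continuous_map X Y r"
    and onto: "r ` topspace X = topspace Y"
    and \<G>: "countable \<G>" "\<And>G. G \<in> \<G> \<Longrightarrow> resolvable_in X G"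
  shows "\<exists>s. (\<forall>y\<in>topspace Y. s y \<in> topspace X \<and> r (s y) = y) \<and>
             (\<forall>G\<in>\<G>. {y \<in> topspace Y. s y \<in> G} \<in> Hs Y)"
proof -
  have cl: "closed_map X Y r" using r X Y by (rule continuous_imp_closed_map)
  define lc where "lc C P \<longleftrightarrow> (\<exists>D. closedin X D \<and> (\<forall>x\<in>topspace X. r x \<in> P \<longrightarrow> (x \<in> C \<longleftrightarrow> x \<in> D)))" for C P
  \<comment> \<open>The finite cover of the \<open>Bos\<close> case is replaced by local agreement
    with closed sets on a nonempty relatively open part of every subset. Applied to a singleton,
    this gives closed fibres.\<close>
  define I where "I C \<longleftrightarrow> C \<subseteq> topspace X \<and> r ` C = topspace Y \<and>
    (\<forall>B. B \<subseteq> topspace Y \<and> B \<noteq> {} \<longrightarrow> (\<exists>V. openin (subtopology Y B) V \<and> V \<noteq> {} \<and> lc C V))" for C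
  show ?thesis
  proof (rule section_of_shrinking[where I = I])
    have "lc (topspace X) B" for B
      unfolding lc_def by (intro exI[of _ "topspace X"]) auto
    then show "I (topspace X)"
      unfolding I_def using onto
      by (metis openin_subtopology_refl subset_refl)
    show "closedin X {x \<in> C. x \<in> topspace X \<and> r x = y} \<and> {x \<in> C. x \<in> topspace X \<and> r x = y} \<noteq> {}"
      if C: "I C" and y: "y \<in> topspace Y" for C y
    proof -
      have "\<exists>V. openin (subtopology Y {y}) V \<and> V \<noteq> {} \<and> lc C V"
        using C y unfolding I_def by blast
      then obtain V where V: "openin (subtopology Y {y}) V" "V \<noteq> {}" "lc C V" by blast
      then have "y \<in> V" using openin_subset[OF V(1)] by auto
      obtain D where D: "closedin X D" "\<And>x. x \<in> topspace X \<Longrightarrow> r x \<in> V \<Longrightarrow> x \<in> C \<longleftrightarrow> x \<in> D"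
        using V(3) unfolding lc_def by blast
      have "{x \<in> C. x \<in> topspace X \<and> r x = y} = D \<inter> {x \<in> topspace X. r x = y}"
        using D(2) \<open>y \<in> V\<close> by auto
      then have "closedin X {x \<in> C. x \<in> topspace X \<and> r x = y}"
        using D(1) closedin_fibre[OF r Y y] by auto
      moreover have "y \<in> r ` C" "C \<subseteq> topspace X" using C y by (simp_all add: I_def)
      ultimately show ?thesis by auto
    qed
    show "Hs Y \<subseteq> Pow (topspace Y)" by (auto simp: Hs_def resolvable_in_def)
  next
    fix C R assume C: "I C" and R: "R \<in> \<G>"
    have CX: "C \<subseteq> topspace X" "r ` C = topspace Y" using C by (simp_all add: I_def)
    \<comment> \<open>\<open>D\<close> serves as the new set above \<open>V\<close>: there it is
      contained in \<open>C\<close>, still covers \<open>V\<close>, and has been decided with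
      respect to \<open>R\<close>.\<close>
    define Q where "Q V D \<longleftrightarrow> closedin X D \<and> {x\<in>D. r x \<in> V} \<subseteq> C \<and> V \<subseteq> r ` D \<and>
      ({x\<in>D. r x \<in> V} \<subseteq> R \<or> {x\<in>D. r x \<in> V} \<inter> R = {})" for V D
    have ex: "\<exists>V. openin (subtopology Y B) V \<and> V \<noteq> {} \<and> (\<exists>D. Q V D)"
      if B: "B \<subseteq> topspace Y" "B \<noteq> {}" for B
    proof -
      obtain V0 where V0: "openin (subtopology Y B) V0" "V0 \<noteq> {}" "lc C V0"
        using C B unfolding I_def by blast
      have V0Y: "V0 \<subseteq> topspace Y" using openin_subset[OF V0(1)] by auto
      obtain D where D: "closedin X D" "\<And>x. x \<in> topspace X \<Longrightarrow> r x \<in> V0 \<Longrightarrow> x \<in> C \<longleftrightarrow> x \<in> D"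
        using V0(3) unfolding lc_def by blast
      have "V0 \<subseteq> r ` D"
      proof
        fix y assume "y \<in> V0"
        then have "y \<in> r ` C" using V0Y CX(2) by (simp add: subset_iff)
        then obtain x where x: "x \<in> C" "y = r x" by (rule imageE)
        then have "x \<in> D" using D(2)[of x] CX(1) \<open>y \<in> V0\<close> by (simp add: subset_iff)
        then show "y \<in> r ` D" using x by simp
      qed
      from minimal_closed_cover[OF X Y r D(1) this V0Y] obtain E where
        E: "closedin X E" "E \<subseteq> D" "V0 \<subseteq> r ` E"
          "\<And>E'. closedin X E' \<Longrightarrow> E' \<subseteq> E \<Longrightarrow> V0 \<subseteq> r ` E' \<Longrightarrow> E' = E" by blast
      have EX: "E \<subseteq> topspace X" using E(1) by (rule closedin_subset)
      let ?B = "{x\<in>E. r x \<in> V0}"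
      have "?B \<noteq> {}" "?B \<subseteq> topspace X" using E(3) V0(2) EX by blast+
      then obtain W where W: "openin (subtopology X ?B) W" "W \<noteq> {}" "W \<subseteq> R \<or> W \<inter> R = {}"
        using \<G>(2)[OF R] unfolding resolvable_in_def by blast
      then obtain W' where W': "openin X W'" "W = W' \<inter> ?B" by (auto simp: openin_subtopology)
      have clE: "closedin X (E - W')" using E(1) W'(1) by (rule closedin_diff)
      then have clr: "closedin Y (r ` (E - W'))" using cl by (simp add: closed_map_def)
      \<comment> \<open>Minimality of \<open>E\<close> is used here: \<open>E - W'\<close> misses
        some point of \<open>V0\<close>, so the set \<open>?V\<close> below is nonempty, and all
        points of \<open>E\<close> above it lie in \<open>W\<close>.\<close>
      have "E - W' \<noteq> E" using W(2) W'(2) by blast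
      then have nsub: "\<not> V0 \<subseteq> r ` (E - W')" using E(4)[OF clE] by blast
      let ?V = "V0 - r ` (E - W')"
      have "openin (subtopology Y V0) ?V"
      proof -
        have "?V = (topspace Y - r ` (E - W')) \<inter> V0" using V0Y by auto
        then show ?thesis using clr by (metis openin_diff openin_subtopology_Int openin_topspace)
      qed
      then have "openin (subtopology Y B) ?V" using V0(1) openin_subtopology_trans by blast
      moreover have "?V \<noteq> {}" using nsub by blast
      moreover have "{x\<in>E. r x \<in> ?V} \<subseteq> W" using W'(2) by auto
      then have "{x\<in>E. r x \<in> ?V} \<subseteq> R \<or> {x\<in>E. r x \<in> ?V} \<inter> R = {}" using W(3) by blast
      moreover have "{x\<in>E. r x \<in> ?V} \<subseteq> C"
      proof
        fix x assume "x \<in> {x\<in>E. r x \<in> ?V}"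
        then have "x \<in> topspace X" "r x \<in> V0" "x \<in> D" using EX E(2) by auto
        then show "x \<in> C" using D(2) by simp
      qed
      moreover have "?V \<subseteq> r ` E" using E(3) by blast
      ultimately have "Q ?V E" unfolding Q_def using E(1) by simp
      then show ?thesis
        using \<open>openin (subtopology Y B) ?V\<close> \<open>?V \<noteq> {}\<close> by (intro exI[of _ ?V] conjI exI[of _ E])
    qed
    have "\<exists>\<P>. scattered_partition Y \<P> \<and> (\<forall>P\<in>\<P>. \<exists>D. Q P D)"
      using ex by (rule scattered_partition_exists)
    then obtain \<P> where \<P>: "scattered_partition Y \<P>" "\<And>P. P \<in> \<P> \<Longrightarrow> \<exists>D. Q P D" by auto
    then obtain D where D: "\<And>P. P \<in> \<P> \<Longrightarrow> Q P (D P)" by metis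
    have DX: "D P \<subseteq> topspace X" if "P \<in> \<P>" for P
      using D[OF that] closedin_subset by (auto simp: Q_def)
    note un = scattered_partition_Union[OF \<P>(1)] and disj = scattered_partition_disjoint[OF \<P>(1)]
    \<comment> \<open>The local choices are glued along a scattered partition of \<open>Y\<close>.
      Above each piece \<open>C'\<close> coincides with one closed set, and \<open>A\<close> is a
      union of pieces, hence resolvable.\<close>
    define C' where "C' = (\<Union>P\<in>\<P>. {x \<in> D P. r x \<in> P})"
    define A where "A = \<Union>{P \<in> \<P>. {x \<in> D P. r x \<in> P} \<subseteq> R}"
    have C'C: "C' \<subseteq> C" using D by (auto simp: C'_def Q_def)
    have C'P: "x \<in> C' \<longleftrightarrow> x \<in> D P" if "P \<in> \<P>" "r x \<in> P" for x P
      using that disj unfolding C'_def by blast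
    have "A \<in> Hs Y"
      unfolding A_def Hs_def using scattered_partition_resolvable[OF \<P>(1)] by simp
    moreover have "\<forall>x\<in>C'. x \<in> R \<longleftrightarrow> r x \<in> A"
    proof
      fix x assume "x \<in> C'"
      then obtain P where P: "P \<in> \<P>" "x \<in> D P" "r x \<in> P" by (auto simp: C'_def)
      have "r x \<in> A \<longleftrightarrow> {x \<in> D P. r x \<in> P} \<subseteq> R"
        using P disj unfolding A_def by blast
      then show "x \<in> R \<longleftrightarrow> r x \<in> A" using D[OF P(1)] P unfolding Q_def by blast
    qed
    moreover have "I C'"
      unfolding I_def
    proof (intro conjI allI impI)
      show "C' \<subseteq> topspace X" using DX by (auto simp: C'_def)
      show "r ` C' = topspace Y"
      proof
        show "r ` C' \<subseteq> topspace Y" using C'C CX by auto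
        show "topspace Y \<subseteq> r ` C'"
        proof
          fix y assume "y \<in> topspace Y"
          then obtain P where "P \<in> \<P>" "y \<in> P" using un by blast
          moreover from this have "y \<in> r ` D P" using D by (auto simp: Q_def)
          then obtain x where "x \<in> D P" "y = r x" by (rule imageE)
          ultimately show "y \<in> r ` C'" by (auto simp: C'_def)
        qed
      qed
      fix B assume "B \<subseteq> topspace Y \<and> B \<noteq> {}"
      then obtain P where P: "P \<in> \<P>" "openin (subtopology Y B) (P \<inter> B)" "P \<inter> B \<noteq> {}"
        using scattered_partition_open[OF \<P>(1)] by blast
      moreover have "lc C' (P \<inter> B)"
        unfolding lc_def using D[OF P(1)] C'P[OF P(1)] by (auto simp: Q_def intro!: exI[of _ "D P"])
      ultimately show "\<exists>V. openin (subtopology Y B) V \<and> V \<noteq> {} \<and> lc C' V" by blast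
    qed
    ultimately show "\<exists>C'\<subseteq>C. I C' \<and> (\<exists>A\<in>Hs Y. \<forall>x\<in>C'. x \<in> R \<longleftrightarrow> r x \<in> A)"
      using C'C by (intro exI[of _ C'] conjI bexI[of _ A]) simp_all
  qed (use assms in auto)
qed

text \<open>A set of \<open>Bos X\<close> comes from finitely many open sets by complements and
  unions. Instead of a normal form, only the consequence for preimages under an arbitrary map
  \<open>s\<close> is recorded.\<close>

lemma Bos_countably_generated:
  assumes "A \<in> Bos X"
  shows "\<exists>\<G>. countable \<G> \<and> (\<forall>G\<in>\<G>. openin X G) \<and>
    (\<forall>s. s ` topspace Y \<subseteq> topspace X \<and> (\<forall>G\<in>\<G>. {y \<in> topspace Y. s y \<in> G} \<in> Bos Y) \<longrightarrow>
         {y \<in> topspace Y. s y \<in> A} \<in> Bos Y)" (is "\<exists>\<G>. ?P \<G> A")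
proof (rule Bos_induct[OF assms])
  interpret Y: algebra "topspace Y" "Bos Y" by (rule algebra_Bos)
  show "\<exists>\<G>. ?P \<G> U" if "openin X U" for U
    using that by (intro exI[of _ "{U}"]) auto
  show "algebra (topspace X) {A. A \<subseteq> topspace X \<and> (\<exists>\<G>. ?P \<G> A)}"
    unfolding algebra_iff_Un
  proof (intro conjI ballI)
    show "{} \<in> {A. A \<subseteq> topspace X \<and> (\<exists>\<G>. ?P \<G> A)}"
      by (auto intro!: exI[of _ "{}"])
  next
    fix A assume "A \<in> {A. A \<subseteq> topspace X \<and> (\<exists>\<G>. ?P \<G> A)}"
    then obtain \<G> where "?P \<G> A" by blast
    moreover have "{y \<in> topspace Y. s y \<in> topspace X - A} = topspace Y - {y \<in> topspace Y. s y \<in> A}"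
      if "s ` topspace Y \<subseteq> topspace X" for s using that by auto
    ultimately have "?P \<G> (topspace X - A)" by auto
    then show "topspace X - A \<in> {A. A \<subseteq> topspace X \<and> (\<exists>\<G>. ?P \<G> A)}" by blast
  next
    fix A A' assume "A \<in> {A. A \<subseteq> topspace X \<and> (\<exists>\<G>. ?P \<G> A)}" "A' \<in> {A. A \<subseteq> topspace X \<and> (\<exists>\<G>. ?P \<G> A)}"
    then obtain \<G> \<G>' where *: "?P \<G> A" "?P \<G>' A'" and sub: "A \<subseteq> topspace X" "A' \<subseteq> topspace X" by blast
    have eq: "{y \<in> topspace Y. s y \<in> A \<union> A'} = {y \<in> topspace Y. s y \<in> A} \<union> {y \<in> topspace Y. s y \<in> A'}"
      for s by auto
    have "?P (\<G> \<union> \<G>') (A \<union> A')"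
      unfolding eq
    proof (intro conjI allI impI)
      fix s assume s: "s ` topspace Y \<subseteq> topspace X \<and> (\<forall>G\<in>\<G> \<union> \<G>'. {y \<in> topspace Y. s y \<in> G} \<in> Bos Y)"
      then have "{y \<in> topspace Y. s y \<in> A} \<in> Bos Y" "{y \<in> topspace Y. s y \<in> A'} \<in> Bos Y"
        using * by simp_all
      then show "{y \<in> topspace Y. s y \<in> A} \<union> {y \<in> topspace Y. s y \<in> A'} \<in> Bos Y" by auto
    qed (use * in auto)
    then show "A \<union> A' \<in> {A. A \<subseteq> topspace X \<and> (\<exists>\<G>. ?P \<G> A)}" using sub by blast
  qed auto
qed

text \<open>If \<open>s\<close> is a section, then \<open>g\<close> and
  \<open>\<Phi> \<circ> s\<close> agree on the space; it remains to choose \<open>s\<close> with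
  good preimages of the sets from which \<open>\<Phi>\<close> is built. These are countably many: a
  countable base of the plane, countably many sets for each preimage, one sequence at each limit
  step.\<close>

lemma limit_hierarchy_descent:
  assumes \<alpha>: "1 \<le> \<alpha>"
    and \<Phi>: "\<Phi> \<in> limit_hierarchy (topspace X) 1 (preimage_class X (Sigma2 \<A>)) \<alpha>"
    and g: "\<And>x. x \<in> topspace X \<Longrightarrow> g (r x) = \<Phi> x"
    and gen: "\<And>A. A \<in> \<A> \<Longrightarrow> \<exists>\<G>. countable \<G> \<and> \<G> \<subseteq> \<O> \<and>
      (\<forall>s. s ` topspace Y \<subseteq> topspace X \<and> (\<forall>G\<in>\<G>. {y \<in> topspace Y. s y \<in> G} \<in> \<B>) \<longrightarrow>
         {y \<in> topspace Y. s y \<in> A} \<in> \<B>)"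
    and sec: "\<And>\<G>. countable \<G> \<Longrightarrow> \<G> \<subseteq> \<O> \<Longrightarrow>
      \<exists>s. (\<forall>y\<in>topspace Y. s y \<in> topspace X \<and> r (s y) = y) \<and> (\<forall>G\<in>\<G>. {y \<in> topspace Y. s y \<in> G} \<in> \<B>)"
    and \<B>: "algebra (topspace Y) \<B>"
  shows "g \<in> limit_hierarchy (topspace Y) 1 (preimage_class Y (Sigma2 \<B>)) \<alpha>"
proof -
  define ok where "ok \<G> s \<longleftrightarrow> s ` topspace Y \<subseteq> topspace X \<and> (\<forall>G\<in>\<G>. {y \<in> topspace Y. s y \<in> G} \<in> \<B>)" for \<G> s
  note SL = sigma_lattice_Sigma2[OF \<B>]
  \<comment> \<open>The family \<open>\<G>\<close> is complete only at the end of the induction, so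
    the claim speaks of every \<open>s\<close> that pulls \<open>\<G>\<close> back correctly; the
    section is chosen afterwards. Enlarging \<open>\<G>\<close> only restricts \<open>s\<close>, so
    countable families can be united.\<close>
  have "\<exists>\<G>. countable \<G> \<and> \<G> \<subseteq> \<O> \<and> (\<forall>s. ok \<G> s \<longrightarrow>
      \<Phi> \<circ> s \<in> limit_hierarchy (topspace Y) 1 (preimage_class Y (Sigma2 \<B>)) \<alpha>)"
    using \<alpha> \<Phi>
  proof (induction rule: limit_hierarchy_induct)
    case (base h)
    obtain \<U> :: "complex set set" where \<U>: "countable \<U>" "\<And>U. U \<in> \<U> \<Longrightarrow> open U"
        "\<And>S. open S \<Longrightarrow> \<exists>\<V>\<subseteq>\<U>. S = \<Union>\<V>"
      using univ_second_countable by metis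
    have "\<forall>U\<in>\<U>. \<exists>\<C>. countable \<C> \<and> \<C> \<subseteq> \<A> \<and> {x \<in> topspace X. h x \<in> U} = \<Union>\<C>"
    proof
      fix U assume "U \<in> \<U>"
      then have "{x \<in> topspace X. h x \<in> U} \<in> Sigma2 \<A>"
        using base \<U>(2) by (simp add: preimage_class_def)
      then show "\<exists>\<C>. countable \<C> \<and> \<C> \<subseteq> \<A> \<and> {x \<in> topspace X. h x \<in> U} = \<Union>\<C>"
        by (auto simp: Sigma2_def)
    qed
    from bchoice[OF this] obtain \<C> where
      \<C>': "\<forall>U\<in>\<U>. countable (\<C> U) \<and> \<C> U \<subseteq> \<A> \<and> {x \<in> topspace X. h x \<in> U} = \<Union>(\<C> U)"
      by (elim exE)
    note \<C> = bspec[OF \<C>']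
    have "\<forall>A\<in>\<A>. \<exists>\<G>. countable \<G> \<and> \<G> \<subseteq> \<O> \<and> (\<forall>s. ok \<G> s \<longrightarrow> {y \<in> topspace Y. s y \<in> A} \<in> \<B>)"
      unfolding ok_def by (intro ballI gen)
    from bchoice[OF this] obtain \<G> where \<G>': "\<forall>A\<in>\<A>. countable (\<G> A) \<and> \<G> A \<subseteq> \<O> \<and>
        (\<forall>s. ok (\<G> A) s \<longrightarrow> {y \<in> topspace Y. s y \<in> A} \<in> \<B>)"
      by (elim exE)
    note \<G> = bspec[OF \<G>']
    let ?\<G> = "\<Union>U\<in>\<U>. \<Union>A\<in>\<C> U. \<G> A"
    show ?case
    proof (intro exI[of _ ?\<G>] conjI allI impI)
      show "countable ?\<G>" using \<U>(1) \<C> \<G> by (intro countable_UN) blast+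
      show "?\<G> \<subseteq> \<O>" using \<C> \<G> by blast
      fix s assume s: "ok ?\<G> s"
      have ok: "ok (\<G> A) s" if "U \<in> \<U>" "A \<in> \<C> U" for U A
        using s that unfolding ok_def by blast
      have U: "{y \<in> topspace Y. h (s y) \<in> U} \<in> Sigma2 \<B>" if "U \<in> \<U>" for U
      proof -
        have "{y \<in> topspace Y. h (s y) \<in> U} = (\<Union>A\<in>\<C> U. {y \<in> topspace Y. s y \<in> A})"
        proof -
          have "h (s y) \<in> U \<longleftrightarrow> s y \<in> \<Union>(\<C> U)" if "y \<in> topspace Y" for y
            using \<C>[OF \<open>U \<in> \<U>\<close>] s that unfolding ok_def by blast
          then show ?thesis by auto
        qed
        also have "\<dots> \<in> Sigma2 \<B>"
        proof (rule Sigma2_UN)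
          show "countable (\<C> U)" using \<C> that by blast
          show "{y \<in> topspace Y. s y \<in> A} \<in> \<B>" if "A \<in> \<C> U" for A
            using \<G>[of A] ok[OF \<open>U \<in> \<U>\<close> that] \<C>[OF \<open>U \<in> \<U>\<close>] that by blast
        qed
        finally show ?thesis .
      qed
      have "h \<circ> s \<in> preimage_class Y (Sigma2 \<B>)"
        unfolding preimage_class_def
      proof safe
        fix S :: "complex set" assume "open S"
        then obtain \<V> where \<V>: "\<V> \<subseteq> \<U>" "S = \<Union>\<V>" using \<U>(3) by blast
        have "{y \<in> topspace Y. (h \<circ> s) y \<in> S} = (\<Union>U\<in>\<V>. {y \<in> topspace Y. h (s y) \<in> U})"
          using \<V>(2) by auto
        also have "\<dots> \<in> Sigma2 \<B>"
          using U \<V> \<U>(1) countable_subset by (intro sigma_lattice_UN[OF SL]) auto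
        finally show "{y \<in> topspace Y. (h \<circ> s) y \<in> S} \<in> Sigma2 \<B>" .
      qed
      then show "h \<circ> s \<in> limit_hierarchy (topspace Y) 1 (preimage_class Y (Sigma2 \<B>)) 1" by simp
    qed
  next
    case (step \<alpha> h g)
    let ?L = "limit_hierarchy (topspace Y) 1 (preimage_class Y (Sigma2 \<B>))"
    have "\<exists>\<G>. countable \<G> \<and> \<G> \<subseteq> \<O> \<and> (\<exists>\<beta>. 1 \<le> \<beta> \<and> \<beta> < \<alpha> \<and> (\<forall>s. ok \<G> s \<longrightarrow> h n \<circ> s \<in> ?L \<beta>))" for n
      using step(3)[of n] by blast
    then have "\<forall>n. \<exists>\<G>. countable \<G> \<and> \<G> \<subseteq> \<O> \<and> (\<exists>\<beta>. 1 \<le> \<beta> \<and> \<beta> < \<alpha> \<and> (\<forall>s. ok \<G> s \<longrightarrow> h n \<circ> s \<in> ?L \<beta>))"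
      by (rule allI)
    from choice[OF this] obtain \<G> where \<G>: "\<And>n. countable (\<G> n)" "\<And>n. \<G> n \<subseteq> \<O>"
      "\<And>n. \<exists>\<beta>. 1 \<le> \<beta> \<and> \<beta> < \<alpha> \<and> (\<forall>s. ok (\<G> n) s \<longrightarrow> h n \<circ> s \<in> ?L \<beta>)" by auto
    show ?case
    proof (intro exI[of _ "\<Union>n. \<G> n"] conjI allI impI)
      fix s assume s: "ok (\<Union>n. \<G> n) s"
      then have "ok (\<G> n) s" for n unfolding ok_def by blast
      then have "\<exists>\<beta>. 1 \<le> \<beta> \<and> \<beta> < \<alpha> \<and> h n \<circ> s \<in> ?L \<beta>" for n using \<G>(3)[of n] by blast
      moreover have "(\<lambda>n. (h n \<circ> s) y) \<longlonglongrightarrow> (g \<circ> s) y" if "y \<in> topspace Y" for y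
        using step(2)[of "s y"] s that by (auto simp: ok_def)
      ultimately show "g \<circ> s \<in> ?L \<alpha>"
        unfolding limit_hierarchy_iff[OF step(1)] by (intro exI[of _ "\<lambda>n. h n \<circ> s"]) simp
    qed (use \<G> in auto)
  qed
  then obtain \<G> where \<G>: "countable \<G>" "\<G> \<subseteq> \<O>"
    "\<And>s. ok \<G> s \<Longrightarrow> \<Phi> \<circ> s \<in> limit_hierarchy (topspace Y) 1 (preimage_class Y (Sigma2 \<B>)) \<alpha>" by blast
  from sec[OF \<G>(1,2)] obtain s where s: "\<And>y. y \<in> topspace Y \<Longrightarrow> s y \<in> topspace X \<and> r (s y) = y"
    "\<forall>G\<in>\<G>. {y \<in> topspace Y. s y \<in> G} \<in> \<B>" by blast
  then have "ok \<G> s" by (auto simp: ok_def)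
  from \<G>(3)[OF this] show ?thesis
  proof (rule limit_hierarchy_cong[OF \<alpha>])
    show "g y = (\<Phi> \<circ> s) y" if "y \<in> topspace Y" for y
      using g[of "s y"] s(1)[OF that] by simp
  qed (rule preimage_class_cong)
qed

lemma Bof_descent:
  assumes "compact_space X" "Hausdorff_space Y" "continuous_map X Y r" "r ` topspace X = topspace Y"
    and "1 \<le> \<alpha>" "\<Phi> \<in> Bof \<alpha> X" "\<And>x. x \<in> topspace X \<Longrightarrow> g (r x) = \<Phi> x"
  shows "g \<in> Bof \<alpha> Y"
  unfolding Bof_def
proof (rule limit_hierarchy_descent[where \<O> = "Collect (openin X)" and r = r])
  show "\<exists>\<G>. countable \<G> \<and> \<G> \<subseteq> Collect (openin X) \<and>
      (\<forall>s. s ` topspace Y \<subseteq> topspace X \<and> (\<forall>G\<in>\<G>. {y \<in> topspace Y. s y \<in> G} \<in> Bos Y) \<longrightarrow>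
         {y \<in> topspace Y. s y \<in> A} \<in> Bos Y)" if "A \<in> Bos X" for A
    using Bos_countably_generated[OF that] by (simp add: subset_eq)
  show "\<exists>s. (\<forall>y\<in>topspace Y. s y \<in> topspace X \<and> r (s y) = y) \<and>
      (\<forall>G\<in>\<G>. {y \<in> topspace Y. s y \<in> G} \<in> Bos Y)" if "countable \<G>" "\<G> \<subseteq> Collect (openin X)" for \<G>
    using Bos_section[OF assms(1-4) that(1)] that(2) by auto
qed (use assms in \<open>auto simp: Bof_def algebra_Bos\<close>)

lemma Hf_descent:
  assumes "compact_space X" "Hausdorff_space Y" "continuous_map X Y r" "r ` topspace X = topspace Y"
    and "1 \<le> \<alpha>" "\<Phi> \<in> Hf \<alpha> X" "\<And>x. x \<in> topspace X \<Longrightarrow> g (r x) = \<Phi> x"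
  shows "g \<in> Hf \<alpha> Y"
  unfolding Hf_def
proof (rule limit_hierarchy_descent[where \<O> = "Hs X" and r = r])
  show "\<exists>\<G>. countable \<G> \<and> \<G> \<subseteq> Hs X \<and>
      (\<forall>s. s ` topspace Y \<subseteq> topspace X \<and> (\<forall>G\<in>\<G>. {y \<in> topspace Y. s y \<in> G} \<in> Hs Y) \<longrightarrow>
         {y \<in> topspace Y. s y \<in> A} \<in> Hs Y)" if "A \<in> Hs X" for A
    using that by (intro exI[of _ "{A}"]) auto
  show "\<exists>s. (\<forall>y\<in>topspace Y. s y \<in> topspace X \<and> r (s y) = y) \<and>
      (\<forall>G\<in>\<G>. {y \<in> topspace Y. s y \<in> G} \<in> Hs Y)" if "countable \<G>" "\<G> \<subseteq> Hs X" for \<G>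
    using Hs_section[OF assms(1-4) that(1)] that(2) by (auto simp: Hs_def)
qed (use assms in \<open>auto simp: Hf_def algebra_Hs\<close>)

section \<open>Radon measures from finitely additive probabilities\<close>

text \<open>The set functions are defined on all subsets of the type so that they are points of a
  product space; the condition on \<open>A \<inter> K\<close> confines the mass to
  \<open>K\<close>.\<close>

definition fa_prob :: "'a set \<Rightarrow> ('a set \<Rightarrow> real) set" where
  "fa_prob K = {m. (\<forall>A. 0 \<le> m A) \<and> (\<forall>A. m (A \<inter> K) = m A) \<and> m K = 1 \<and>
     (\<forall>A B. A \<inter> B = {} \<longrightarrow> m (A \<union> B) = m A + m B)}"

text \<open>Intended for open \<open>G\<close>. A finitely additive \<open>m\<close> has no
  continuity along sequences; approximation from inside by closed, hence compact, sets creates the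
  countable subadditivity from which the outer measure starts.\<close>

definition inner_content :: "'a topology \<Rightarrow> ('a set \<Rightarrow> real) \<Rightarrow> 'a set \<Rightarrow> real" where
  "inner_content T m G = (SUP F\<in>{F. closedin T F \<and> F \<subseteq> G}. m F)"

definition regular_outer :: "'a topology \<Rightarrow> ('a set \<Rightarrow> real) \<Rightarrow> 'a set \<Rightarrow> real" where
  "regular_outer T m A = (INF G\<in>{G. openin T G \<and> A \<subseteq> G}. inner_content T m G)"

text \<open>The sigma-algebra consists of all Caratheodory measurable sets, not only the Borel sets,
  since a Radon measure has to be complete.\<close>

definition regular_measure :: "'a topology \<Rightarrow> ('a set \<Rightarrow> real) \<Rightarrow> 'a measure" where
  "regular_measure T m = measure_of (topspace T)
     (lambda_system (topspace T) (Pow (topspace T)) (\<lambda>A. ennreal (regular_outer T m A)))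
     (\<lambda>A. ennreal (regular_outer T m A))"

lemma fa_probD:
  assumes "m \<in> fa_prob K"
  shows "0 \<le> m A" "m (A \<inter> K) = m A" "m K = 1" "A \<inter> B = {} \<Longrightarrow> m (A \<union> B) = m A + m B"
  using assms by (auto simp: fa_prob_def)

lemma fa_prob_mono:
  assumes "m \<in> fa_prob K" "A \<subseteq> B"
  shows "m A \<le> m B"
proof -
  have "m (A \<union> (B - A)) = m A + m (B - A)" using assms(1) by (intro fa_probD(4)) auto
  moreover have "A \<union> (B - A) = B" using assms(2) by blast
  ultimately show ?thesis using fa_probD(1)[OF assms(1)] by (metis le_add_same_cancel1)
qed

lemma fa_prob_diff:
  assumes "m \<in> fa_prob K" "A \<subseteq> B"
  shows "m (B - A) = m B - m A"
proof -
  have "m (A \<union> (B - A)) = m A + m (B - A)" using assms(1) by (intro fa_probD(4)) auto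
  moreover have "A \<union> (B - A) = B" using assms(2) by blast
  ultimately show ?thesis by simp
qed

lemma fa_prob_eq_1: "m \<in> fa_prob K \<Longrightarrow> K \<subseteq> A \<Longrightarrow> m A = 1"
  by (metis fa_probD(2,3) inf.absorb2)

lemma fa_prob_le_1: "m \<in> fa_prob K \<Longrightarrow> m A \<le> 1"
  using fa_prob_mono[of m K "A \<inter> K" K] fa_probD(2,3)[of m K] by simp

lemma fa_prob_empty: "m \<in> fa_prob K \<Longrightarrow> m {} = 0"
  using fa_prob_diff[of m K "{}" "{}"] by simp

locale regularization =
  fixes T :: "'a topology" and K :: "'a set" and m :: "'a set \<Rightarrow> real"
  assumes compact_T: "compact_space T" and Hausdorff_T: "Hausdorff_space T"
    and closed_K: "closedin T K" and m: "m \<in> fa_prob K"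
begin

abbreviation "\<nu> \<equiv> inner_content T m"
abbreviation "\<rho> \<equiv> regular_outer T m"
abbreviation "\<mu> \<equiv> regular_measure T m"

lemma K_subset: "K \<subseteq> topspace T"
  using closed_K by (rule closedin_subset)

lemma bdd_nu: "bdd_above (m ` S)"
  using fa_prob_le_1[OF m] by (auto simp: bdd_above_def)

lemma nu_upper: "closedin T F \<Longrightarrow> F \<subseteq> G \<Longrightarrow> m F \<le> \<nu> G"
  unfolding inner_content_def by (intro cSUP_upper bdd_nu) auto

lemma nu_least: "(\<And>F. closedin T F \<Longrightarrow> F \<subseteq> G \<Longrightarrow> m F \<le> c) \<Longrightarrow> \<nu> G \<le> c"
  unfolding inner_content_def by (intro cSUP_least) auto

lemma nu_less: "c < \<nu> G \<longleftrightarrow> (\<exists>F. closedin T F \<and> F \<subseteq> G \<and> c < m F)"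
proof -
  have ne: "{F. closedin T F \<and> F \<subseteq> G} \<noteq> {}" by auto
  show ?thesis
    unfolding inner_content_def less_cSUP_iff[OF ne bdd_nu] by auto
qed

lemma nu_mono: "G \<subseteq> H \<Longrightarrow> \<nu> G \<le> \<nu> H"
  by (rule nu_least) (auto intro: nu_upper)

lemma nu_le: "\<nu> G \<le> m G"
  by (rule nu_least) (rule fa_prob_mono[OF m])

lemma nu_nonneg: "0 \<le> \<nu> G"
  using nu_upper[of "{}" G] fa_prob_empty[OF m] by simp

lemma nu_space: "\<nu> (topspace T) = 1"
  using nu_upper[of "topspace T" "topspace T"] nu_le[of "topspace T"] fa_prob_eq_1[OF m K_subset] by simp

text \<open>For closed \<open>F\<close> inside \<open>G \<union> H\<close>, normality separates the
  disjoint closed sets \<open>F - G\<close> and \<open>F - H\<close> by open \<open>U\<close> and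
  \<open>V\<close>. The closed sets \<open>F - U\<close> and \<open>F - V\<close> lie in
  \<open>G\<close> and \<open>H\<close> and cover \<open>F\<close>.\<close>

lemma nu_Un:
  assumes "openin T G" "openin T H"
  shows "\<nu> (G \<union> H) \<le> \<nu> G + \<nu> H"
proof (rule nu_least)
  fix F assume F: "closedin T F" "F \<subseteq> G \<union> H"
  have "normal_space T"
    using compact_T Hausdorff_T compact_Hausdorff_or_regular_imp_normal_space by blast
  moreover have "closedin T (F - G)" "closedin T (F - H)" using F assms by (auto intro: closedin_diff)
  moreover have "disjnt (F - G) (F - H)" using F by (auto simp: disjnt_def)
  ultimately obtain U V where UV: "openin T U" "openin T V" "F - G \<subseteq> U" "F - H \<subseteq> V" "disjnt U V"
    unfolding normal_space_def by meson
  have "closedin T (F - U)" "closedin T (F - V)" using F UV by (auto intro: closedin_diff)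
  then have "m (F - U) \<le> \<nu> G" "m (F - V) \<le> \<nu> H" using UV by (auto intro!: nu_upper)
  moreover have "m F \<le> m (F - U) + m (F - V)"
  proof -
    have "m F = m ((F - U) \<union> (F \<inter> U))" by (rule arg_cong[of _ _ m]) blast
    also have "\<dots> = m (F - U) + m (F \<inter> U)" by (rule fa_probD(4)[OF m]) blast
    also have "m (F \<inter> U) \<le> m (F - V)"
      using UV(5) by (intro fa_prob_mono[OF m]) (auto simp: disjnt_def)
    finally show ?thesis by simp
  qed
  ultimately show "m F \<le> \<nu> G + \<nu> H" by simp
qed

lemma nu_finite_UN:
  assumes "\<And>i::nat. openin T (G i)"
  shows "\<nu> (\<Union>i<n. G i) \<le> (\<Sum>i<n. \<nu> (G i))"
proof (induction n)
  case 0
  then show ?case using nu_le[of "{}"] fa_prob_empty[OF m] by simp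
next
  case (Suc n)
  have "\<nu> (\<Union>i<Suc n. G i) = \<nu> ((\<Union>i<n. G i) \<union> G n)"
    by (rule arg_cong[of _ _ \<nu>]) (auto simp: less_Suc_eq)
  also have "\<dots> \<le> \<nu> (\<Union>i<n. G i) + \<nu> (G n)"
    using assms by (intro nu_Un) auto
  finally show ?case using Suc by simp
qed

lemma closed_subset_UN:
  assumes F: "closedin T F" "F \<subseteq> (\<Union>i. G i)" and G: "\<And>i::nat. openin T (G i)"
  shows "\<exists>n. F \<subseteq> (\<Union>i<n. G i)"
proof -
  have "compactin T F" using F compact_T closedin_compact_space by blast
  then obtain \<F> where \<F>: "finite \<F>" "\<F> \<subseteq> range G" "F \<subseteq> \<Union>\<F>"
    using compactinD[of T F "range G"] F G by auto
  obtain I where I: "finite I" "\<F> = G ` I" using \<F> by (meson finite_subset_image)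
  have "F \<subseteq> (\<Union>i<Suc (Max I). G i)"
  proof
    fix x assume "x \<in> F"
    then obtain i where "i \<in> I" "x \<in> G i" using \<F> I by auto
    moreover have "i < Suc (Max I)" using \<open>i \<in> I\<close> I by (simp add: less_Suc_eq_le)
    ultimately show "x \<in> (\<Union>i<Suc (Max I). G i)" by blast
  qed
  then show ?thesis by blast
qed

section \<open>The outer measure and its measurable sets\<close>

lemma bdd_rho: "bdd_below (\<nu> ` S)"
  using nu_nonneg by (auto simp: bdd_below_def)

lemma rho_lower: "openin T G \<Longrightarrow> A \<subseteq> G \<Longrightarrow> \<rho> A \<le> \<nu> G"
  unfolding regular_outer_def by (intro cINF_lower bdd_rho) auto

lemma rho_greatest:
  "A \<subseteq> topspace T \<Longrightarrow> (\<And>G. openin T G \<Longrightarrow> A \<subseteq> G \<Longrightarrow> c \<le> \<nu> G) \<Longrightarrow> c \<le> \<rho> A"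
  unfolding regular_outer_def by (intro cINF_greatest) auto

lemma rho_less:
  assumes "A \<subseteq> topspace T"
  shows "\<rho> A < c \<longleftrightarrow> (\<exists>G. openin T G \<and> A \<subseteq> G \<and> \<nu> G < c)"
proof -
  have ne: "{G. openin T G \<and> A \<subseteq> G} \<noteq> {}" using assms by auto
  show ?thesis
    unfolding regular_outer_def cINF_less_iff[OF ne bdd_rho] by auto
qed

lemma rho_open: "openin T G \<Longrightarrow> \<rho> G = \<nu> G"
  using rho_lower[of G G] rho_greatest[of G "\<nu> G"] nu_mono openin_subset by force

lemma rho_mono: "A \<subseteq> B \<Longrightarrow> B \<subseteq> topspace T \<Longrightarrow> \<rho> A \<le> \<rho> B"
  by (rule rho_greatest) (auto intro: rho_lower)

lemma rho_nonneg: "A \<subseteq> topspace T \<Longrightarrow> 0 \<le> \<rho> A"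
  by (rule rho_greatest) (auto intro: nu_nonneg)

lemma rho_Un:
  assumes "A \<subseteq> topspace T" "B \<subseteq> topspace T"
  shows "\<rho> (A \<union> B) \<le> \<rho> A + \<rho> B"
proof (rule field_le_epsilon)
  fix e :: real assume e: "0 < e"
  obtain G where G: "openin T G" "A \<subseteq> G" "\<nu> G < \<rho> A + e / 2"
    using rho_less[OF assms(1), of "\<rho> A + e / 2"] e by auto
  obtain H where H: "openin T H" "B \<subseteq> H" "\<nu> H < \<rho> B + e / 2"
    using rho_less[OF assms(2), of "\<rho> B + e / 2"] e by auto
  have "\<rho> (A \<union> B) \<le> \<nu> (G \<union> H)" using G H by (intro rho_lower) auto
  also have "\<dots> \<le> \<nu> G + \<nu> H" using G H by (intro nu_Un)
  finally show "\<rho> (A \<union> B) \<le> \<rho> A + \<rho> B + e" using G H by simp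
qed

text \<open>Compactness reduces the countable case to finite subadditivity: a closed subset of the
  union of the open sets \<open>G i\<close> lies in finitely many of them, and \<open>\<nu>\<close>
  of the union is a supremum over such closed subsets.\<close>

lemma rho_UN:
  assumes A: "\<And>i::nat. A i \<subseteq> topspace T"
  shows "ennreal (\<rho> (\<Union>i. A i)) \<le> (\<Sum>i. ennreal (\<rho> (A i)))"
proof (cases "\<Sum>i. ennreal (\<rho> (A i))")
  case (real s)
  have sum: "(\<Sum>i<n. \<rho> (A i)) \<le> s" for n
  proof -
    have "ennreal (\<Sum>i<n. \<rho> (A i)) = (\<Sum>i<n. ennreal (\<rho> (A i)))"
      using rho_nonneg[OF A] by (simp add: sum_ennreal)
    also have "\<dots> \<le> (\<Sum>i. ennreal (\<rho> (A i)))" by (intro sum_le_suminf) auto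
    finally show ?thesis using real by simp
  qed
  have "\<rho> (\<Union>i. A i) \<le> s"
  proof (rule field_le_epsilon)
    fix e :: real assume e: "0 < e"
    \<comment> \<open>The allowances \<open>e * (1/2) ^ Suc i\<close> add up to at most
      \<open>e\<close>.\<close>
    have "\<forall>i. \<exists>G. openin T G \<and> A i \<subseteq> G \<and> \<nu> G < \<rho> (A i) + e * (1/2) ^ Suc i"
    proof
      fix i
      show "\<exists>G. openin T G \<and> A i \<subseteq> G \<and> \<nu> G < \<rho> (A i) + e * (1/2) ^ Suc i"
        unfolding rho_less[OF A, symmetric] using e by simp
    qed
    from choice[OF this] obtain G where
      G: "\<And>i. openin T (G i)" "\<And>i. A i \<subseteq> G i" "\<And>i. \<nu> (G i) < \<rho> (A i) + e * (1/2) ^ Suc i" by auto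
    have "\<rho> (\<Union>i. A i) \<le> \<nu> (\<Union>i. G i)" using G(1,2) by (intro rho_lower) auto
    also have "\<dots> \<le> s + e"
    proof (rule nu_least)
      fix F assume F: "closedin T F" "F \<subseteq> (\<Union>i. G i)"
      then obtain n where n: "F \<subseteq> (\<Union>i<n. G i)" using closed_subset_UN[of F G] G by auto
      have "m F \<le> \<nu> (\<Union>i<n. G i)" using F(1) n by (rule nu_upper)
      also have "\<dots> \<le> (\<Sum>i<n. \<nu> (G i))" using G(1) by (rule nu_finite_UN)
      also have "\<dots> \<le> (\<Sum>i<n. \<rho> (A i) + e * (1/2) ^ Suc i)" using G(3) by (intro sum_mono less_imp_le)
      also have "\<dots> = (\<Sum>i<n. \<rho> (A i)) + e * (\<Sum>i<n. (1/2) ^ Suc i)"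
        by (simp add: sum.distrib sum_distrib_left)
      also have "(\<Sum>i<n. (1/2::real) ^ Suc i) \<le> 1"
        using sum_le_suminf[of "\<lambda>i. (1/2::real) ^ Suc i" "{..<n}"] power_half_series
        by (auto simp: sums_iff)
      finally show "m F \<le> s + e" using sum[of n] e by (simp add: mult_left_le)
    qed
    finally show "\<rho> (\<Union>i. A i) \<le> s + e" .
  qed
  then show ?thesis using real by (simp add: ennreal_leI)
qed simp

lemma rho_outer_measure: "outer_measure_space (Pow (topspace T)) (\<lambda>A. ennreal (\<rho> A))"
  unfolding outer_measure_space_def
proof (intro conjI)
  have "\<rho> {} = 0"
    using rho_open[of "{}"] nu_le[of "{}"] nu_nonneg[of "{}"] fa_prob_empty[OF m] by simp
  then show "positive (Pow (topspace T)) (\<lambda>A. ennreal (\<rho> A))"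
    by (simp add: positive_def)
  show "increasing (Pow (topspace T)) (\<lambda>A. ennreal (\<rho> A))"
    by (auto simp: increasing_def intro!: ennreal_leI rho_mono)
  show "countably_subadditive (Pow (topspace T)) (\<lambda>A. ennreal (\<rho> A))"
    unfolding countably_subadditive_def
  proof (intro allI impI)
    fix A :: "nat \<Rightarrow> 'a set" assume "range A \<subseteq> Pow (topspace T)"
    then show "ennreal (\<rho> (\<Union>i. A i)) \<le> (\<Sum>i. ennreal (\<rho> (A i)))"
      by (intro rho_UN) auto
  qed
qed

text \<open>Given open \<open>U\<close> containing \<open>A\<close>, approximate
  \<open>U \<inter> G\<close> from inside by a closed \<open>F\<close> and the open set
  \<open>U - F\<close> by a closed \<open>H\<close>. They are disjoint subsets of \<open>U\<close>,
  so \<open>m\<close> is additive on them, and \<open>A - G\<close> lies in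
  \<open>U - F\<close>.\<close>

lemma rho_split_open:
  assumes G: "openin T G" and A: "A \<subseteq> topspace T"
  shows "\<rho> (A \<inter> G) + \<rho> (A - G) \<le> \<rho> A"
proof (rule rho_greatest[OF A])
  fix U assume U: "openin T U" "A \<subseteq> U"
  show "\<rho> (A \<inter> G) + \<rho> (A - G) \<le> \<nu> U"
  proof (rule field_le_epsilon)
    fix e :: real assume e: "0 < e"
    obtain F where F: "closedin T F" "F \<subseteq> U \<inter> G" "\<nu> (U \<inter> G) - e / 2 < m F"
      using nu_less[of "\<nu> (U \<inter> G) - e / 2" "U \<inter> G"] e by auto
    have UF: "openin T (U - F)" using U F by (auto intro: openin_diff)
    obtain H where H: "closedin T H" "H \<subseteq> U - F" "\<nu> (U - F) - e / 2 < m H"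
      using nu_less[of "\<nu> (U - F) - e / 2" "U - F"] e by auto
    have "m (F \<union> H) = m F + m H" using H by (intro fa_probD(4)[OF m]) auto
    moreover have "m (F \<union> H) \<le> \<nu> U" using F H by (intro nu_upper) auto
    moreover have "\<rho> (A \<inter> G) \<le> \<nu> (U \<inter> G)" using U G by (intro rho_lower) auto
    moreover have "\<rho> (A - G) \<le> \<nu> (U - F)" using U F UF by (intro rho_lower) auto
    ultimately show "\<rho> (A \<inter> G) + \<rho> (A - G) \<le> \<nu> U + e" using F(3) H(3) by linarith
  qed
qed

abbreviation "\<L> \<equiv> lambda_system (topspace T) (Pow (topspace T)) (\<lambda>A. ennreal (\<rho> A))"

lemma L_iff: "A \<in> \<L> \<longleftrightarrow> A \<subseteq> topspace T \<and> (\<forall>B\<subseteq>topspace T. \<rho> (B \<inter> A) + \<rho> (B - A) \<le> \<rho> B)"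
proof -
  interpret P: sigma_algebra "topspace T" "Pow (topspace T)" by (rule sigma_algebra_Pow)
  have "ennreal (\<rho> (B \<inter> A)) + ennreal (\<rho> (B - A)) = ennreal (\<rho> B) \<longleftrightarrow>
      \<rho> (B \<inter> A) + \<rho> (B - A) \<le> \<rho> B" if B: "B \<subseteq> topspace T" for B
  proof -
    have nn: "0 \<le> \<rho> (B \<inter> A)" "0 \<le> \<rho> (B - A)" "0 \<le> \<rho> B" using B by (auto intro!: rho_nonneg)
    have "\<rho> (B \<inter> A \<union> (B - A)) \<le> \<rho> (B \<inter> A) + \<rho> (B - A)" using B by (intro rho_Un) auto
    moreover have "B \<inter> A \<union> (B - A) = B" by blast
    ultimately have "\<rho> B \<le> \<rho> (B \<inter> A) + \<rho> (B - A)" by simp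
    then show ?thesis using nn by (simp flip: ennreal_plus)
  qed
  then show ?thesis unfolding P.lambda_system_eq by auto
qed

lemma measure_space_L: "measure_space (topspace T) \<L> (\<lambda>A. ennreal (\<rho> A))"
proof -
  interpret P: sigma_algebra "topspace T" "Pow (topspace T)" by (rule sigma_algebra_Pow)
  show ?thesis using rho_outer_measure by (rule P.caratheodory_lemma)
qed

lemma sigma_algebra_L: "sigma_algebra (topspace T) \<L>"
  using measure_space_L by (simp add: measure_space_def)

section \<open>The Radon probability obtained from the outer measure\<close>

lemma space_mu: "space \<mu> = topspace T"
  unfolding regular_measure_def by (intro space_measure_of) (auto simp: lambda_system_def)

lemma sets_mu: "sets \<mu> = \<L>"
  unfolding regular_measure_def by (rule sigma_algebra.sets_measure_of_eq[OF sigma_algebra_L])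

lemma sets_mu_subset: "A \<in> sets \<mu> \<Longrightarrow> A \<subseteq> topspace T"
  unfolding sets_mu L_iff by blast

lemma emeasure_mu: "A \<in> sets \<mu> \<Longrightarrow> emeasure \<mu> A = ennreal (\<rho> A)"
  unfolding sets_mu unfolding regular_measure_def using measure_space_L
  by (intro emeasure_measure_of_sigma) (auto simp: measure_space_def)

lemma prob_space_mu: "prob_space \<mu>"
proof
  have "topspace T \<in> sets \<mu>" using sets.top[of \<mu>] by (simp add: space_mu)
  then show "emeasure \<mu> (space \<mu>) = 1"
    using emeasure_mu[of "topspace T"] nu_space rho_open[of "topspace T"] by (simp add: space_mu)
qed

lemma measure_mu: "A \<in> sets \<mu> \<Longrightarrow> measure \<mu> A = \<rho> A"
  using emeasure_mu[of A] rho_nonneg[OF sets_mu_subset] by (simp add: measure_def)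

lemma open_sets: "openin T G \<Longrightarrow> G \<in> sets \<mu>"
  unfolding sets_mu L_iff using rho_split_open openin_subset by blast

lemma closed_sets: "closedin T F \<Longrightarrow> F \<in> sets \<mu>"
  using sets.Diff[OF sets.top open_sets[of "topspace T - F"]] closedin_subset[of T F]
  by (auto simp: space_mu double_diff closedin_def)

lemma measure_open: "openin T G \<Longrightarrow> measure \<mu> G = \<nu> G"
  by (simp add: measure_mu open_sets rho_open)

lemma measure_compl: "A \<in> sets \<mu> \<Longrightarrow> measure \<mu> (topspace T - A) = 1 - measure \<mu> A"
  using prob_space.prob_compl[OF prob_space_mu, of A] by (simp add: space_mu)

text \<open>The inequality \<open>nu_le\<close> for the complement. Regularization can only increase
  the mass of a closed set; this suffices to give \<open>K\<close>, and later a Dirac point, full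
  mass.\<close>

lemma measure_closed_ge: "closedin T F \<Longrightarrow> m F \<le> measure \<mu> F"
proof -
  assume F: "closedin T F"
  have "measure \<mu> (topspace T - F) \<le> m (topspace T - F)"
    using F nu_le by (simp add: measure_open openin_diff)
  also have "\<dots> = 1 - m F"
    using fa_prob_diff[OF m closedin_subset[OF F]] fa_prob_eq_1[OF m K_subset] by simp
  finally show ?thesis using measure_compl[OF closed_sets[OF F]] by simp
qed

lemma measure_K: "measure \<mu> K = 1"
  using measure_closed_ge[OF closed_K] fa_probD(3)[OF m] prob_space.prob_le_1[OF prob_space_mu, of K]
  by simp

text \<open>Outer regularity of the complement, which holds by the definition of
  \<open>\<rho>\<close> as an infimum over open sets.\<close>

lemma inner_regular:
  assumes A: "A \<in> sets \<mu>" and e: "0 < e"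
  obtains F where "closedin T F" "F \<subseteq> A" "measure \<mu> A \<le> measure \<mu> F + e"
proof -
  let ?A = "topspace T - A"
  have A': "?A \<in> sets \<mu>" using A sets.compl_sets by (simp flip: space_mu)
  then obtain G where G: "openin T G" "?A \<subseteq> G" "\<nu> G < measure \<mu> ?A + e"
    using rho_less[of ?A "measure \<mu> ?A + e"] e measure_mu[OF A'] by auto
  let ?F = "topspace T - G"
  have "measure \<mu> ?F = 1 - \<nu> G" using G(1) by (simp add: measure_compl measure_open open_sets)
  then have "measure \<mu> A \<le> measure \<mu> ?F + e" using G(3) measure_compl[OF A] by simp
  then show ?thesis using G by (intro that[of ?F]) auto
qed

lemma radon_probability_mu: "radon_probability T \<mu>"
  unfolding radon_probability_def radon_measure_def
proof (intro conjI allI impI ballI)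
  interpret prob_space \<mu> by (rule prob_space_mu)
  show "space \<mu> = topspace T" by (rule space_mu)
  show "finite_measure \<mu>" "prob_space \<mu>" by unfold_locales
  show "complete_measure \<mu>"
  proof
    fix A B assume B: "B \<subseteq> A" and A: "A \<in> null_sets \<mu>"
    then have AT: "A \<subseteq> topspace T" and "\<rho> A = 0"
      using sets_mu_subset[of A] measure_mu[of A] by (auto simp: null_sets_def measure_def)
    have "\<rho> (C \<inter> B) + \<rho> (C - B) \<le> \<rho> C" if C: "C \<subseteq> topspace T" for C
    proof -
      have "\<rho> (C \<inter> B) \<le> \<rho> A" using B AT by (intro rho_mono) auto
      moreover have "\<rho> (C - B) \<le> \<rho> C" using C by (intro rho_mono) auto
      ultimately show ?thesis using \<open>\<rho> A = 0\<close> by simp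
    qed
    then show "B \<in> sets \<mu>" unfolding sets_mu L_iff using B AT by blast
  qed
  show "U \<in> sets \<mu>" if "openin T U" for U using that by (rule open_sets)
  fix A assume A: "A \<in> sets \<mu>"
  show "emeasure \<mu> A = (SUP C\<in>{C. compactin T C \<and> C \<subseteq> A}. emeasure \<mu> C)"
  proof (rule antisym)
    show "emeasure \<mu> A \<le> (SUP C\<in>{C. compactin T C \<and> C \<subseteq> A}. emeasure \<mu> C)"
    proof (rule ennreal_le_epsilon)
      fix e :: real assume e: "0 < e"
      obtain F where F: "closedin T F" "F \<subseteq> A" "measure \<mu> A \<le> measure \<mu> F + e"
        using A e by (rule inner_regular)
      then have "compactin T F" using compact_T closedin_compact_space by blast
      have "emeasure \<mu> A \<le> emeasure \<mu> F + ennreal e"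
        using F(3) e by (simp add: emeasure_eq_measure ennreal_leI flip: ennreal_plus)
      also have "\<dots> \<le> (SUP C\<in>{C. compactin T C \<and> C \<subseteq> A}. emeasure \<mu> C) + ennreal e"
        using F \<open>compactin T F\<close> by (intro add_right_mono SUP_upper) auto
      finally show "emeasure \<mu> A \<le> (SUP C\<in>{C. compactin T C \<and> C \<subseteq> A}. emeasure \<mu> C) + ennreal e" .
    qed
    show "(SUP C\<in>{C. compactin T C \<and> C \<subseteq> A}. emeasure \<mu> C) \<le> emeasure \<mu> A"
      using A by (intro SUP_least emeasure_mono) auto
  qed
qed

end

section \<open>Dependence of the regular measure on the finitely additive probability\<close>

abbreviation fa_top :: "'a set \<Rightarrow> ('a set \<Rightarrow> real) topology" where
  "fa_top K \<equiv> top_of_set (fa_prob K)"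

lemma continuous_on_eval: "continuous_on S (\<lambda>m::'b \<Rightarrow> real. m A)"
  by (rule continuous_on_subset[OF continuous_on_product_coordinates]) simp

text \<open>Each defining condition concerns finitely many coordinates and is closed; countable
  additivity would not be such a condition.\<close>

lemma compact_fa_prob: "compact (fa_prob K)"
proof -
  let ?P = "PiE UNIV (\<lambda>_. {0..1}) :: ('a set \<Rightarrow> real) set"
  have "compactin (product_topology (\<lambda>_::'a set. euclidean :: real topology) UNIV) ?P"
    by (subst compactin_PiE) auto
  then have "compact ?P" by (simp add: euclidean_product_topology)
  moreover have "closed (fa_prob K)"
  proof -
    have eq: "fa_prob K = (\<Inter>A. {m. 0 \<le> m A}) \<inter> (\<Inter>A. {m. m (A \<inter> K) = m A}) \<inter> {m. m K = 1} \<inter>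
        (\<Inter>A. \<Inter>B\<in>{B. A \<inter> B = {}}. {m. m (A \<union> B) = m A + m B})"
      by (auto simp: fa_prob_def)
    show ?thesis
      unfolding eq
      by (intro closed_Int closed_INT ballI closed_Collect_eq closed_Collect_le continuous_intros
          continuous_on_eval)
  qed
  ultimately have "compact (?P \<inter> fa_prob K)" by (rule compact_Int_closed)
  moreover have "fa_prob K \<subseteq> ?P"
  proof
    fix m assume m: "m \<in> fa_prob K"
    have "m A \<in> {0..1}" for A using fa_probD(1)[OF m, of A] fa_prob_le_1[OF m, of A] by simp
    then show "m \<in> ?P" by (simp add: PiE_UNIV_domain)
  qed
  then have "?P \<inter> fa_prob K = fa_prob K" by (rule Int_absorb1)
  ultimately show ?thesis by simp
qed

lemma compact_space_fa_top: "compact_space (fa_top K)"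
  by (rule compact_space_subtopology) (simp add: compact_fa_prob)

lemma openin_fa_superlevel: "openin (fa_top K) {m \<in> fa_prob K. c < m A}"
proof -
  have "open {m. c < m A}" by (intro open_Collect_less continuous_intros continuous_on_eval)
  then have "openin (fa_top K) (fa_prob K \<inter> {m. c < m A})" by (rule openin_open_Int)
  moreover have "fa_prob K \<inter> {m. c < m A} = {m \<in> fa_prob K. c < m A}" by blast
  ultimately show ?thesis by simp
qed

text \<open>Replaces the transfinite exhaustion of the space by open sets. By Zorn's lemma there is
  a maximal open set with the property; if its complement were nonempty, resolvability would add an
  open \<open>W\<close> whose new part lies inside or outside \<open>A\<close>.\<close>

lemma resolvable_induct:
  assumes A: "resolvable_in Y A" and empty: "P {}"
    and chain: "\<And>\<C>. \<C> \<noteq> {} \<Longrightarrow> subset.chain {U. openin Y U} \<C> \<Longrightarrow> (\<And>U. U \<in> \<C> \<Longrightarrow> P U) \<Longrightarrow> P (\<Union>\<C>)"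
    and step: "\<And>U W. openin Y U \<Longrightarrow> openin Y W \<Longrightarrow> P U \<Longrightarrow> W - U \<subseteq> A \<or> (W - U) \<inter> A = {} \<Longrightarrow> P (U \<union> W)"
  shows "P (topspace Y)"
proof -
  let ?\<U> = "{U. openin Y U \<and> P U}"
  have "\<exists>M\<in>?\<U>. \<forall>X\<in>?\<U>. M \<subseteq> X \<longrightarrow> X = M"
  proof (rule subset_Zorn_nonempty)
    show "?\<U> \<noteq> {}" using empty by auto
    fix \<C> assume \<C>: "\<C> \<noteq> {}" "subset.chain ?\<U> \<C>"
    then have "subset.chain {U. openin Y U} \<C>" "\<And>U. U \<in> \<C> \<Longrightarrow> P U" "\<And>U. U \<in> \<C> \<Longrightarrow> openin Y U"
      by (auto simp: subset_chain_def)
    then show "\<Union>\<C> \<in> ?\<U>" using chain[OF \<C>(1)] by auto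
  qed
  then obtain U where U: "openin Y U" "P U" and max: "\<And>X. openin Y X \<Longrightarrow> P X \<Longrightarrow> U \<subseteq> X \<Longrightarrow> X = U"
    by auto
  have "U = topspace Y"
  proof (rule ccontr)
    assume "U \<noteq> topspace Y"
    then have "topspace Y - U \<noteq> {}" using openin_subset[OF U(1)] by blast
    then have "\<exists>V. openin (subtopology Y (topspace Y - U)) V \<and> V \<noteq> {} \<and> (V \<subseteq> A \<or> V \<inter> A = {})"
      using A unfolding resolvable_in_def by simp
    then obtain V where V: "openin (subtopology Y (topspace Y - U)) V" "V \<noteq> {}" "V \<subseteq> A \<or> V \<inter> A = {}"
      by (elim exE conjE)
    then obtain W where W: "openin Y W" "V = W \<inter> (topspace Y - U)" by (auto simp: openin_subtopology)
    then have "V = W - U" using openin_subset[OF W(1)] by blast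
    then have "P (U \<union> W)" using step[OF U(1) W(1) U(2)] V(3) by simp
    then have "U \<union> W = U" using max U(1) W(1) by blast
    then show False using \<open>V = W - U\<close> V(2) by blast
  qed
  then show ?thesis using U(2) by simp
qed

section \<open>Measurability of resolvable sets\<close>

context regularization
begin

text \<open>A form of tau-additivity: the chain may be uncountable, but a nearly optimal closed set
  is compact and therefore lies in a single member of the chain.\<close>

lemma nu_chain:
  assumes \<C>: "\<C> \<noteq> {}" "subset.chain {U. openin T U} \<C>" and c: "c < \<nu> (\<Union>\<C>)"
  shows "\<exists>U\<in>\<C>. c < \<nu> U"
proof -
  obtain F where F: "closedin T F" "F \<subseteq> \<Union>\<C>" "c < m F" using c nu_less by auto
  have "compactin T F" using F compact_T closedin_compact_space by blast
  moreover have "\<And>U. U \<in> \<C> \<Longrightarrow> openin T U" using \<C>(2) by (auto simp: subset_chain_def)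
  ultimately obtain \<F> where \<F>: "finite \<F>" "\<F> \<subseteq> \<C>" "F \<subseteq> \<Union>\<F>"
    using compactinD[of T F \<C>] F(2) by blast
  show ?thesis
  proof (cases "\<F> = {}")
    case True
    then have "F = {}" using \<F> by simp
    then show ?thesis using \<C>(1) F nu_upper[of F] by (meson all_not_in_conv empty_subsetI less_le_trans)
  next
    case False
    have "subset.chain {U. openin T U} \<F>"
      using \<C>(2) \<F>(2) unfolding subset_chain_def by (meson subset_iff subset_trans)
    then have "\<Union>\<F> \<in> \<F>" using \<F>(1) False Union_in_chain by blast
    then have "\<Union>\<F> \<in> \<C>" using \<F>(2) by blast
    moreover have "c < \<nu> (\<Union>\<F>)" using F \<F>(3) nu_upper[of F "\<Union>\<F>"] by simp
    ultimately show ?thesis by blast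
  qed
qed

lemma null_subset: "A \<in> sets \<mu> \<Longrightarrow> measure \<mu> A = 0 \<Longrightarrow> B \<subseteq> A \<Longrightarrow> B \<in> sets \<mu>"
proof -
  interpret prob_space \<mu> by (rule prob_space_mu)
  assume A: "A \<in> sets \<mu>" "measure \<mu> A = 0" and "B \<subseteq> A"
  then have "A \<in> null_sets \<mu>" by (simp add: null_sets_def emeasure_eq_measure)
  then show ?thesis
    using radon_probability_mu \<open>B \<subseteq> A\<close>
    by (meson complete_measure.complete radon_measure_def radon_probability_def)
qed

text \<open>At the union of a chain, which may be uncountable, countably many members already
  exhaust its measure. The rest of the union is a null set, and completeness makes its intersection
  with \<open>A\<close> measurable.\<close>

lemma resolvable_sets:
  assumes A: "resolvable_in T A"
  shows "A \<in> sets \<mu>"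
proof -
  interpret prob_space \<mu> by (rule prob_space_mu)
  have "A \<inter> topspace T \<in> sets \<mu>"
    using A
  proof (rule resolvable_induct[where P = "\<lambda>U. A \<inter> U \<in> sets \<mu>"])
    fix \<C> assume \<C>: "\<C> \<noteq> {}" "subset.chain {U. openin T U} \<C>" "\<And>U. U \<in> \<C> \<Longrightarrow> A \<inter> U \<in> sets \<mu>"
    have op: "openin T U" if "U \<in> \<C>" for U using \<C>(2) that by (auto simp: subset_chain_def)
    let ?W = "\<Union>\<C>"
    have W: "openin T ?W" using op by blast
    have "\<forall>n. \<exists>U. U \<in> \<C> \<and> \<nu> ?W - 1 / Suc n < \<nu> U"
      using nu_chain[OF \<C>(1,2)] by (simp add: Bex_def)
    from choice[OF this] obtain U where U: "\<And>n. U n \<in> \<C>" "\<And>n. \<nu> ?W - 1 / Suc n < \<nu> (U n)" by auto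
    let ?V = "\<Union>n. U n"
    have V: "openin T ?V" using U op by blast
    have "measure \<mu> (?W - ?V) = measure \<mu> ?W - measure \<mu> ?V"
      using U V W by (intro finite_measure_Diff open_sets) auto
    also have "\<dots> \<le> 0"
    proof (rule field_le_epsilon)
      fix e :: real assume "0 < e"
      then obtain n where "1 / Suc n < e" using nat_approx_posE by blast
      moreover have "\<nu> (U n) \<le> \<nu> ?V" by (intro nu_mono) auto
      ultimately show "measure \<mu> ?W - measure \<mu> ?V \<le> 0 + e"
        using U(2)[of n] V W by (simp add: measure_open)
    qed
    finally have "measure \<mu> (?W - ?V) = 0" by (simp add: measure_le_0_iff)
    moreover have "?W - ?V \<in> sets \<mu>" using V W by (intro sets.Diff open_sets)
    ultimately have "A \<inter> (?W - ?V) \<in> sets \<mu>" using null_subset[of "?W - ?V" "A \<inter> (?W - ?V)"] by simp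
    moreover have "(\<Union>n. A \<inter> U n) \<in> sets \<mu>"
      using \<C>(3)[OF U(1)] by (intro sets.countable_UN) auto
    moreover have "A \<inter> ?W = (\<Union>n. A \<inter> U n) \<union> (A \<inter> (?W - ?V))" using U(1) by blast
    ultimately show "A \<inter> ?W \<in> sets \<mu>" by simp
  next
    fix U W assume *: "openin T U" "openin T W" "A \<inter> U \<in> sets \<mu>" "W - U \<subseteq> A \<or> (W - U) \<inter> A = {}"
    have "A \<inter> (W - U) = W - U \<or> A \<inter> (W - U) = {}" using *(4) by blast
    then have "A \<inter> (W - U) \<in> sets \<mu>" using *(1,2) open_sets by auto
    moreover have "A \<inter> (U \<union> W) = (A \<inter> U) \<union> (A \<inter> (W - U))" by blast
    ultimately show "A \<inter> (U \<union> W) \<in> sets \<mu>" using *(3) by simp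
  qed simp
  moreover have "A \<inter> topspace T = A" using A by (auto simp: resolvable_in_def)
  ultimately show ?thesis by simp
qed

end

section \<open>How the measure of an open or resolvable set varies with the finitely additive
  probability\<close>

lemma fragmented_diff:
  assumes "fragmented Y \<phi>" "fragmented Y \<psi>"
  shows "fragmented Y (\<lambda>x. \<phi> x - \<psi> x)"
  unfolding fragmented_def
proof (intro allI impI, elim conjE)
  fix B and \<epsilon> :: real assume B: "B \<subseteq> topspace Y" "B \<noteq> {}" and \<epsilon>: "0 < \<epsilon>"
  have "0 < \<epsilon> / 2" using \<epsilon> by simp
  then obtain U where U: "openin (subtopology Y B) U" "U \<noteq> {}" "\<forall>x\<in>U. \<forall>y\<in>U. \<bar>\<phi> x - \<phi> y\<bar> < \<epsilon> / 2"
    using assms(1)[unfolded fragmented_def, rule_format, of B "\<epsilon> / 2"] B by (auto)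
  have "U \<subseteq> topspace Y" using openin_subset[OF U(1)] by auto
  then obtain V where V: "openin (subtopology Y U) V" "V \<noteq> {}" "\<forall>x\<in>V. \<forall>y\<in>V. \<bar>\<psi> x - \<psi> y\<bar> < \<epsilon> / 2"
    using assms(2)[unfolded fragmented_def, rule_format, of U "\<epsilon> / 2"] U(2) \<epsilon> by auto
  have "V \<subseteq> U" using openin_subset[OF V(1)] by auto
  show "\<exists>V. openin (subtopology Y B) V \<and> V \<noteq> {} \<and> (\<forall>x\<in>V. \<forall>y\<in>V. \<bar>\<phi> x - \<psi> x - (\<phi> y - \<psi> y)\<bar> < \<epsilon>)"
  proof (intro exI[of _ V] conjI ballI)
    show "openin (subtopology Y B) V" using U(1) V(1) by (rule openin_subtopology_trans)
    fix x y assume "x \<in> V" "y \<in> V"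
    then have "\<bar>\<phi> x - \<phi> y\<bar> < \<epsilon> / 2" "\<bar>\<psi> x - \<psi> y\<bar> < \<epsilon> / 2" using U(3) V(3) \<open>V \<subseteq> U\<close> by blast+
    then show "\<bar>\<phi> x - \<psi> x - (\<phi> y - \<psi> y)\<bar> < \<epsilon>" by linarith
  qed (rule V(2))
qed

lemma fragmented_const: "fragmented Y (\<lambda>_. c)"
  unfolding fragmented_def by (auto intro: openin_subtopology_refl[THEN iffD2])

lemma fragmented_add:
  assumes "fragmented Y \<phi>" "fragmented Y \<psi>"
  shows "fragmented Y (\<lambda>x. \<phi> x + \<psi> x)"
  using fragmented_diff[OF assms(1) fragmented_diff[OF fragmented_const[of Y 0] assms(2)]] by simp

lemma near_sup:
  assumes bdd: "\<And>x. x \<in> topspace Y \<Longrightarrow> \<phi> x \<le> M"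
    and B: "B \<subseteq> topspace Y" "B \<noteq> {}" and \<epsilon>: "0 < (\<epsilon>::real)"
  shows "\<exists>s x. (\<forall>y\<in>B. \<phi> y \<le> s) \<and> x \<in> B \<and> s - \<epsilon> < \<phi> x"
proof -
  have bd: "bdd_above (\<phi> ` B)" using bdd B by (intro bdd_aboveI2[where M = M]) auto
  have "Sup (\<phi> ` B) - \<epsilon> < Sup (\<phi> ` B)" using \<epsilon> by simp
  then obtain x where "x \<in> B" "Sup (\<phi> ` B) - \<epsilon> < \<phi> x"
    using less_cSUP_iff[OF B(2) bd] by auto
  then show ?thesis using cSUP_upper[OF _ bd] by (intro exI[of _ "Sup (\<phi> ` B)"] exI[of _ x]) auto
qed

text \<open>With \<open>s\<close> bounding \<open>\<phi>\<close> on \<open>B\<close> from above and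
  \<open>s - \<epsilon>\<close> exceeded somewhere on \<open>B\<close>, the set
  \<open>{s - \<epsilon> < \<phi>}\<close> is relatively open in \<open>B\<close>, nonempty, and
  \<open>\<phi>\<close> varies there by less than \<open>\<epsilon>\<close>.\<close>

lemma fragmented_lsc:
  assumes lsc: "\<And>c. openin Y {x \<in> topspace Y. c < \<phi> x}" and bdd: "\<And>x. x \<in> topspace Y \<Longrightarrow> \<phi> x \<le> M"
  shows "fragmented Y \<phi>"
  unfolding fragmented_def
proof (intro allI impI, elim conjE)
  fix B and \<epsilon> :: real assume B: "B \<subseteq> topspace Y" "B \<noteq> {}" and \<epsilon>: "0 < \<epsilon>"
  have "\<exists>s x. (\<forall>y\<in>B. \<phi> y \<le> s) \<and> x \<in> B \<and> s - \<epsilon> < \<phi> x"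
    using bdd B \<epsilon> by (rule near_sup)
  then obtain s x where s: "\<forall>y\<in>B. \<phi> y \<le> s" "x \<in> B" "s - \<epsilon> < \<phi> x" by (elim exE conjE)
  show "\<exists>V. openin (subtopology Y B) V \<and> V \<noteq> {} \<and> (\<forall>x\<in>V. \<forall>y\<in>V. \<bar>\<phi> x - \<phi> y\<bar> < \<epsilon>)"
  proof (intro exI[of _ "{x \<in> topspace Y. s - \<epsilon> < \<phi> x} \<inter> B"] conjI ballI)
    show "openin (subtopology Y B) ({x \<in> topspace Y. s - \<epsilon> < \<phi> x} \<inter> B)"
      using lsc by (rule openin_subtopology_Int)
    show "{x \<in> topspace Y. s - \<epsilon> < \<phi> x} \<inter> B \<noteq> {}" using s B by blast
    fix x y assume "x \<in> {x \<in> topspace Y. s - \<epsilon> < \<phi> x} \<inter> B" "y \<in> {x \<in> topspace Y. s - \<epsilon> < \<phi> x} \<inter> B"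
    then show "\<bar>\<phi> x - \<phi> y\<bar> < \<epsilon>" using bspec[OF s(1), of x] bspec[OF s(1), of y] by auto
  qed
qed

locale regular_family =
  fixes T :: "'a topology" and K :: "'a set"
  assumes compact_T: "compact_space T" and Hausdorff_T: "Hausdorff_space T"
    and closed_K: "closedin T K"
begin

abbreviation "X \<equiv> fa_top K"
abbreviation "\<mu> m \<equiv> regular_measure T m"

lemma regularization: "m \<in> fa_prob K \<Longrightarrow> regularization T K m"
  using compact_T Hausdorff_T closed_K by unfold_locales

text \<open>The measure of \<open>G\<close> is the supremum of the coordinates \<open>m F\<close>
  over closed \<open>F\<close> inside \<open>G\<close>. The topological dependence of the measures
  on \<open>m\<close> used below all derives from this.\<close>

lemma measure_open_lsc:
  assumes "openin T G"
  shows "openin X {m \<in> fa_prob K. c < measure (\<mu> m) G}"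
proof -
  have "{m \<in> fa_prob K. c < measure (\<mu> m) G} =
      (\<Union>F\<in>{F. closedin T F \<and> F \<subseteq> G}. {m \<in> fa_prob K. c < m F})"
    using regularization.measure_open[OF regularization assms] regularization.nu_less[OF regularization]
    by auto
  also have "openin X \<dots>" using openin_fa_superlevel by (intro openin_Union) blast
  finally show ?thesis .
qed

text \<open>The critical case is the union of a chain. Near the supremum \<open>s\<close> of the
  measure of the union over \<open>B\<close>, one member \<open>U\<close> of the chain already has
  measure above \<open>s - \<epsilon> / 4\<close> at one point of \<open>B\<close>, hence on a
  relatively open subset by lower semicontinuity. There the union exceeds \<open>U\<close> by at
  most \<open>\<epsilon> / 4\<close> in measure, uniformly in \<open>m\<close>, so that
  fragmentability passes from \<open>A \<inter> U\<close> to the union.\<close>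

lemma measure_resolvable_fragmented:
  assumes A: "resolvable_in T A"
  shows "fragmented X (\<lambda>m. measure (\<mu> m) A)"
proof -
  have sets: "A \<in> sets (\<mu> m)" if "m \<in> fa_prob K" for m
    using regularization.resolvable_sets[OF regularization[OF that] A] .
  have op_sets: "U \<in> sets (\<mu> m)" if "m \<in> fa_prob K" "openin T U" for m U
    using regularization.open_sets[OF regularization[OF that(1)] that(2)] .
  have fin: "finite_measure (\<mu> m)" if "m \<in> fa_prob K" for m
    using regularization.prob_space_mu[OF regularization[OF that]] by (simp add: prob_space_def)
  have le_1: "measure (\<mu> m) B \<le> 1" if "m \<in> fa_prob K" for m B
    using prob_space.prob_le_1[OF regularization.prob_space_mu[OF regularization[OF that]]] .
  have frag_open: "fragmented X (\<lambda>m. measure (\<mu> m) U)" if "openin T U" for U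
    using measure_open_lsc[OF that] le_1 by (intro fragmented_lsc) auto
  have cong: "fragmented X \<psi>" if \<phi>: "fragmented X \<phi>" and eq: "\<And>m. m \<in> fa_prob K \<Longrightarrow> \<phi> m = \<psi> m" for \<phi> \<psi>
    unfolding fragmented_def
  proof (intro allI impI, elim conjE)
    fix B and \<epsilon> :: real assume B: "B \<subseteq> topspace X" "B \<noteq> {}" and \<epsilon>: "0 < \<epsilon>"
    then obtain U where U: "openin (subtopology X B) U" "U \<noteq> {}" "\<forall>x\<in>U. \<forall>y\<in>U. \<bar>\<phi> x - \<phi> y\<bar> < \<epsilon>"
      using \<phi>[unfolded fragmented_def, rule_format, of B \<epsilon>] by auto
    moreover have "U \<subseteq> fa_prob K" using openin_subset[OF U(1)] by auto
    ultimately show "\<exists>V. openin (subtopology X B) V \<and> V \<noteq> {} \<and> (\<forall>x\<in>V. \<forall>y\<in>V. \<bar>\<psi> x - \<psi> y\<bar> < \<epsilon>)"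
      using eq by (intro exI[of _ U]) (simp add: subset_iff)
  qed
  have "fragmented X (\<lambda>m. measure (\<mu> m) (A \<inter> topspace T))"
    using A
  proof (rule resolvable_induct[where P = "\<lambda>U. fragmented X (\<lambda>m. measure (\<mu> m) (A \<inter> U))"])
    show "fragmented X (\<lambda>m. measure (\<mu> m) (A \<inter> {}))" using fragmented_const[of X] by simp
  next
    fix \<C> assume \<C>: "\<C> \<noteq> {}" "subset.chain {U. openin T U} \<C>"
      and frag: "\<And>U. U \<in> \<C> \<Longrightarrow> fragmented X (\<lambda>m. measure (\<mu> m) (A \<inter> U))"
    let ?W = "\<Union>\<C>"
    have op: "openin T U" if "U \<in> \<C>" for U using \<C>(2) that by (auto simp: subset_chain_def)
    then have opW: "openin T ?W" by blast
    show "fragmented X (\<lambda>m. measure (\<mu> m) (A \<inter> ?W))"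
      unfolding fragmented_def
    proof (intro allI impI, elim conjE)
      fix B and \<epsilon> :: real assume B: "B \<subseteq> topspace X" "B \<noteq> {}" and \<epsilon>: "0 < \<epsilon>"
      have \<epsilon>4: "0 < \<epsilon> / 4" using \<epsilon> by simp
      have "\<exists>s m0. (\<forall>m\<in>B. measure (\<mu> m) ?W \<le> s) \<and> m0 \<in> B \<and> s - \<epsilon> / 4 < measure (\<mu> m0) ?W"
        by (rule near_sup[OF _ B \<epsilon>4, where M = 1]) (use le_1 in auto)
      then obtain s m0 where s: "\<forall>m\<in>B. measure (\<mu> m) ?W \<le> s" "m0 \<in> B" "s - \<epsilon> / 4 < measure (\<mu> m0) ?W"
        by (elim exE conjE)
      have m0: "m0 \<in> fa_prob K" using B s by auto
      then have "\<exists>U\<in>\<C>. s - \<epsilon> / 4 < inner_content T m0 U"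
        using regularization.nu_chain[OF regularization[OF m0] \<C>] s(3)
          regularization.measure_open[OF regularization[OF m0] opW] by simp
      then obtain U where U: "U \<in> \<C>" "s - \<epsilon> / 4 < measure (\<mu> m0) U"
        using regularization.measure_open[OF regularization[OF m0] op] by auto
      let ?O = "{m \<in> fa_prob K. s - \<epsilon> / 4 < measure (\<mu> m) U} \<inter> B"
      have O: "openin (subtopology X B) ?O"
        using measure_open_lsc[OF op[OF U(1)]] by (rule openin_subtopology_Int)
      have "?O \<noteq> {}" "?O \<subseteq> topspace X" using U s(2) m0 by auto
      then obtain V where V: "openin (subtopology X ?O) V" "V \<noteq> {}"
        "\<forall>x\<in>V. \<forall>y\<in>V. \<bar>measure (\<mu> x) (A \<inter> U) - measure (\<mu> y) (A \<inter> U)\<bar> < \<epsilon> / 4"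
        using frag[OF U(1), unfolded fragmented_def, rule_format, of ?O "\<epsilon> / 4"] \<epsilon>4 by auto
      have VO: "V \<subseteq> ?O" using openin_subset[OF V(1)] by auto
      have close: "\<bar>measure (\<mu> m) (A \<inter> ?W) - measure (\<mu> m) (A \<inter> U)\<bar> \<le> \<epsilon> / 4" if "m \<in> V" for m
      proof -
        have m: "m \<in> fa_prob K" "m \<in> B" "s - \<epsilon> / 4 < measure (\<mu> m) U" using that VO by auto
        interpret finite_measure "\<mu> m" using m(1) by (rule fin)
        have meas: "A \<in> sets (\<mu> m)" "U \<in> sets (\<mu> m)" "?W \<in> sets (\<mu> m)"
          using sets op_sets m(1) op[OF U(1)] opW by blast+
        have sub: "U \<subseteq> ?W" using U(1) by blast
        have "measure (\<mu> m) (?W - U) = measure (\<mu> m) ?W - measure (\<mu> m) U"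
          using meas sub by (intro finite_measure_Diff)
        \<comment> \<open>The upper bound \<open>s\<close> holds on all of \<open>B\<close>, the
          lower bound on the relatively open set; their difference controls the remainder.\<close>
        then have le: "measure (\<mu> m) (?W - U) \<le> \<epsilon> / 4" using bspec[OF s(1) m(2)] m(3) by simp
        have "measure (\<mu> m) (A \<inter> ?W - A \<inter> U) = measure (\<mu> m) (A \<inter> ?W) - measure (\<mu> m) (A \<inter> U)"
          using meas sub by (intro finite_measure_Diff) auto
        moreover have "measure (\<mu> m) (A \<inter> ?W - A \<inter> U) \<le> measure (\<mu> m) (?W - U)"
          using meas by (intro finite_measure_mono) auto
        ultimately show ?thesis using le by (smt (verit) measure_nonneg)
      qed
      show "\<exists>V. openin (subtopology X B) V \<and> V \<noteq> {} \<and>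
          (\<forall>x\<in>V. \<forall>y\<in>V. \<bar>measure (\<mu> x) (A \<inter> ?W) - measure (\<mu> y) (A \<inter> ?W)\<bar> < \<epsilon>)"
      proof (intro exI[of _ V] conjI ballI)
        show "openin (subtopology X B) V" using O V(1) by (rule openin_subtopology_trans)
        show "V \<noteq> {}" by (rule V(2))
        fix x y assume xy: "x \<in> V" "y \<in> V"
        then have "\<bar>measure (\<mu> x) (A \<inter> U) - measure (\<mu> y) (A \<inter> U)\<bar> < \<epsilon> / 4" using V(3) by blast
        then show "\<bar>measure (\<mu> x) (A \<inter> ?W) - measure (\<mu> y) (A \<inter> ?W)\<bar> < \<epsilon>"
          using close[OF xy(1)] close[OF xy(2)] \<epsilon> by linarith
      qed
    qed
  next
    fix U W assume *: "openin T U" "openin T W" "fragmented X (\<lambda>m. measure (\<mu> m) (A \<inter> U))"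
      "W - U \<subseteq> A \<or> (W - U) \<inter> A = {}"
    have UW: "openin T (U \<union> W)" using * by blast
    from *(4) show "fragmented X (\<lambda>m. measure (\<mu> m) (A \<inter> (U \<union> W)))"
    proof
      assume sub: "W - U \<subseteq> A"
      \<comment> \<open>The added part is the whole of \<open>W - U\<close>, whose measure is a
        difference of measures of two open sets.\<close>
      have "fragmented X (\<lambda>m. measure (\<mu> m) (A \<inter> U) + (measure (\<mu> m) (U \<union> W) - measure (\<mu> m) U))"
        using *(3) fragmented_diff[OF frag_open[OF UW] frag_open[OF *(1)]] by (rule fragmented_add)
      then show ?thesis
      proof (rule cong)
        fix m assume m: "m \<in> fa_prob K"
        interpret finite_measure "\<mu> m" using m by (rule fin)
        have meas: "A \<in> sets (\<mu> m)" "U \<in> sets (\<mu> m)" "W \<in> sets (\<mu> m)"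
          using sets op_sets m * by blast+
        have "measure (\<mu> m) (U \<union> W - U) = measure (\<mu> m) (U \<union> W) - measure (\<mu> m) U"
          using meas by (intro finite_measure_Diff) auto
        moreover have "measure (\<mu> m) (A \<inter> U \<union> (U \<union> W - U)) = measure (\<mu> m) (A \<inter> U) + measure (\<mu> m) (U \<union> W - U)"
          using meas by (intro finite_measure_Union) auto
        moreover have "A \<inter> U \<union> (U \<union> W - U) = A \<inter> (U \<union> W)" using sub by blast
        ultimately show "measure (\<mu> m) (A \<inter> U) + (measure (\<mu> m) (U \<union> W) - measure (\<mu> m) U) =
            measure (\<mu> m) (A \<inter> (U \<union> W))" by simp
      qed
    next
      assume "(W - U) \<inter> A = {}"
      then have "A \<inter> (U \<union> W) = A \<inter> U" by blast
      then show ?thesis using *(3) by simp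
    qed
  qed
  moreover have "A \<inter> topspace T = A" using A by (auto simp: resolvable_in_def)
  ultimately show ?thesis by simp
qed

end

section \<open>Integrals as functions of the finitely additive probability\<close>

text \<open>For the open sets as \<open>\<Sigma>\<close> this is lower semicontinuity. The one-sided
  notion is the right one because the measure of an open set is controlled only from below.\<close>

definition lower_in :: "'a set \<Rightarrow> 'a set set \<Rightarrow> ('a \<Rightarrow> real) \<Rightarrow> bool" where
  "lower_in \<Omega> \<Sigma> u \<longleftrightarrow> (\<forall>c. {x \<in> \<Omega>. c < u x} \<in> \<Sigma>)"

lemma lower_inD: "lower_in \<Omega> \<Sigma> u \<Longrightarrow> {x \<in> \<Omega>. c < u x} \<in> \<Sigma>"
  by (simp add: lower_in_def)

lemma lower_in_cong: "(\<And>x. x \<in> \<Omega> \<Longrightarrow> u x = v x) \<Longrightarrow> lower_in \<Omega> \<Sigma> u \<longleftrightarrow> lower_in \<Omega> \<Sigma> v"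
  by (simp add: lower_in_def cong: conj_cong)

lemma lower_in_const:
  assumes "sigma_lattice \<Omega> \<Sigma>"
  shows "lower_in \<Omega> \<Sigma> (\<lambda>_. a)"
  unfolding lower_in_def
proof
  fix c show "{x \<in> \<Omega>. c < a} \<in> \<Sigma>"
    using sigma_lattice_space[OF assms] sigma_lattice_empty[OF assms] by (cases "c < a") auto
qed

lemma lower_in_add:
  assumes \<Sigma>: "sigma_lattice \<Omega> \<Sigma>" and u: "lower_in \<Omega> \<Sigma> u" and v: "lower_in \<Omega> \<Sigma> v"
  shows "lower_in \<Omega> \<Sigma> (\<lambda>x. u x + v x)"
  unfolding lower_in_def
proof
  fix c
  have "{x \<in> \<Omega>. c < u x + v x} = (\<Union>q\<in>\<rat>. {x \<in> \<Omega>. q < u x} \<inter> {x \<in> \<Omega>. c - q < v x})"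
  proof (intro set_eqI iffI)
    fix x assume x: "x \<in> {x \<in> \<Omega>. c < u x + v x}"
    then have "c - v x < u x" by simp
    then obtain q where "q \<in> \<rat>" "c - v x < q" "q < u x" using Rats_dense_in_real by blast
    then show "x \<in> (\<Union>q\<in>\<rat>. {x \<in> \<Omega>. q < u x} \<inter> {x \<in> \<Omega>. c - q < v x})"
      using x by (intro UN_I[of q]) auto
  qed auto
  also have "\<dots> \<in> \<Sigma>"
    using u v by (intro sigma_lattice_UN[OF \<Sigma>] sigma_lattice_Int[OF \<Sigma>] countable_rat) (auto simp: lower_in_def)
  finally show "{x \<in> \<Omega>. c < u x + v x} \<in> \<Sigma>" .
qed

lemma lower_in_cmult:
  assumes \<Sigma>: "sigma_lattice \<Omega> \<Sigma>" and u: "lower_in \<Omega> \<Sigma> u" and a: "0 \<le> (a::real)"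
  shows "lower_in \<Omega> \<Sigma> (\<lambda>x. a * u x)"
proof (cases "a = 0")
  case True
  then show ?thesis using lower_in_const[OF \<Sigma>, of 0] by simp
next
  case False
  then have "{x \<in> \<Omega>. c < a * u x} = {x \<in> \<Omega>. c / a < u x}" for c
    using a by (auto simp: field_simps)
  then show ?thesis using u by (simp add: lower_in_def)
qed

lemma lower_in_sum:
  assumes \<Sigma>: "sigma_lattice \<Omega> \<Sigma>" and u: "\<And>i. i \<in> I \<Longrightarrow> lower_in \<Omega> \<Sigma> (u i)"
  shows "lower_in \<Omega> \<Sigma> (\<lambda>x. \<Sum>i\<in>I. u i x)"
  using u
proof (induction I rule: infinite_finite_induct)
  case (insert i I)
  then show ?case using lower_in_add[OF \<Sigma>, of "u i" "\<lambda>x. \<Sum>i\<in>I. u i x"] by simp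
qed (use lower_in_const[OF \<Sigma>, of 0] in auto)

lemma lower_in_SUP:
  assumes \<Sigma>: "sigma_lattice \<Omega> \<Sigma>" and u: "\<And>n::nat. lower_in \<Omega> \<Sigma> (u n)"
    and iff: "\<And>x c. x \<in> \<Omega> \<Longrightarrow> c < v x \<longleftrightarrow> (\<exists>n. c < u n x)"
  shows "lower_in \<Omega> \<Sigma> v"
  unfolding lower_in_def
proof
  fix c
  have "{x \<in> \<Omega>. c < v x} = (\<Union>n. {x \<in> \<Omega>. c < u n x})" using iff by auto
  also have "\<dots> \<in> \<Sigma>" using u by (intro sigma_lattice_UN[OF \<Sigma>]) (auto simp: lower_in_def)
  finally show "{x \<in> \<Omega>. c < v x} \<in> \<Sigma>" .
qed

text \<open>When the superlevel sets lie in an algebra, passing to \<open>Sigma2\<close> makes the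
  function two-sided: \<open>{c < - u}\<close> is the union of the complements of the sets
  \<open>{- c - 1 / Suc n < u}\<close>. Negative coefficients thus become admissible.\<close>

lemma lower_in_Sigma2_algebra:
  assumes A: "algebra \<Omega> \<A>" and u: "lower_in \<Omega> \<A> u"
  shows "lower_in \<Omega> (Sigma2 \<A>) u" "lower_in \<Omega> (Sigma2 \<A>) (\<lambda>x. - u x)"
proof -
  show "lower_in \<Omega> (Sigma2 \<A>) u" using u subset_Sigma2 by (auto simp: lower_in_def)
  show "lower_in \<Omega> (Sigma2 \<A>) (\<lambda>x. - u x)"
    unfolding lower_in_def
  proof
    fix c
    interpret algebra \<Omega> \<A> by (rule A)
    have "{x \<in> \<Omega>. c < - u x} = (\<Union>n. \<Omega> - {x \<in> \<Omega>. - c - 1 / Suc n < u x})"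
    proof (intro set_eqI iffI)
      fix x assume x: "x \<in> {x \<in> \<Omega>. c < - u x}"
      then obtain n where "1 / Suc n < - u x - c" using nat_approx_posE[of "- u x - c"] by auto
      then show "x \<in> (\<Union>n. \<Omega> - {x \<in> \<Omega>. - c - 1 / Suc n < u x})" using x by (intro UN_I[of n]) auto
    next
      fix x assume "x \<in> (\<Union>n. \<Omega> - {x \<in> \<Omega>. - c - 1 / Suc n < u x})"
      then obtain n where "x \<in> \<Omega> - {x \<in> \<Omega>. - c - 1 / Suc n < u x}" by (rule UN_E)
      then have "x \<in> \<Omega>" "u x \<le> - c - 1 / Suc n" by auto
      moreover have "0 < 1 / real (Suc n)" by simp
      ultimately have "c < - u x" by linarith
      then show "x \<in> {x \<in> \<Omega>. c < - u x}" using \<open>x \<in> \<Omega>\<close> by simp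
    qed
    also have "\<dots> \<in> Sigma2 \<A>" using u by (intro Sigma2_UN) (auto simp: lower_in_def)
    finally show "{x \<in> \<Omega>. c < - u x} \<in> Sigma2 \<A>" .
  qed
qed

text \<open>Finite linear combinations of indicators of open sets. They are closed under products
  because open sets are closed under intersection, and so they contain the indicators of all sets in
  \<open>Bos T\<close>.\<close>

inductive open_comb :: "'a topology \<Rightarrow> ('a \<Rightarrow> real) \<Rightarrow> bool" for T where
  single: "openin T G \<Longrightarrow> open_comb T (\<lambda>x. c * indicator G x)"
| add: "open_comb T f \<Longrightarrow> open_comb T g \<Longrightarrow> open_comb T (\<lambda>x. f x + g x)"

lemma open_comb_mult_single:
  assumes "open_comb T f" "openin T G"
  shows "open_comb T (\<lambda>x. f x * (c * indicator G x))"
  using assms(1)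
proof induction
  case (single H d)
  have "open_comb T (\<lambda>x. (d * c) * indicator (H \<inter> G) x)"
    using single assms(2) by (intro open_comb.single) auto
  then show ?case by (simp add: indicator_inter_arith mult_ac)
next
  case (add f g)
  then show ?case using open_comb.add by (force simp: distrib_right)
qed

lemma open_comb_mult:
  assumes f: "open_comb T f" and "open_comb T g"
  shows "open_comb T (\<lambda>x. f x * g x)"
  using assms(2)
proof induction
  case (single G c)
  then show ?case using open_comb_mult_single[OF f] by simp
next
  case (add g h)
  then show ?case using open_comb.add by (force simp: distrib_left)
qed

lemma open_comb_Bos:
  assumes "A \<in> Bos T"
  shows "open_comb T (indicator A)"
proof (rule Bos_induct[OF assms])
  have one: "open_comb T (\<lambda>x. c * indicator (topspace T) x)" for c by (rule open_comb.single) simp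
  \<comment> \<open>Negation is obtained as a product with \<open>-1\<close> times the indicator of
    the space, which requires \<open>f\<close> to vanish outside it.\<close>
  have neg: "open_comb T (\<lambda>x. - f x)" if f: "open_comb T f" and "\<And>x. x \<notin> topspace T \<Longrightarrow> f x = 0" for f
  proof -
    have "open_comb T (\<lambda>x. (-1 * indicator (topspace T) x) * f x)" using one f by (rule open_comb_mult)
    moreover have "(-1 * indicator (topspace T) x) * f x = - f x" for x
      using that(2)[of x] by (cases "x \<in> topspace T") simp_all
    ultimately show ?thesis by (simp only:)
  qed
  show "open_comb T (indicator U)" if "openin T U" for U
    using open_comb.single[OF that, of 1] by simp
  show "algebra (topspace T) {A. A \<subseteq> topspace T \<and> open_comb T (indicator A)}"
    unfolding algebra_iff_Un
  proof (intro conjI ballI)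
    show "{} \<in> {A. A \<subseteq> topspace T \<and> open_comb T (indicator A)}"
    proof -
      have "(\<lambda>x. 1 * indicator {} x) = (indicator {} :: 'a \<Rightarrow> real)" by (rule ext) simp
      then show ?thesis using open_comb.single[of T "{}" 1] by (simp only:) simp
    qed
  next
    fix A assume A: "A \<in> {A. A \<subseteq> topspace T \<and> open_comb T (indicator A)}"
    have "open_comb T (\<lambda>x. - indicator A x)" using A by (intro neg) (auto simp: indicator_eq_0_iff)
    from open_comb.add[OF one[of 1] this]
    have "open_comb T (\<lambda>x. 1 * indicator (topspace T) x + - indicator A x)" .
    moreover have "(\<lambda>x. 1 * indicator (topspace T) x + - indicator A x) = (indicator (topspace T - A) :: _ \<Rightarrow> real)"
      using A by (intro ext) (auto simp: indicator_def)
    ultimately have "open_comb T (indicator (topspace T - A))" by (simp only:)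
    then show "topspace T - A \<in> {A. A \<subseteq> topspace T \<and> open_comb T (indicator A)}" by simp
  next
    fix A B assume A: "A \<in> {A. A \<subseteq> topspace T \<and> open_comb T (indicator A)}"
      and B: "B \<in> {A. A \<subseteq> topspace T \<and> open_comb T (indicator A)}"
    have "open_comb T (\<lambda>x. - (indicator A x * indicator B x))"
      using A B by (intro neg open_comb_mult) (auto simp: indicator_eq_0_iff)
    then have "open_comb T (\<lambda>x. (indicator A x + indicator B x) + - (indicator A x * indicator B x))"
      using A B by (intro open_comb.add) auto
    moreover have "(\<lambda>x. (indicator A x + indicator B x) + - (indicator A x * indicator B x)) =
        (indicator (A \<union> B) :: _ \<Rightarrow> real)"
      by (intro ext) (auto simp: indicator_def)
    ultimately have "open_comb T (indicator (A \<union> B))" by (simp only:)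
    then show "A \<union> B \<in> {A. A \<subseteq> topspace T \<and> open_comb T (indicator A)}" using A B by simp
  qed auto
qed

section \<open>Layer-cake approximation of integrals\<close>

lemma layer_count:
  fixes a :: real
  assumes "0 \<le> a" "a \<le> real N"
  shows "a \<le> (\<Sum>k<N. if real k < a then 1 else 0)" "(\<Sum>k<N. if real k < a then 1 else 0) \<le> a + 1"
proof -
  have "{k. k < N \<and> real k < a} = {..<nat \<lceil>a\<rceil>}"
    using assms by (auto simp: less_ceiling_iff zless_nat_conj zless_nat_eq_int_zless) 
  then have "card {k. k < N \<and> real k < a} = nat \<lceil>a\<rceil>" by simp
  moreover have "(\<Sum>k<N. if real k < a then 1 else (0::real)) = real (card {k. k < N \<and> real k < a})"
    by (simp add: sum.If_cases lessThan_def Int_def)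
  ultimately have "(\<Sum>k<N. if real k < a then 1 else (0::real)) = of_int \<lceil>a\<rceil>" using assms by simp
  then show "a \<le> (\<Sum>k<N. if real k < a then 1 else 0)" "(\<Sum>k<N. if real k < a then 1 else 0) \<le> a + 1"
    by linarith+
qed

text \<open>\<open>S\<close> counts the integers from 0 to \<open>n\<close> that lie below
  \<open>Suc n * v\<close> and divides by \<open>Suc n\<close>; it is \<open>v\<close> rounded up to
  a multiple of \<open>1 / Suc n\<close>.\<close>

lemma layer_cake_bounds:
  fixes v :: real and n :: nat
  assumes "0 \<le> v" "v \<le> 1"
  defines "S \<equiv> \<Sum>k<Suc n. (1 / Suc n) * (if k / Suc n < v then 1 else 0)"
  shows "v \<le> S" "S \<le> v + 1 / Suc n"
proof -
  let ?N = "real (Suc n)"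
  have a: "0 \<le> ?N * v" "?N * v \<le> real (Suc n)" using assms by (auto simp: mult_left_le)
  have "(if k / ?N < v then 1 else (0::real)) = (if real k < ?N * v then 1 else 0)" for k
    by (simp add: field_simps)
  then have S: "S = (1 / ?N) * (\<Sum>k<Suc n. if real k < ?N * v then 1 else 0)"
    unfolding S_def by (simp only: sum_distrib_left)
  have "(1 / ?N) * (?N * v) \<le> S" unfolding S using layer_count(1)[OF a] by (intro mult_left_mono) auto
  then show "v \<le> S" by simp
  have "S \<le> (1 / ?N) * (?N * v + 1)" unfolding S using layer_count(2)[OF a] by (intro mult_left_mono) auto
  then show "S \<le> v + 1 / Suc n" by (simp add: distrib_left)
qed

text \<open>Integrates the pointwise rounding bounds. An integral thereby becomes, up to
  \<open>1 / Suc n\<close>, a nonnegative combination of measures of superlevel sets.\<close>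

lemma (in prob_space) layer_integral_bounds:
  assumes u: "u \<in> borel_measurable M" "\<And>x. x \<in> space M \<Longrightarrow> 0 \<le> u x \<and> u x \<le> (1::real)"
  defines "L \<equiv> \<lambda>n::nat. \<Sum>k<Suc n. (1 / Suc n) * prob {x \<in> space M. k / Suc n < u x}"
  shows "(LINT x|M. u x) \<le> L n" "L n \<le> (LINT x|M. u x) + 1 / Suc n"
proof -
  let ?S = "\<lambda>x. \<Sum>k<Suc n. (1 / Suc n) * indicator {x \<in> space M. k / Suc n < u x} x :: real"
  have sets: "{x \<in> space M. t < u x} \<in> events" for t using u(1) by simp
  have int: "integrable M u" using u by (intro integrable_const_bound[where B = 1]) auto
  have intS: "integrable M ?S" using sets by (auto simp: less_top[symmetric])
  have L: "(LINT x|M. ?S x) = L n"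
    unfolding L_def using sets
    by (subst Bochner_Integration.integral_sum) (auto simp: less_top[symmetric] sets.Int_space_eq2)
  have S: "u x \<le> ?S x \<and> ?S x \<le> u x + 1 / Suc n" if x: "x \<in> space M" for x
  proof -
    have "?S x = (\<Sum>k<Suc n. (1 / Suc n) * (if k / Suc n < u x then 1 else 0))"
      using x by (intro sum.cong refl) (simp add: indicator_def)
    then show ?thesis using layer_cake_bounds[of "u x" n] u(2)[OF x] by simp
  qed
  show "(LINT x|M. u x) \<le> L n"
    unfolding L[symmetric] using int intS S by (intro integral_mono) auto
  have "(LINT x|M. ?S x) \<le> (LINT x|M. u x + 1 / Suc n)"
    using int intS S by (intro integral_mono) auto
  also have "\<dots> = (LINT x|M. u x) + 1 / Suc n"
    using int by (subst Bochner_Integration.integral_add) (auto simp: prob_space)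
  finally show "L n \<le> (LINT x|M. u x) + 1 / Suc n" unfolding L .
qed

section \<open>Transfer of set classes from \<open>K\<close> to the space of finitely additive
  probabilities\<close>

context regular_family
begin

text \<open>The measures live on \<open>T\<close>, whereas \<open>h\<close> is controlled only on
  \<open>K\<close>; the indicator removes the irrelevant values.\<close>

definition K_integral :: "('a \<Rightarrow> complex) \<Rightarrow> ('a set \<Rightarrow> real) \<Rightarrow> complex" where
  "K_integral h m = (LINT x|\<mu> m. indicator K x *\<^sub>R h x)"

text \<open>The only input in which the three families differ; everything from here to membership of
  \<open>K_integral h\<close> in a hierarchy is common.\<close>

definition transfers :: "'a set set \<Rightarrow> ('a set \<Rightarrow> real) set set \<Rightarrow> bool" where
  "transfers \<Sigma> \<Sigma>' \<longleftrightarrow> (\<forall>A\<in>\<Sigma>. (\<forall>m\<in>fa_prob K. A \<in> sets (\<mu> m)) \<and>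
     lower_in (fa_prob K) \<Sigma>' (\<lambda>m. measure (\<mu> m) A))"

lemma prob_space_mu: "m \<in> fa_prob K \<Longrightarrow> prob_space (\<mu> m)"
  by (rule regularization.prob_space_mu[OF regularization])

lemma space_mu: "m \<in> fa_prob K \<Longrightarrow> space (\<mu> m) = topspace T"
  by (rule regularization.space_mu[OF regularization])

lemma K_sets: "m \<in> fa_prob K \<Longrightarrow> K \<in> sets (\<mu> m)"
  by (rule regularization.closed_sets[OF regularization closed_K])

lemma measure_K: "m \<in> fa_prob K \<Longrightarrow> measure (\<mu> m) K = 1"
  by (rule regularization.measure_K[OF regularization])

lemma K_subset: "K \<subseteq> topspace T"
  using closed_K by (rule closedin_subset)

text \<open>A relatively open set is the trace of an open \<open>G\<close>, and has the same measure
  as \<open>G\<close> because \<open>K\<close> carries full mass.\<close>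

lemma transfers_openin:
  "transfers (Collect (openin (subtopology T K))) (Collect (openin X))"
  unfolding transfers_def
proof (intro ballI conjI)
  fix A assume "A \<in> Collect (openin (subtopology T K))"
  then obtain G where G: "openin T G" "A = G \<inter> K" by (auto simp: openin_subtopology)
  show A: "A \<in> sets (\<mu> m)" if "m \<in> fa_prob K" for m
    using G K_sets[OF that] regularization.open_sets[OF regularization[OF that] G(1)] by auto
  have "measure (\<mu> m) A = measure (\<mu> m) G" if m: "m \<in> fa_prob K" for m
  proof -
    interpret prob_space "\<mu> m" using m by (rule prob_space_mu)
    have Gs: "G \<in> events" using regularization.open_sets[OF regularization[OF m] G(1)] .
    have "prob (space (\<mu> m) - K) = 0" using prob_compl[OF K_sets[OF m]] measure_K[OF m] by simp
    moreover have "prob (G - K) \<le> prob (space (\<mu> m) - K)"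
      using K_sets[OF m] sets.sets_into_space[OF Gs] by (intro finite_measure_mono) auto
    ultimately have "prob (G - K) = 0" by (simp add: measure_le_0_iff)
    moreover have "prob (A \<union> (G - K)) = prob A + prob (G - K)"
      using G A[OF m] Gs K_sets[OF m] by (intro finite_measure_Union) auto
    moreover have "A \<union> (G - K) = G" using G by blast
    ultimately show ?thesis by simp
  qed
  then show "lower_in (fa_prob K) (Collect (openin X)) (\<lambda>m. measure (\<mu> m) A)"
    using measure_open_lsc[OF G(1)] by (simp add: lower_in_def cong: conj_cong)
qed

text \<open>The algebra allows a countable union to be written as an increasing union; the measure
  is then the supremum of the measures of its stages.\<close>

lemma transfers_Sigma2:
  assumes A: "algebra K \<A>" and \<Sigma>': "sigma_lattice (fa_prob K) \<Sigma>'" and tr: "transfers \<A> \<Sigma>'"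
  shows "transfers (Sigma2 \<A>) \<Sigma>'"
  unfolding transfers_def
proof (intro ballI conjI)
  interpret algebra K \<A> by (rule A)
  fix S assume "S \<in> Sigma2 \<A>"
  then obtain \<C> where \<C>: "countable \<C>" "\<C> \<subseteq> \<A>" "S = \<Union>\<C>" by (auto simp: Sigma2_def)
  have meas: "B \<in> sets (\<mu> m)" if "B \<in> \<A>" "m \<in> fa_prob K" for B m
    using tr that by (auto simp: transfers_def)
  show "S \<in> sets (\<mu> m)" if "m \<in> fa_prob K" for m
    using \<C> meas that by (auto intro!: sets.countable_Union)
  \<comment> \<open>The empty set is inserted so that the enumeration has a meaning even for an
    empty family.\<close>
  define B where "B n = (\<Union>i<n. from_nat_into (insert {} \<C>) i)" for n :: nat
  have ran: "range (from_nat_into (insert {} \<C>)) = insert {} \<C>"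
    using \<C>(1) by (intro range_from_nat_into) auto
  have "from_nat_into (insert {} \<C>) i \<in> \<A>" for i
    using \<C>(2) ran by (metis empty_sets insert_subset rangeI subsetD)
  then have B: "B n \<in> \<A>" for n unfolding B_def by (intro finite_UN) auto
  have un: "(\<Union>n. B n) = S"
  proof -
    have "(\<Union>n. B n) = \<Union>(range (from_nat_into (insert {} \<C>)))" unfolding B_def by blast
    then show ?thesis using ran \<C>(3) by simp
  qed
  have inc: "incseq B" unfolding B_def incseq_def by (intro allI impI UN_mono) auto
  show "lower_in (fa_prob K) \<Sigma>' (\<lambda>m. measure (\<mu> m) S)"
  proof (rule lower_in_SUP[OF \<Sigma>'])
    show "lower_in (fa_prob K) \<Sigma>' (\<lambda>m. measure (\<mu> m) (B n))" for n
      using tr B by (auto simp: transfers_def)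
    fix m c assume m: "m \<in> fa_prob K"
    interpret prob_space "\<mu> m" using m by (rule prob_space_mu)
    have lim: "(\<lambda>n. prob (B n)) \<longlonglongrightarrow> prob S"
      using finite_Lim_measure_incseq[OF _ inc] meas[OF B m] un by auto
    show "c < prob S \<longleftrightarrow> (\<exists>n. c < prob (B n))"
    proof
      assume "c < prob S"
      from order_tendstoD(1)[OF lim this] show "\<exists>n. c < prob (B n)"
        by (auto simp: eventually_sequentially)
    next
      assume "\<exists>n. c < prob (B n)"
      then obtain n where "c < prob (B n)" by blast
      also have "\<dots> \<le> prob S"
        using un meas[OF B m] by (intro finite_measure_mono) (auto simp flip: un)
      finally show "c < prob S" .
    qed
  qed
qed

lemma algebra_subspace:
  assumes A: "algebra (topspace T) \<A>" and "K \<in> \<A>"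
  shows "algebra K {A \<in> \<A>. A \<subseteq> K}"
proof -
  interpret algebra "topspace T" \<A> by (rule A)
  show ?thesis
    unfolding algebra_iff_Un using assms(2) by auto
qed

lemma Bos_subspace: "A \<in> Bos (subtopology T K) \<Longrightarrow> A \<in> Bos T"
proof (erule Bos_induct)
  interpret algebra "topspace T" "Bos T" by (rule algebra_Bos)
  have "topspace T - K \<in> Bos T" using closed_K by (intro Bos_openin) auto
  then have "topspace T - (topspace T - K) \<in> Bos T" by (rule compl_sets)
  then have K: "K \<in> Bos T" using K_subset by (simp add: double_diff)
  have "topspace (subtopology T K) = K" using K_subset by auto
  then show "algebra (topspace (subtopology T K)) {A. A \<subseteq> topspace (subtopology T K) \<and> A \<in> Bos T}"
    using algebra_subspace[OF algebra_Bos K] by (simp add: conj_commute)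
  fix U assume "openin (subtopology T K) U"
  then obtain G where "openin T G" "U = G \<inter> K" by (auto simp: openin_subtopology)
  then show "U \<in> Bos T" using K Bos_openin by auto
qed

text \<open>Closedness of \<open>K\<close> is used here: a set \<open>B\<close> not contained in
  \<open>K\<close> has the nonempty relatively open part \<open>B - K\<close>, which misses
  \<open>A\<close>.\<close>

lemma resolvable_subspace: "resolvable_in (subtopology T K) A \<Longrightarrow> resolvable_in T A"
proof -
  assume A: "resolvable_in (subtopology T K) A"
  then have AK: "A \<subseteq> K" by (auto simp: resolvable_in_def)
  show ?thesis
    unfolding resolvable_in_def
  proof (intro conjI allI impI)
    show "A \<subseteq> topspace T" using AK K_subset by blast
    fix B assume B: "B \<subseteq> topspace T \<and> B \<noteq> {}"
    show "\<exists>U. openin (subtopology T B) U \<and> U \<noteq> {} \<and> (U \<subseteq> A \<or> U \<inter> A = {})"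
    proof (cases "B \<subseteq> K")
      case True
      then have eq: "subtopology (subtopology T K) B = subtopology T B"
        by (simp add: subtopology_subtopology Int_absorb1)
      have "B \<subseteq> topspace (subtopology T K) \<and> B \<noteq> {}" using B True by simp
      then show ?thesis
        using A unfolding resolvable_in_def eq[symmetric] by blast
    next
      case False
      have "openin (subtopology T B) ((topspace T - K) \<inter> B)"
        using closed_K by (intro openin_subtopology_Int) auto
      moreover have "(topspace T - K) \<inter> B \<noteq> {}" using B False by blast
      moreover have "(topspace T - K) \<inter> B \<inter> A = {}" using AK by blast
      ultimately show ?thesis by blast
    qed
  qed
qed

lemma topspace_K: "topspace (subtopology T K) = K"
  using K_subset by auto

text \<open>The measure of a set in \<open>Bos T\<close> is the integral of an
  \<open>open_comb\<close>, that is, a signed combination of measures of open sets. Each of these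
  has open superlevel sets, and \<open>Sigma2 (Bos X)\<close> absorbs the signs.\<close>

lemma transfers_Bos: "transfers (Sigma2 (Bos (subtopology T K))) (Sigma2 (Bos X))"
proof (rule transfers_Sigma2)
  show "algebra K (Bos (subtopology T K))" using algebra_Bos[of "subtopology T K"] by (simp only: topspace_K)
  have alg: "algebra (fa_prob K) (Bos X)" using algebra_Bos[of X] by simp
  show SL: "sigma_lattice (fa_prob K) (Sigma2 (Bos X))" by (rule sigma_lattice_Sigma2[OF alg])
  have comb: "(\<forall>m\<in>fa_prob K. integrable (\<mu> m) f) \<and>
      lower_in (fa_prob K) (Sigma2 (Bos X)) (\<lambda>m. LINT x|\<mu> m. f x)" if "open_comb T f" for f
    using that
  proof induction
    case (single G c)
    have G: "G \<in> sets (\<mu> m)" if "m \<in> fa_prob K" for m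
      using regularization.open_sets[OF regularization[OF that] single] .
    have fin: "emeasure (\<mu> m) G < \<infinity>" if "m \<in> fa_prob K" for m
      using prob_space_mu[OF that] by (simp add: finite_measure.emeasure_finite prob_space_def less_top[symmetric])
    have low: "lower_in (fa_prob K) (Bos X) (\<lambda>m. measure (\<mu> m) G)"
      using measure_open_lsc[OF single] Bos_openin by (auto simp: lower_in_def)
    have "lower_in (fa_prob K) (Sigma2 (Bos X)) (\<lambda>m. c * measure (\<mu> m) G)"
    proof (cases "0 \<le> c")
      case True
      then show ?thesis using lower_in_Sigma2_algebra(1)[OF alg low] by (intro lower_in_cmult[OF SL])
    next
      case False
      then have "lower_in (fa_prob K) (Sigma2 (Bos X)) (\<lambda>m. - c * - measure (\<mu> m) G)"
        using lower_in_Sigma2_algebra(2)[OF alg low] by (intro lower_in_cmult[OF SL]) auto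
      then show ?thesis by simp
    qed
    then have "lower_in (fa_prob K) (Sigma2 (Bos X)) (\<lambda>m. LINT x|\<mu> m. c * indicator G x)"
      by (rule iffD2[OF lower_in_cong, rotated]) (use G in \<open>simp add: sets.Int_space_eq2\<close>)
    then show ?case using G fin by auto
  next
    case (add f g)
    have "lower_in (fa_prob K) (Sigma2 (Bos X)) (\<lambda>m. (LINT x|\<mu> m. f x) + (LINT x|\<mu> m. g x))"
      using add by (intro lower_in_add[OF SL]) auto
    then have "lower_in (fa_prob K) (Sigma2 (Bos X)) (\<lambda>m. LINT x|\<mu> m. f x + g x)"
      by (rule iffD2[OF lower_in_cong, rotated]) (use add in auto)
    then show ?case using add by auto
  qed
  show "transfers (Bos (subtopology T K)) (Sigma2 (Bos X))"
    unfolding transfers_def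
  proof (intro ballI conjI)
    fix A assume "A \<in> Bos (subtopology T K)"
    then have A: "A \<in> Bos T" by (rule Bos_subspace)
    show sets: "A \<in> sets (\<mu> m)" if "m \<in> fa_prob K" for m
    proof (rule Bos_induct[OF A])
      show "U \<in> sets (\<mu> m)" if "openin T U" for U
        using regularization.open_sets[OF regularization[OF \<open>m \<in> fa_prob K\<close>] that] .
      have "algebra (topspace T) (sets (\<mu> m))"
        using sets.algebra_axioms[of "\<mu> m"] space_mu[OF that] by simp
      moreover have "{A. A \<subseteq> topspace T \<and> A \<in> sets (\<mu> m)} = sets (\<mu> m)"
        using sets.sets_into_space[of _ "\<mu> m"] space_mu[OF that] by auto
      ultimately show "algebra (topspace T) {A. A \<subseteq> topspace T \<and> A \<in> sets (\<mu> m)}" by simp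
    qed
    have "lower_in (fa_prob K) (Sigma2 (Bos X)) (\<lambda>m. LINT x|\<mu> m. indicator A x)"
      using comb[OF open_comb_Bos[OF A]] by simp
    then show "lower_in (fa_prob K) (Sigma2 (Bos X)) (\<lambda>m. measure (\<mu> m) A)"
      by (rule iffD2[OF lower_in_cong, rotated]) (use sets in \<open>simp add: sets.Int_space_eq2\<close>)
  qed
qed

lemma transfers_Hs: "transfers (Sigma2 (Hs (subtopology T K))) (Sigma2 (Hs X))"
proof (rule transfers_Sigma2)
  show "algebra K (Hs (subtopology T K))" using algebra_Hs[of "subtopology T K"] by (simp only: topspace_K)
  show "sigma_lattice (fa_prob K) (Sigma2 (Hs X))" using sigma_lattice_Sigma2[OF algebra_Hs[of X]] by simp
  show "transfers (Hs (subtopology T K)) (Sigma2 (Hs X))"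
    unfolding transfers_def
  proof (intro ballI conjI)
    fix A assume "A \<in> Hs (subtopology T K)"
    then have A: "resolvable_in T A" by (auto simp: Hs_def intro: resolvable_subspace)
    show "A \<in> sets (\<mu> m)" if "m \<in> fa_prob K" for m
      using regularization.resolvable_sets[OF regularization[OF that] A] .
    show "lower_in (fa_prob K) (Sigma2 (Hs X)) (\<lambda>m. measure (\<mu> m) A)"
      unfolding lower_in_def using fragmented_superlevel[OF measure_resolvable_fragmented[OF A]] by simp
  qed
qed

end

section \<open>Transfer of function classes by integration\<close>

context regular_family
begin

text \<open>The layer sum \<open>L n\<close> overestimates the integral by at most
  \<open>1 / Suc n\<close>, so the integral is the supremum of \<open>L n - 1 / Suc n\<close>, and
  each of these is a nonnegative combination of measures of sets in \<open>\<Sigma>\<close> plus a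
  constant.\<close>

lemma real_integral_lower:
  assumes \<Sigma>': "sigma_lattice (fa_prob K) \<Sigma>'" and tr: "transfers \<Sigma> \<Sigma>'"
    and u: "\<And>t. {x \<in> K. t < u x} \<in> \<Sigma>" "\<And>x. x \<in> K \<Longrightarrow> 0 \<le> u x \<and> u x \<le> (1::real)"
    and int: "\<And>m. m \<in> fa_prob K \<Longrightarrow> integrable (\<mu> m) (\<lambda>x. indicator K x * u x)"
  shows "lower_in (fa_prob K) \<Sigma>' (\<lambda>m. LINT x|\<mu> m. indicator K x * u x)"
proof -
  define L where "L n m = (\<Sum>k<Suc n. (1 / Suc n) * measure (\<mu> m) {x \<in> K. k / Suc n < u x})" for n m
  have low: "lower_in (fa_prob K) \<Sigma>' (\<lambda>m. L n m + (- 1 / Suc n))" for n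
    unfolding L_def using tr u(1)
    by (intro lower_in_add[OF \<Sigma>'] lower_in_sum[OF \<Sigma>'] lower_in_cmult[OF \<Sigma>'] lower_in_const[OF \<Sigma>'])
      (auto simp: transfers_def)
  have bounds: "(LINT x|\<mu> m. indicator K x * u x) \<le> L n m \<and>
      L n m \<le> (LINT x|\<mu> m. indicator K x * u x) + 1 / Suc n" if m: "m \<in> fa_prob K" for n m
  proof -
    interpret prob_space "\<mu> m" using m by (rule prob_space_mu)
    \<comment> \<open>The thresholds are nonnegative, so points outside \<open>K\<close>, where the
      product vanishes, do not enter.\<close>
    have "{x \<in> space (\<mu> m). real k / real (Suc n) < indicator K x * u x} = {x \<in> K. real k / real (Suc n) < u x}" for k
    proof (intro set_eqI iffI)
      fix x assume x: "x \<in> {x \<in> space (\<mu> m). real k / real (Suc n) < indicator K x * u x}"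
      then have "x \<in> K" by (cases "x \<in> K") (auto simp: divide_less_0_iff)
      then show "x \<in> {x \<in> K. real k / real (Suc n) < u x}" using x by simp
    qed (use K_subset in \<open>auto simp: space_mu[OF m]\<close>)
    then show ?thesis
      unfolding L_def using layer_integral_bounds[of "\<lambda>x. indicator K x * u x" n] int[OF m] u(2)
      by (auto simp: indicator_def)
  qed
  show ?thesis
  proof (rule lower_in_SUP[OF \<Sigma>' low])
    fix m c assume m: "m \<in> fa_prob K"
    let ?I = "LINT x|\<mu> m. indicator K x * u x"
    show "c < ?I \<longleftrightarrow> (\<exists>n. c < L n m + (- 1 / Suc n))"
    proof
      assume "c < ?I"
      then obtain n where "1 / Suc n < ?I - c" using nat_approx_posE[of "?I - c"] by auto
      then have "c < L n m + (- 1 / Suc n)" using bounds[OF m, of n] by simp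
      then show "\<exists>n. c < L n m + (- 1 / Suc n)" by blast
    next
      assume "\<exists>n. c < L n m + (- 1 / Suc n)"
      then obtain n where "c < L n m + (- 1 / Suc n)" by blast
      then show "c < ?I" using bounds[OF m, of n] by simp
    qed
  qed
qed

lemma K_integrable:
  assumes m: "m \<in> fa_prob K" and meas: "(\<lambda>x. indicator K x *\<^sub>R h x) \<in> borel_measurable (\<mu> m)"
    and M: "\<And>x. x \<in> K \<Longrightarrow> norm (h x) \<le> M"
  shows "integrable (\<mu> m) (\<lambda>x. indicator K x *\<^sub>R (h x :: 'b::{banach,second_countable_topology}))"
proof -
  interpret prob_space "\<mu> m" using m by (rule prob_space_mu)
  have "norm (indicator K x *\<^sub>R h x) \<le> max 0 M" for x
    using M[of x] by (auto simp: indicator_def)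
  then show ?thesis using meas by (intro integrable_const_bound[where B = "max 0 M"]) auto
qed

lemma preimage_class_measurable:
  assumes tr: "transfers \<Sigma> \<Sigma>'" and h: "h \<in> preimage_class (subtopology T K) \<Sigma>" and m: "m \<in> fa_prob K"
  shows "(\<lambda>x. indicator K x *\<^sub>R h x) \<in> borel_measurable (\<mu> m)"
proof (rule borel_measurableI)
  fix S :: "complex set" assume "open S"
  then have "{x \<in> K. h x \<in> S} \<in> \<Sigma>" using h unfolding preimage_class_def topspace_K by blast
  then have *: "{x \<in> K. h x \<in> S} \<in> sets (\<mu> m)" using tr m by (auto simp: transfers_def)
  have "(\<lambda>x. indicator K x *\<^sub>R h x) -` S \<inter> space (\<mu> m) =
      {x \<in> K. h x \<in> S} \<union> (if 0 \<in> S then space (\<mu> m) - K else {})"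
    using K_subset by (auto simp: space_mu[OF m] indicator_def of_bool_def split: if_splits)
  then show "(\<lambda>x. indicator K x *\<^sub>R h x) -` S \<inter> space (\<mu> m) \<in> sets (\<mu> m)"
    using * K_sets[OF m] by auto
qed

text \<open>The affine map \<open>1 / 2 + p / (2 * N)\<close> brings the values into
  \<open>[0,1]\<close>, where the layer argument applies; it is undone afterwards because
  \<open>K\<close> has mass 1. With \<open>p\<close> equal to plus or minus \<open>Re\<close> and
  \<open>Im\<close> this yields all the half planes.\<close>

lemma functional_K_integral_lower:
  assumes \<Sigma>': "sigma_lattice (fa_prob K) \<Sigma>'" and tr: "transfers \<Sigma> \<Sigma>'"
    and h: "h \<in> preimage_class (subtopology T K) \<Sigma>" and M: "\<forall>x\<in>K. norm (h x) \<le> M"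
    and p: "bounded_linear p" "\<And>z. \<bar>p z\<bar> \<le> cmod z"
  shows "lower_in (fa_prob K) \<Sigma>' (\<lambda>m. p (K_integral h m))"
proof -
  define N where "N = max 1 M"
  have N: "0 < N" "\<And>x. x \<in> K \<Longrightarrow> norm (h x) \<le> N" using M by (auto simp: N_def le_max_iff_disj)
  define u where "u x = 1 / 2 + p (h x) / (2 * N)" for x
  have int: "integrable (\<mu> m) (\<lambda>x. indicator K x *\<^sub>R h x)" if "m \<in> fa_prob K" for m
    using K_integrable[OF that preimage_class_measurable[OF tr h that], of M] M by simp
  have intp: "integrable (\<mu> m) (\<lambda>x. indicator K x * p (h x))" if "m \<in> fa_prob K" for m
    using integrable_bounded_linear[OF p(1) int[OF that]] linear_cmul[OF bounded_linear.linear[OF p(1)]] by simp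
  have K1: "integrable (\<mu> m) (indicator K :: _ \<Rightarrow> real)" "(LINT x|\<mu> m. indicator K x) = (1::real)"
    if "m \<in> fa_prob K" for m
  proof -
    interpret prob_space "\<mu> m" using that by (rule prob_space_mu)
    show "integrable (\<mu> m) (indicator K :: _ \<Rightarrow> real)" "(LINT x|\<mu> m. indicator K x) = (1::real)"
      using K_sets[OF that] measure_K[OF that] by (auto simp: less_top[symmetric] sets.Int_space_eq2)
  qed
  have u_eq: "indicator K x * u x = (1 / 2) * indicator K x + (1 / (2 * N)) * (indicator K x * p (h x))" for x
    by (simp add: u_def indicator_def)
  have Iu: "(LINT x|\<mu> m. indicator K x * u x) = 1 / 2 + (1 / (2 * N)) * p (K_integral h m)"
    and intu: "integrable (\<mu> m) (\<lambda>x. indicator K x * u x)" if "m \<in> fa_prob K" for m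
  proof -
    have "p (K_integral h m) = (LINT x|\<mu> m. p (indicator K x *\<^sub>R h x))"
      unfolding K_integral_def using integral_bounded_linear[OF p(1) int[OF that]] by simp
    then have "p (K_integral h m) = (LINT x|\<mu> m. indicator K x * p (h x))"
      using linear_cmul[OF bounded_linear.linear[OF p(1)]] by simp
    then show "(LINT x|\<mu> m. indicator K x * u x) = 1 / 2 + (1 / (2 * N)) * p (K_integral h m)"
      unfolding u_eq using K1[OF that] intp[OF that] by simp
    show "integrable (\<mu> m) (\<lambda>x. indicator K x * u x)"
      unfolding u_eq using K1[OF that] intp[OF that] by simp
  qed
  have "lower_in (fa_prob K) \<Sigma>' (\<lambda>m. LINT x|\<mu> m. indicator K x * u x)"
  proof (rule real_integral_lower[OF \<Sigma>' tr _ _ intu])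
    fix t
    have "continuous_on UNIV (\<lambda>z. 1 / 2 + p z / (2 * N))"
      using N(1) by (intro continuous_intros linear_continuous_on p(1)) auto
    then have "open {z. t < 1 / 2 + p z / (2 * N)}" by (intro open_Collect_less continuous_on_const)
    then have "{x \<in> K. h x \<in> {z. t < 1 / 2 + p z / (2 * N)}} \<in> \<Sigma>"
      using h unfolding preimage_class_def topspace_K by blast
    then show "{x \<in> K. t < u x} \<in> \<Sigma>" by (simp add: u_def)
  next
    fix x assume "x \<in> K"
    then have "\<bar>p (h x)\<bar> \<le> N" using N(2) p(2) order_trans by blast
    then have "- N \<le> p (h x)" "p (h x) \<le> N" by auto
    then show "0 \<le> u x \<and> u x \<le> 1" using N(1) by (auto simp: u_def field_simps)
  qed
  then have "lower_in (fa_prob K) \<Sigma>' (\<lambda>m. 1 / 2 + (1 / (2 * N)) * p (K_integral h m))"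
    by (rule iffD1[OF lower_in_cong, rotated]) (simp add: Iu)
  then have "lower_in (fa_prob K) \<Sigma>' (\<lambda>m. (2 * N) * (- 1 / 2 + (1 / 2 + (1 / (2 * N)) * p (K_integral h m))))"
    using N(1) by (intro lower_in_cmult[OF \<Sigma>' lower_in_add[OF \<Sigma>' lower_in_const[OF \<Sigma>']]]) auto
  moreover have "(2 * N) * (- 1 / 2 + (1 / 2 + (1 / (2 * N)) * a)) = a" for a
    using N(1) by (simp add: field_simps)
  ultimately show ?thesis by (simp only:)
qed

lemma K_integral_preimage_class:
  assumes \<Sigma>': "sigma_lattice (fa_prob K) \<Sigma>'" and tr: "transfers \<Sigma> \<Sigma>'"
    and h: "h \<in> preimage_class (subtopology T K) \<Sigma>" and M: "\<forall>x\<in>K. norm (h x) \<le> M"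
  shows "K_integral h \<in> preimage_class X \<Sigma>'"
proof -
  note low = functional_K_integral_lower[OF \<Sigma>' tr h M]
  have *: "bounded_linear (\<lambda>z. - Re z)" "bounded_linear (\<lambda>z. - Im z)"
    by (intro bounded_linear_minus bounded_linear_Re bounded_linear_Im)+
  have "lower_in (fa_prob K) \<Sigma>' (\<lambda>m. Re (K_integral h m))" "lower_in (fa_prob K) \<Sigma>' (\<lambda>m. Im (K_integral h m))"
    "lower_in (fa_prob K) \<Sigma>' (\<lambda>m. - Re (K_integral h m))" "lower_in (fa_prob K) \<Sigma>' (\<lambda>m. - Im (K_integral h m))"
    using low[OF bounded_linear_Re] low[OF bounded_linear_Im] low[OF *(1)] low[OF *(2)]
    by (simp_all add: abs_Re_le_cmod abs_Im_le_cmod)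
  note L = this[THEN lower_inD]
  show ?thesis
  proof (rule preimage_class_boxI)
    show "{m \<in> topspace X. Re (K_integral h m) < c} \<in> \<Sigma>'" for c using L(3)[of "- c"] by simp
    show "{m \<in> topspace X. Im (K_integral h m) < c} \<in> \<Sigma>'" for c using L(4)[of "- c"] by simp
  qed (use \<Sigma>' L in simp_all)
qed

text \<open>After truncation all functions share the bound \<open>N\<close>. The invariant
  \<open>Q\<close> keeps that bound and measurability along the hierarchy, and dominated convergence
  makes \<open>K_integral\<close> commute with the limits.\<close>

lemma K_integral_limit_hierarchy:
  assumes \<Sigma>': "sigma_lattice (fa_prob K) \<Sigma>'" and tr: "transfers \<Sigma> \<Sigma>'"
    and \<alpha>: "\<gamma> \<le> \<alpha>" and h: "h \<in> limit_hierarchy K \<gamma> (preimage_class (subtopology T K) \<Sigma>) \<alpha>"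
    and M: "\<And>x. x \<in> K \<Longrightarrow> norm (h x) \<le> M"
  shows "K_integral h \<in> limit_hierarchy (fa_prob K) \<gamma> (preimage_class X \<Sigma>') \<alpha>"
proof -
  define N where "N = max 0 M"
  have N: "0 \<le> N" "\<And>x. x \<in> K \<Longrightarrow> norm (h x) \<le> N" using M by (auto simp: N_def le_max_iff_disj)
  let ?B = "{h \<in> preimage_class (subtopology T K) \<Sigma>. \<forall>x\<in>K. norm (h x) \<le> N}"
  have h': "h \<in> limit_hierarchy K \<gamma> ?B \<alpha>"
    using limit_hierarchy_preimage_class_truncate[of \<gamma> \<alpha> h "subtopology T K" \<Sigma> N] \<alpha> h N
    unfolding topspace_K by blast
  define Q where "Q h \<longleftrightarrow> (\<forall>x\<in>K. norm (h x) \<le> N) \<and>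
    (\<forall>m\<in>fa_prob K. (\<lambda>x. indicator K x *\<^sub>R h x) \<in> borel_measurable (\<mu> m))" for h :: "'a \<Rightarrow> complex"
  have "Q h \<and> K_integral h \<in> limit_hierarchy (fa_prob K) \<gamma> (preimage_class X \<Sigma>') \<alpha>"
    using \<alpha> h'
  proof (rule limit_hierarchy_transport)
    show "Q h \<and> K_integral h \<in> preimage_class X \<Sigma>'" if "h \<in> ?B" for h
      using that K_integral_preimage_class[OF \<Sigma>' tr] preimage_class_measurable[OF tr]
      by (auto simp: Q_def)
  next
    fix h :: "nat \<Rightarrow> 'a \<Rightarrow> complex" and g
    assume Q: "\<And>n. Q (h n)" and lim: "\<And>x. x \<in> K \<Longrightarrow> (\<lambda>n. h n x) \<longlonglongrightarrow> g x"
    have lim': "(\<lambda>n. indicator K x *\<^sub>R h n x) \<longlonglongrightarrow> indicator K x *\<^sub>R g x" for x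
      using lim[of x] by (cases "x \<in> K") auto
    have meas_h: "(\<lambda>x. indicator K x *\<^sub>R h n x) \<in> borel_measurable (\<mu> m)" if "m \<in> fa_prob K" for n m
      using Q[of n] that by (simp add: Q_def)
    have meas: "(\<lambda>x. indicator K x *\<^sub>R g x) \<in> borel_measurable (\<mu> m)" if m: "m \<in> fa_prob K" for m
      using meas_h[OF m] lim' by (rule borel_measurable_LIMSEQ_metric)
    have "norm (g x) \<le> N" if "x \<in> K" for x
      using Q that by (intro LIMSEQ_le_const2[OF tendsto_norm[OF lim[OF that]]]) (simp add: Q_def)
    moreover have "(\<lambda>n. K_integral (h n) m) \<longlonglongrightarrow> K_integral g m" if m: "m \<in> fa_prob K" for m
      unfolding K_integral_def
    proof (rule integral_dominated_convergence[where w = "\<lambda>_. N"])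
      interpret prob_space "\<mu> m" using m by (rule prob_space_mu)
      show "integrable (\<mu> m) (\<lambda>_. N)" by simp
      show "AE x in \<mu> m. norm (indicator K x *\<^sub>R h n x) \<le> N" for n
        using Q[of n] N(1) by (auto simp: Q_def indicator_def)
    qed (use meas[OF m] meas_h[OF m] lim' in simp_all)
    ultimately show "Q g \<and> (\<forall>m\<in>fa_prob K. (\<lambda>n. K_integral (h n) m) \<longlonglongrightarrow> K_integral g m)"
      using meas by (auto simp: Q_def)
  qed
  then show ?thesis by blast
qed

end

section \<open>A variational replacement for separation\<close>

text \<open>A minimiser of \<open>\<Sum>j. (h j x - a j)\<^sup>2\<close> must have value zero: otherwise moving towards a point
  satisfying the linear inequality with coefficients \<open>h j x - a j\<close> decreases the sum.\<close>

lemma convexlike_finite_solution: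
  fixes h :: "'j \<Rightarrow> 'a \<Rightarrow> real"
  assumes X: "compact_space X" "topspace X \<noteq> {}" and J: "finite J"
    and h: "\<And>j. j \<in> J \<Longrightarrow> continuous_map X euclideanreal (h j)"
    and conv: "\<And>x y t. x \<in> topspace X \<Longrightarrow> y \<in> topspace X \<Longrightarrow> 0 < t \<Longrightarrow> t \<le> 1 \<Longrightarrow>
      \<exists>z\<in>topspace X. \<forall>j\<in>J. h j z = (1 - t) * h j x + t * h j y"
    and le: "\<And>c. \<exists>y\<in>topspace X. (\<Sum>j\<in>J. c j * h j y) \<le> (\<Sum>j\<in>J. c j * a j)"
  shows "\<exists>x\<in>topspace X. \<forall>j\<in>J. h j x = a j"
proof -
  define D where "D x = (\<Sum>j\<in>J. (h j x - a j)\<^sup>2)" for x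
  have "continuous_map X euclideanreal D"
    unfolding D_def using h J by (intro continuous_map_sum continuous_map_real_pow continuous_map_diff) auto
  then have "compact (D ` topspace X)"
    using X(1) image_compactin[of X "topspace X" euclideanreal D] by (simp add: compact_space_def)
  then obtain x0 where x0: "x0 \<in> topspace X" "\<And>x. x \<in> topspace X \<Longrightarrow> D x0 \<le> D x"
    using compact_attains_inf[of "D ` topspace X"] X(2) by auto
  define c where "c j = h j x0 - a j" for j
  obtain y where y: "y \<in> topspace X" "(\<Sum>j\<in>J. c j * h j y) \<le> (\<Sum>j\<in>J. c j * a j)" using le by blast
  define d where "d j = h j y - h j x0" for j
  have D0: "D x0 = (\<Sum>j\<in>J. c j * c j)" by (simp add: D_def c_def power2_eq_square)
  \<comment> \<open>Testing the assumed inequality with the residual \<open>c\<close> shows that the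
    direction \<open>d\<close> has inner product at most \<open>- D x0\<close> with it.\<close>
  have "(\<Sum>j\<in>J. c j * d j) + D x0 = (\<Sum>j\<in>J. c j * h j y) - (\<Sum>j\<in>J. c j * a j)"
    unfolding D0 by (simp add: c_def d_def algebra_simps flip: sum.distrib sum_subtractf)
  then have cd: "(\<Sum>j\<in>J. c j * d j) \<le> - D x0" using y(2) by simp
  define S where "S = (\<Sum>j\<in>J. d j * d j)"
  have S: "0 \<le> S" unfolding S_def by (intro sum_nonneg) simp
  have D0nn: "0 \<le> D x0" unfolding D_def by (intro sum_nonneg) simp
  have key: "2 * D x0 \<le> t * S" if t: "0 < t" "t \<le> 1" for t
  proof -
    obtain z where z: "z \<in> topspace X" "\<And>j. j \<in> J \<Longrightarrow> h j z = (1 - t) * h j x0 + t * h j y"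
      using conv[OF x0(1) y(1) t] by blast
    have "D z = (\<Sum>j\<in>J. (c j + t * d j)\<^sup>2)"
      unfolding D_def by (intro sum.cong refl) (simp add: z(2) c_def d_def algebra_simps)
    also have "\<dots> = (\<Sum>j\<in>J. c j * c j) + 2 * t * (\<Sum>j\<in>J. c j * d j) + t\<^sup>2 * S"
      by (simp add: S_def power2_eq_square algebra_simps sum.distrib sum_distrib_left)
    finally have "D x0 \<le> D x0 + 2 * t * (\<Sum>j\<in>J. c j * d j) + t\<^sup>2 * S"
      using x0(2)[OF z(1)] D0 by simp
    moreover have "2 * t * (\<Sum>j\<in>J. c j * d j) \<le> 2 * t * (- D x0)" using cd t by (intro mult_left_mono) auto
    ultimately have "t * (2 * D x0) \<le> t * (t * S)" by (simp add: power2_eq_square mult_ac)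
    then show ?thesis using t by simp
  qed
  have "D x0 = 0"
  proof (rule ccontr)
    assume "D x0 \<noteq> 0"
    then have pos: "0 < D x0" using D0nn by simp
    \<comment> \<open>Small enough that \<open>t * S \<le> D x0\<close>, which contradicts
      \<open>key\<close> when \<open>D x0 > 0\<close>; the denominator is \<open>S + 1\<close>
      because \<open>S\<close> may vanish.\<close>
    define t where "t = min 1 (D x0 / (S + 1))"
    have t: "0 < t" "t \<le> 1" using pos S by (auto simp: t_def)
    have "t * S \<le> D x0 / (S + 1) * S" using S by (intro mult_right_mono) (auto simp: t_def)
    also have "\<dots> \<le> D x0 / (S + 1) * (S + 1)" using S pos by (intro mult_left_mono) auto
    also have "\<dots> = D x0" using S by simp
    finally show False using key[OF t] pos by simp
  qed
  then have "\<forall>j\<in>J. (h j x0 - a j)\<^sup>2 = 0" unfolding D_def using J by (subst (asm) sum_nonneg_eq_0_iff) auto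
  then show ?thesis using x0(1) by auto
qed

text \<open>The solution sets of finite subsystems are nonempty by the finite case, and compactness
  intersects them. It is applied both to the existence of barycenters and to the surjectivity of the
  resultant map.\<close>

lemma convexlike_solution:
  fixes h :: "'j \<Rightarrow> 'a \<Rightarrow> real"
  assumes X: "compact_space X" "topspace X \<noteq> {}"
    and h: "\<And>j. j \<in> J \<Longrightarrow> continuous_map X euclideanreal (h j)"
    and conv: "\<And>x y t. x \<in> topspace X \<Longrightarrow> y \<in> topspace X \<Longrightarrow> 0 < t \<Longrightarrow> t \<le> 1 \<Longrightarrow>
      \<exists>z\<in>topspace X. \<forall>j\<in>J. h j z = (1 - t) * h j x + t * h j y"
    and le: "\<And>I c. finite I \<Longrightarrow> I \<subseteq> J \<Longrightarrow> \<exists>y\<in>topspace X. (\<Sum>j\<in>I. c j * h j y) \<le> (\<Sum>j\<in>I. c j * a j)"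
  shows "\<exists>x\<in>topspace X. \<forall>j\<in>J. h j x = a j"
proof -
  let ?C = "\<lambda>j. {x \<in> topspace X. h j x \<in> {a j}}"
  have "topspace X \<inter> \<Inter>(?C ` J) \<noteq> {}"
  proof (rule conjunct2[OF compactin_fip[THEN iffD1], rule_format])
    show "compactin X (topspace X)" using X(1) by (simp add: compact_space_def)
    show "(\<forall>C\<in>?C ` J. closedin X C) \<and> (\<forall>\<F>. finite \<F> \<and> \<F> \<subseteq> ?C ` J \<longrightarrow> topspace X \<inter> \<Inter>\<F> \<noteq> {})"
    proof (intro conjI ballI allI impI)
      fix C assume "C \<in> ?C ` J"
      then show "closedin X C" using closedin_continuous_map_preimage[OF h] by fastforce
    next
      fix \<F> assume "finite \<F> \<and> \<F> \<subseteq> ?C ` J"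
      then obtain I where I: "finite I" "I \<subseteq> J" "\<F> = ?C ` I" by (meson finite_subset_image)
      have "\<exists>x\<in>topspace X. \<forall>j\<in>I. h j x = a j"
      proof (rule convexlike_finite_solution[OF X I(1)])
        show "continuous_map X euclideanreal (h j)" if "j \<in> I" for j using h I that by blast
        show "\<exists>z\<in>topspace X. \<forall>j\<in>I. h j z = (1 - t) * h j x + t * h j y"
          if "x \<in> topspace X" "y \<in> topspace X" "0 < t" "t \<le> 1" for x y t
          using conv[OF that] I(2) by blast
        show "\<exists>y\<in>topspace X. (\<Sum>j\<in>I. c j * h j y) \<le> (\<Sum>j\<in>I. c j * a j)" for c
          using le[OF I(1,2)] .
      qed
      then show "topspace X \<inter> \<Inter>\<F> \<noteq> {}" using I(3) by auto
    qed
  qed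
  then show ?thesis by auto
qed

section \<open>The dual ball\<close>

lemma Hausdorff_strong_operator_topology:
  "Hausdorff_space (strong_operator_topology :: ('a::real_normed_vector \<Rightarrow>\<^sub>L 'b::real_normed_vector) topology)"
  unfolding Hausdorff_space_def
proof (intro allI impI, elim conjE)
  fix \<phi> \<psi> :: "'a \<Rightarrow>\<^sub>L 'b" assume "\<phi> \<noteq> \<psi>"
  then obtain x where "blinfun_apply \<phi> x \<noteq> blinfun_apply \<psi> x" using blinfun_eqI by blast
  then obtain U V where UV: "open U" "open V" "blinfun_apply \<phi> x \<in> U" "blinfun_apply \<psi> x \<in> V" "U \<inter> V = {}"
    using separation_t2[THEN iffD1] by metis
  let ?p = "\<lambda>U. {\<phi> \<in> topspace strong_operator_topology. blinfun_apply \<phi> x \<in> U}"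
  have "openin strong_operator_topology (?p U)" "openin strong_operator_topology (?p V)"
    using UV strong_operator_topology_continuous_evaluation[of x]
    by (auto intro: openin_continuous_map_preimage)
  then show "\<exists>U V. openin strong_operator_topology U \<and> openin strong_operator_topology V \<and> \<phi> \<in> U \<and> \<psi> \<in> V \<and> disjnt U V"
    using UV by (intro exI[of _ "?p U"] exI[of _ "?p V"]) (auto simp: disjnt_def strong_operator_topology_topspace)
qed

context scalar_banach_space
begin

abbreviation "T \<equiv> ball_top K smul"

lemma of_real_scalar: "of_real r \<in> K"
  using scalars by auto

lemma scalar_closed: "closed K"
  using scalars closed_complex_Reals by auto

lemma ball_top_eq: "T = subtopology strong_operator_topology (dual_ball K smul)"
proof -
  have "dual_space K smul \<inter> dual_ball K smul = dual_ball K smul" by (auto simp: dual_ball_def)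
  then show ?thesis by (simp add: ball_top_def weak_star_def subtopology_subtopology)
qed

lemma topspace_ball: "topspace T = dual_ball K smul"
  by (simp add: ball_top_eq strong_operator_topology_topspace)

lemma dual_ball_iff:
  "\<phi> \<in> dual_ball K smul \<longleftrightarrow> (\<forall>x. \<phi> x \<in> K) \<and> (\<forall>c\<in>K. \<forall>x. \<phi> (smul c x) = c * \<phi> x) \<and> norm \<phi> \<le> 1"
  by (auto simp: dual_ball_def dual_space_def)

lemma continuous_eval: "continuous_map T euclidean (\<lambda>\<phi>. blinfun_apply \<phi> x)"
  unfolding ball_top_eq
  by (intro continuous_map_from_subtopology strong_operator_topology_continuous_evaluation)

lemma continuous_map_into_ball:
  assumes "f ` topspace X \<subseteq> dual_ball K smul" "\<And>x. continuous_map X euclidean (\<lambda>y. blinfun_apply (f y) x)"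
  shows "continuous_map X T f"
  unfolding ball_top_eq
  using assms by (auto simp: continuous_map_in_subtopology continuous_on_strong_operator_topo_iff_coordinatewise)

lemma Hausdorff_ball: "Hausdorff_space T"
  unfolding ball_top_eq by (intro Hausdorff_space_subtopology Hausdorff_strong_operator_topology)

text \<open>Banach-Alaoglu. The linear functions in the product of the discs
  \<open>cball 0 (norm x)\<close> form a compact set, carried onto the ball by
  \<open>Blinfun\<close>, which is continuous there because evaluating \<open>Blinfun g\<close> at
  \<open>x\<close> returns \<open>g x\<close>.\<close>

lemma compact_ball: "compact_space T"
proof -
  let ?P = "PiE UNIV (\<lambda>x::'e. cball 0 (norm x)) :: ('e \<Rightarrow> complex) set"
  let ?lin = "(\<Inter>x. \<Inter>y. {g. g (x + y) = g x + g y}) \<inter> (\<Inter>c\<in>K. \<Inter>x. {g. g (smul c x) = c * g x}) \<inter>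
      (\<Inter>x. {g. g x \<in> K}) :: ('e \<Rightarrow> complex) set"
  have "compactin (product_topology (\<lambda>_::'e. euclidean :: complex topology) UNIV) ?P"
    by (subst compactin_PiE) auto
  then have "compact ?P" by (simp add: euclidean_product_topology)
  moreover have ev: "continuous_on UNIV (\<lambda>g::'e \<Rightarrow> complex. g x)" for x
    by (rule continuous_on_product_coordinates)
  have "closed {g::'e \<Rightarrow> complex. g x \<in> K}" for x
    using closed_vimage[OF scalar_closed ev[of x]] by (simp add: vimage_def)
  then have "closed ?lin"
    by (intro closed_Int closed_INT ballI closed_Collect_eq continuous_intros ev)
  ultimately have W: "compact (?P \<inter> ?lin)" by (rule compact_Int_closed)
  have bl: "bounded_linear g" if "g \<in> ?P \<inter> ?lin" for g
  proof (rule bounded_linear_intro)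
    show "g (x + y) = g x + g y" for x y using that by auto
    show "g (r *\<^sub>R x) = r *\<^sub>R g x" for r x
    proof -
      have "g (smul (of_real r) x) = of_real r * g x" using that of_real_scalar[of r] by auto
      then show ?thesis by (simp add: smul_of_real scaleR_conv_of_real)
    qed
    show "norm (g x) \<le> norm x * 1" for x using that by (auto simp: PiE_UNIV_domain)
  qed
  have app: "blinfun_apply (Blinfun g) = g" if "g \<in> ?P \<inter> ?lin" for g
    using bl[OF that] by (rule bounded_linear_Blinfun_apply)
  have "continuous_map (top_of_set (?P \<inter> ?lin)) strong_operator_topology Blinfun"
    unfolding continuous_on_strong_operator_topo_iff_coordinatewise
  proof
    fix x
    have "continuous_map (top_of_set (?P \<inter> ?lin)) euclidean (\<lambda>g. g x)"
      using continuous_on_subset[OF ev] by auto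
    then show "continuous_map (top_of_set (?P \<inter> ?lin)) euclidean (\<lambda>g. blinfun_apply (Blinfun g) x)"
      by (rule continuous_map_eq) (use app in simp)
  qed
  moreover have "compactin (top_of_set (?P \<inter> ?lin)) (?P \<inter> ?lin)"
    using W by (simp add: compactin_subtopology)
  ultimately have "compactin strong_operator_topology (Blinfun ` (?P \<inter> ?lin))"
    by (rule image_compactin[rotated])
  moreover have "Blinfun ` (?P \<inter> ?lin) = dual_ball K smul"
  proof
    show "Blinfun ` (?P \<inter> ?lin) \<subseteq> dual_ball K smul"
    proof
      fix \<phi> assume "\<phi> \<in> Blinfun ` (?P \<inter> ?lin)"
      then obtain g where "\<phi> = Blinfun g" "g \<in> ?P \<inter> ?lin" by (rule imageE)
      note g = this(2,1)
      have "norm \<phi> \<le> 1" using g app[OF g(1)] by (intro norm_blinfun_bound) (auto simp: PiE_UNIV_domain)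
      then show "\<phi> \<in> dual_ball K smul" using g app[OF g(1)] by (auto simp: dual_ball_iff)
    qed
    show "dual_ball K smul \<subseteq> Blinfun ` (?P \<inter> ?lin)"
    proof
      fix \<phi> assume \<phi>: "\<phi> \<in> dual_ball K smul"
      have "norm (\<phi> x) \<le> norm x" for x
        using norm_blinfun[of \<phi> x] \<phi> mult_right_mono[of "norm \<phi>" 1 "norm x"] by (auto simp: dual_ball_iff)
      then have "blinfun_apply \<phi> \<in> ?P \<inter> ?lin"
        using \<phi> by (auto simp: dual_ball_iff PiE_UNIV_domain blinfun.add_right)
      moreover have "\<phi> = Blinfun (blinfun_apply \<phi>)" by (simp add: blinfun_apply_inverse)
      ultimately show "\<phi> \<in> Blinfun ` (?P \<inter> ?lin)" by (intro image_eqI)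
    qed
  qed
  ultimately show ?thesis by (simp add: ball_top_eq compact_space_subtopology)
qed

lemma convex_ball:
  assumes "\<phi> \<in> dual_ball K smul" "\<psi> \<in> dual_ball K smul" "0 \<le> t" "t \<le> 1"
  shows "(1 - t) *\<^sub>R \<phi> + t *\<^sub>R \<psi> \<in> dual_ball K smul"
proof -
  have "(1 - t) *\<^sub>R a + t *\<^sub>R b \<in> K" if "a \<in> K" "b \<in> K" for a b
    using scalars that by (auto simp: Reals_add scaleR_conv_of_real)
  moreover have "norm ((1 - t) *\<^sub>R \<phi> + t *\<^sub>R \<psi>) \<le> 1"
  proof -
    have "norm ((1 - t) *\<^sub>R \<phi> + t *\<^sub>R \<psi>) \<le> (1 - t) * norm \<phi> + t * norm \<psi>"
      using norm_triangle_ineq[of "(1 - t) *\<^sub>R \<phi>" "t *\<^sub>R \<psi>"] assms by simp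
    also have "\<dots> \<le> (1 - t) * 1 + t * 1"
      using assms by (intro add_mono mult_left_mono) (auto simp: dual_ball_iff)
    finally show ?thesis by simp
  qed
  moreover have "((1 - t) *\<^sub>R \<phi> + t *\<^sub>R \<psi>) x = (1 - t) *\<^sub>R \<phi> x + t *\<^sub>R \<psi> x" for x
    by (simp add: blinfun.add_left blinfun.scaleR_left)
  moreover have "(1 - t) *\<^sub>R (c * a) + t *\<^sub>R (c * b) = c * ((1 - t) *\<^sub>R a + t *\<^sub>R b)" for a b c :: complex
    by (simp add: distrib_left)
  ultimately show ?thesis
    using assms(1,2) unfolding dual_ball_iff by simp
qed

lemma zero_in_ball: "0 \<in> dual_ball K smul"
  using scalars by (auto simp: dual_ball_iff)

text \<open>Over the reals the values are real; over the complex numbers the imaginary part at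
  \<open>x\<close> is minus the real part at \<open>\<i> x\<close>. Hence real-valued arguments
  suffice below.\<close>

lemma dual_ball_eqI:
  assumes "\<phi> \<in> dual_ball K smul" "\<psi> \<in> dual_ball K smul"
    and Re: "\<And>x. Re (blinfun_apply \<phi> x) = Re (blinfun_apply \<psi> x)"
  shows "\<phi> = \<psi>"
proof (rule blinfun_eqI)
  fix x
  have "Im (blinfun_apply \<phi> x) = Im (blinfun_apply \<psi> x)"
  proof (cases "K = \<real>")
    case True
    then have "blinfun_apply \<phi> x \<in> \<real>" "blinfun_apply \<psi> x \<in> \<real>" using assms(1,2) unfolding dual_ball_iff by blast+
    then show ?thesis by (simp add: complex_is_Real_iff)
  next
    case False
    then have "\<i> \<in> K" using scalars by auto
    then have "blinfun_apply \<phi> (smul \<i> x) = \<i> * blinfun_apply \<phi> x" "blinfun_apply \<psi> (smul \<i> x) = \<i> * blinfun_apply \<psi> x"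
      using assms(1,2) unfolding dual_ball_iff by blast+
    then show ?thesis using Re[of "smul \<i> x"] by simp
  qed
  then show "blinfun_apply \<phi> x = blinfun_apply \<psi> x" using Re by (intro complex_eqI)
qed

text \<open>Bauer's minimum principle: a minimal closed extreme subset of the set of minimisers is a singleton.\<close>

lemma extreme_minimum:
  assumes \<phi>: "\<phi> \<in> dual_ball K smul"
  shows "\<exists>\<psi>. \<psi> extreme_point_of dual_ball K smul \<and> Re (blinfun_apply \<psi> e) \<le> Re (blinfun_apply \<phi> e)"
proof -
  let ?B = "dual_ball K smul"
  define face where "face F \<longleftrightarrow> F \<subseteq> ?B \<and> (\<forall>a\<in>?B. \<forall>b\<in>?B. \<forall>t. 0 < t \<and> t < 1 \<and> (1 - t) *\<^sub>R a + t *\<^sub>R b \<in> F \<longrightarrow>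
      a \<in> F \<and> b \<in> F)" for F
  have cRe: "continuous_map T euclideanreal (\<lambda>\<psi>. Re (blinfun_apply \<psi> x))" for x
    using continuous_map_compose[OF continuous_eval[of x], of euclidean Re]
    by (simp add: comp_def continuous_on_Re)
  \<comment> \<open>Minimisers of a real linear functional on an extreme set form an extreme set: a
    proper convex combination of two values not below the minimum equals it only if both do.\<close>
  have min_face: "\<exists>F'. closedin T F' \<and> F' \<noteq> {} \<and> face F' \<and> F' \<subseteq> F \<and>
      (\<forall>a\<in>F'. \<forall>b\<in>F. Re (blinfun_apply a x) \<le> Re (blinfun_apply b x))"
    if F: "closedin T F" "F \<noteq> {}" "face F" for F x
  proof -
    have "compactin T F" using F(1) compact_ball closedin_compact_space by blast
    then have "compactin euclideanreal ((\<lambda>\<psi>. Re (blinfun_apply \<psi> x)) ` F)" using cRe by (rule image_compactin)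
    then obtain a where a: "a \<in> F" "\<And>b. b \<in> F \<Longrightarrow> Re (blinfun_apply a x) \<le> Re (blinfun_apply b x)"
      using compact_attains_inf[of "(\<lambda>\<psi>. Re (blinfun_apply \<psi> x)) ` F"] F(2) by auto
    let ?r = "Re (blinfun_apply a x)"
    let ?F = "F \<inter> {\<psi> \<in> topspace T. Re (blinfun_apply \<psi> x) \<in> {?r}}"
    have "closedin T ?F"
      using F(1) cRe by (intro closedin_Int closedin_continuous_map_preimage[of T euclideanreal]) auto
    moreover have "a \<in> ?F" using a(1) closedin_subset[OF F(1)] by auto
    moreover have "face ?F"
      unfolding face_def
    proof (intro conjI ballI allI impI; (elim conjE)?)
      show "?F \<subseteq> ?B" by (auto simp: topspace_ball)
      fix b c t assume bc: "b \<in> ?B" "c \<in> ?B" and t: "0 < t" "t < (1::real)" and in_F: "(1 - t) *\<^sub>R b + t *\<^sub>R c \<in> ?F"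
      then have bcF: "b \<in> F" "c \<in> F" using F(3) unfolding face_def by blast+
      have eq: "(1 - t) * Re (blinfun_apply b x) + t * Re (blinfun_apply c x) = ?r"
        using in_F by (simp add: blinfun.add_left blinfun.scaleR_left)
      have ge: "?r \<le> Re (blinfun_apply b x)" "?r \<le> Re (blinfun_apply c x)" using a(2) bcF by auto
      have "Re (blinfun_apply b x) = ?r \<and> Re (blinfun_apply c x) = ?r"
      proof -
        have "(1 - t) * (Re (blinfun_apply b x) - ?r) + t * (Re (blinfun_apply c x) - ?r) = 0"
          using eq by (simp add: algebra_simps)
        moreover have "0 \<le> (1 - t) * (Re (blinfun_apply b x) - ?r)" "0 \<le> t * (Re (blinfun_apply c x) - ?r)"
          using ge t by auto
        ultimately have "(1 - t) * (Re (blinfun_apply b x) - ?r) = 0" "t * (Re (blinfun_apply c x) - ?r) = 0"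
          by linarith+
        then show ?thesis using t by auto
      qed
      then show "b \<in> ?F" "c \<in> ?F" using bcF closedin_subset[OF F(1)] by auto
    qed
    ultimately show ?thesis using a(2) by (intro exI[of _ ?F]) auto
  qed
  have "closedin T ?B" using closedin_topspace[of T] by (simp add: topspace_ball)
  moreover have "face ?B" by (simp add: face_def)
  ultimately obtain F0 where F0: "closedin T F0" "F0 \<noteq> {}" "face F0"
      "\<forall>a\<in>F0. \<forall>b\<in>?B. Re (blinfun_apply a e) \<le> Re (blinfun_apply b e)"
    using min_face[of ?B e] \<phi> by blast
  \<comment> \<open>Zorn's lemma is applied to open sets whose removal leaves a nonempty face; a
    maximal one leaves a minimal closed face.\<close>
  define \<F> where "\<F> = {U. openin T U \<and> F0 - U \<noteq> {} \<and> face (F0 - U)}"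
  have F0T: "F0 \<subseteq> topspace T" using F0(1) by (rule closedin_subset)
  have "\<exists>M\<in>\<F>. \<forall>U\<in>\<F>. M \<subseteq> U \<longrightarrow> U = M"
  proof (rule subset_Zorn_nonempty)
    show "\<F> \<noteq> {}" using F0 by (auto simp: \<F>_def intro!: exI[of _ "{}"])
    fix \<C> assume \<C>: "\<C> \<noteq> {}" "subset.chain \<F> \<C>"
    then have C: "openin T U" "F0 - U \<noteq> {}" "face (F0 - U)" if "U \<in> \<C>" for U
      using that by (auto simp: subset_chain_def \<F>_def)
    have "F0 \<inter> \<Inter>((\<lambda>U. topspace T - U) ` \<C>) \<noteq> {}"
    proof (rule conjunct2[OF compactin_fip[THEN iffD1], rule_format])
      show "compactin T F0" using F0(1) compact_ball closedin_compact_space by blast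
      show "(\<forall>C\<in>(\<lambda>U. topspace T - U) ` \<C>. closedin T C) \<and>
          (\<forall>\<D>. finite \<D> \<and> \<D> \<subseteq> (\<lambda>U. topspace T - U) ` \<C> \<longrightarrow> F0 \<inter> \<Inter>\<D> \<noteq> {})"
      proof (intro conjI allI impI)
        show "\<forall>C\<in>(\<lambda>U. topspace T - U) ` \<C>. closedin T C" using C(1) by auto
        fix \<D> assume "finite \<D> \<and> \<D> \<subseteq> (\<lambda>U. topspace T - U) ` \<C>"
        then obtain \<E> where \<E>: "finite \<E>" "\<E> \<subseteq> \<C>" "\<D> = (\<lambda>U. topspace T - U) ` \<E>"
          by (meson finite_subset_image)
        show "F0 \<inter> \<Inter>\<D> \<noteq> {}"
        proof (cases "\<E> = {}")
          case False
          have "subset.chain \<F> \<E>" using \<C>(2) \<E>(2) unfolding subset_chain_def by (meson subset_iff subset_trans)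
          then have "\<Union>\<E> \<in> \<C>" using Union_in_chain[OF \<E>(1) False] \<E>(2) by blast
          then have "F0 - \<Union>\<E> \<noteq> {}" by (rule C(2))
          then show ?thesis unfolding \<E>(3) using F0T by blast
        qed (use \<E> F0 in auto)
      qed
    qed
    then have "F0 - \<Union>\<C> \<noteq> {}" by blast
    moreover have "face (F0 - \<Union>\<C>)"
      unfolding face_def
    proof (intro conjI ballI allI impI; (elim conjE)?)
      show "F0 - \<Union>\<C> \<subseteq> ?B" using F0T by (auto simp: topspace_ball)
      fix a b t assume ab: "a \<in> ?B" "b \<in> ?B" and t: "0 < t" "t < (1::real)"
        and in_F: "(1 - t) *\<^sub>R a + t *\<^sub>R b \<in> F0 - \<Union>\<C>"
      have "a \<in> F0 - U \<and> b \<in> F0 - U" if "U \<in> \<C>" for U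
        using C(3)[OF that] in_F that ab t unfolding face_def by blast
      then show "a \<in> F0 - \<Union>\<C>" "b \<in> F0 - \<Union>\<C>" using \<C>(1) by blast+
    qed
    ultimately show "\<Union>\<C> \<in> \<F>" unfolding \<F>_def using C(1) by blast
  qed
  then obtain M where M: "openin T M" "F0 - M \<noteq> {}" "face (F0 - M)"
    and max: "\<And>U. openin T U \<Longrightarrow> F0 - U \<noteq> {} \<Longrightarrow> face (F0 - U) \<Longrightarrow> M \<subseteq> U \<Longrightarrow> U = M"
    by (auto simp: \<F>_def)
  let ?F = "F0 - M"
  have F: "closedin T ?F" using F0(1) M(1) by (rule closedin_diff)
  \<comment> \<open>The minimisers at \<open>x\<close> inside the minimal face form a closed face
    again, hence all of it. So each evaluation has constant real part there.\<close>
  have const: "Re (blinfun_apply a x) = Re (blinfun_apply b x)" if ab: "a \<in> ?F" "b \<in> ?F" for a b x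
  proof -
    obtain F' where F': "closedin T F'" "F' \<noteq> {}" "face F'" "F' \<subseteq> ?F"
        "\<forall>a\<in>F'. \<forall>b\<in>?F. Re (blinfun_apply a x) \<le> Re (blinfun_apply b x)"
      using min_face[OF F M(2,3), of x] by blast
    let ?U = "topspace T - F'"
    have FU: "F0 - ?U = F'" using F'(4) F0T by blast
    have "?U = M"
    proof (rule max)
      show "openin T ?U" using F'(1) by auto
      show "F0 - ?U \<noteq> {}" "face (F0 - ?U)" unfolding FU using F' by auto
      show "M \<subseteq> ?U" using F'(4) openin_subset[OF M(1)] by blast
    qed
    then have "F' = ?F" using FU by simp
    then show ?thesis using F'(5) ab by (intro antisym) auto
  qed
  obtain \<psi> where \<psi>: "\<psi> \<in> ?F" using M(2) by blast
  have FB: "?F \<subseteq> ?B" using F0T by (auto simp: topspace_ball)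
  have single: "a = \<psi>" if "a \<in> ?F" for a
  proof (rule dual_ball_eqI)
    show "a \<in> ?B" "\<psi> \<in> ?B" using that \<psi> FB by blast+
    show "Re (blinfun_apply a x) = Re (blinfun_apply \<psi> x)" for x using that \<psi> by (rule const)
  qed
  have "\<psi> extreme_point_of ?B"
    unfolding extreme_point_of_def
  proof (intro conjI ballI notI)
    show "\<psi> \<in> ?B" using \<psi> FB by blast
    fix a b assume ab: "a \<in> ?B" "b \<in> ?B" and "\<psi> \<in> open_segment a b"
    then obtain t where t: "0 < t" "t < 1" "\<psi> = (1 - t) *\<^sub>R a + t *\<^sub>R b" and "a \<noteq> b"
      by (auto simp: in_segment)
    then have "a \<in> ?F" "b \<in> ?F" using M(3) ab \<psi> unfolding face_def by blast+
    then show False using single \<open>a \<noteq> b\<close> by blast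
  qed
  moreover have "Re (blinfun_apply \<psi> e) \<le> Re (blinfun_apply \<phi> e)" using F0(4) \<psi> \<phi> by blast
  ultimately show ?thesis by blast
qed

end

section \<open>Barycenters\<close>

lemma radon_integrable_continuous:
  fixes h :: "'a \<Rightarrow> 'b::{banach,second_countable_topology}"
  assumes \<mu>: "radon_probability T \<mu>" and T: "compact_space T" and h: "continuous_map T euclidean h"
  shows "integrable \<mu> h"
proof -
  interpret prob_space \<mu> using \<mu> by (simp add: radon_probability_def)
  have space: "space \<mu> = topspace T" and sets: "\<And>U. openin T U \<Longrightarrow> U \<in> sets \<mu>"
    using \<mu> by (auto simp: radon_probability_def radon_measure_def)
  have "h \<in> borel_measurable \<mu>"
  proof (rule borel_measurableI)
    fix S :: "'b set" assume "open S"
    then have "openin T {x \<in> topspace T. h x \<in> S}" using h by (intro openin_continuous_map_preimage) auto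
    moreover have "h -` S \<inter> space \<mu> = {x \<in> topspace T. h x \<in> S}" using space by auto
    ultimately show "h -` S \<inter> space \<mu> \<in> sets \<mu>" using sets by simp
  qed
  moreover have "compact (h ` topspace T)"
    using T h image_compactin[of T "topspace T" euclidean h] by (simp add: compact_space_def)
  then obtain B where "\<And>x. x \<in> topspace T \<Longrightarrow> norm (h x) \<le> B"
    using compact_imp_bounded bounded_iff by (metis imageI)
  ultimately show ?thesis using space by (intro integrable_const_bound[where B = B]) auto
qed

text \<open>For the lower bound, nearly optimal closed sets for \<open>m\<close> and
  \<open>m'\<close> are replaced by their union, which is nearly optimal for both.\<close>

lemma inner_content_convex:
  assumes m: "m \<in> fa_prob K" "m' \<in> fa_prob K" and t: "0 \<le> t" "t \<le> 1"
    and T: "compact_space T" "Hausdorff_space T" "closedin T K"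
  shows "(\<lambda>A. (1 - t) * m A + t * m' A) \<in> fa_prob K"
    and "inner_content T (\<lambda>A. (1 - t) * m A + t * m' A) G =
      (1 - t) * inner_content T m G + t * inner_content T m' G"
proof -
  let ?m = "\<lambda>A. (1 - t) * m A + t * m' A"
  show mm: "?m \<in> fa_prob K"
    unfolding fa_prob_def mem_Collect_eq
  proof (intro conjI allI impI)
    show "0 \<le> (1 - t) * m A + t * m' A" for A
      using fa_probD(1)[OF m(1)] fa_probD(1)[OF m(2)] t by simp
    show "(1 - t) * m (A \<inter> K) + t * m' (A \<inter> K) = (1 - t) * m A + t * m' A" for A
      by (simp only: fa_probD(2)[OF m(1)] fa_probD(2)[OF m(2)])
    show "(1 - t) * m K + t * m' K = 1" by (simp add: fa_probD(3)[OF m(1)] fa_probD(3)[OF m(2)])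
    show "(1 - t) * m (A \<union> B) + t * m' (A \<union> B) = (1 - t) * m A + t * m' A + ((1 - t) * m B + t * m' B)"
      if "A \<inter> B = {}" for A B
      using fa_probD(4)[OF m(1) that] fa_probD(4)[OF m(2) that] by (simp add: algebra_simps)
  qed
  interpret R: regularization T K m using m T by unfold_locales
  interpret R': regularization T K m' using m T by unfold_locales
  interpret R'': regularization T K ?m using mm T by unfold_locales
  show "inner_content T ?m G = (1 - t) * inner_content T m G + t * inner_content T m' G"
  proof (rule antisym)
    show "inner_content T ?m G \<le> (1 - t) * inner_content T m G + t * inner_content T m' G"
      using t by (intro R''.nu_least add_mono mult_left_mono R.nu_upper R'.nu_upper) auto
    show "(1 - t) * inner_content T m G + t * inner_content T m' G \<le> inner_content T ?m G"
    proof (rule field_le_epsilon)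
      fix e :: real assume e: "0 < e"
      obtain F where F: "closedin T F" "F \<subseteq> G" "inner_content T m G - e < m F"
        using R.nu_less[of "inner_content T m G - e" G] e by auto
      obtain F' where F': "closedin T F'" "F' \<subseteq> G" "inner_content T m' G - e < m' F'"
        using R'.nu_less[of "inner_content T m' G - e" G] e by auto
      have le: "m F \<le> m (F \<union> F')" "m' F' \<le> m' (F \<union> F')"
        using fa_prob_mono m by blast+
      have "(1 - t) * (inner_content T m G - e) + t * (inner_content T m' G - e) \<le> ?m (F \<union> F')"
        using t F(3) F'(3) le by (intro add_mono mult_left_mono) auto
      also have "\<dots> \<le> inner_content T ?m G" using F F' by (intro R''.nu_upper) auto
      finally show "(1 - t) * inner_content T m G + t * inner_content T m' G \<le> inner_content T ?m G + e"
        by (simp add: algebra_simps)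
    qed
  qed
qed

section \<open>Affine dependence of integrals on the probability, and Dirac measures\<close>

context regular_family
begin

lemma radon_mu: "m \<in> fa_prob K \<Longrightarrow> radon_probability T (\<mu> m)"
  by (rule regularization.radon_probability_mu[OF regularization])

lemma K_integral_eq:
  assumes m: "m \<in> fa_prob K" and h: "h \<in> borel_measurable (\<mu> m)"
  shows "K_integral h m = (LINT x|\<mu> m. h x)"
proof -
  interpret prob_space "\<mu> m" using m by (rule prob_space_mu)
  have "AE x in \<mu> m. x \<in> K" using prob_eq_1[OF K_sets[OF m]] measure_K[OF m] by simp
  then have "AE x in \<mu> m. indicator K x *\<^sub>R h x = h x" by eventually_elim simp
  then show ?thesis
    unfolding K_integral_def using h K_sets[OF m] by (intro integral_cong_AE) auto
qed

text \<open>The superlevel sets of a continuous \<open>u\<close> are open, so the layer sums involve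
  only \<open>inner_content\<close> and are affine in \<open>m\<close>; their error
  \<open>1 / Suc n\<close> tends to zero.\<close>

lemma integral_convex:
  assumes m: "m \<in> fa_prob K" "m' \<in> fa_prob K" and t: "0 \<le> t" "t \<le> 1"
    and u: "continuous_map T euclideanreal u" "\<And>x. x \<in> topspace T \<Longrightarrow> 0 \<le> u x \<and> u x \<le> 1"
  shows "(LINT x|\<mu> (\<lambda>A. (1 - t) * m A + t * m' A). u x) = (1 - t) * (LINT x|\<mu> m. u x) + t * (LINT x|\<mu> m'. u x)"
    (is "?I'' = (1 - t) * ?I + t * ?I'")
proof -
  let ?m = "\<lambda>A. (1 - t) * m A + t * m' A"
  note conv = inner_content_convex[OF m t compact_T Hausdorff_T closed_K]
  define L where "L m n = (\<Sum>k<Suc n. (1 / Suc n) * inner_content T m {x \<in> topspace T. k / Suc n < u x})"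
    for m and n :: nat
  have bounds: "(LINT x|\<mu> m. u x) \<le> L m n" "L m n \<le> (LINT x|\<mu> m. u x) + 1 / Suc n"
    if m: "m \<in> fa_prob K" for m n
  proof -
    interpret prob_space "\<mu> m" using m by (rule prob_space_mu)
    have "openin T {x \<in> topspace T. c < u x}" for c
      using openin_continuous_map_preimage[OF u(1), of "{c<..}"] by simp
    then have "L m n = (\<Sum>k<Suc n. (1 / Suc n) * prob {x \<in> space (\<mu> m). k / Suc n < u x})"
      unfolding L_def using regularization.measure_open[OF regularization[OF m]] by (simp add: space_mu[OF m])
    moreover have "u \<in> borel_measurable (\<mu> m)"
      using radon_integrable_continuous[OF radon_mu[OF m] compact_T u(1)] by blast
    ultimately show "(LINT x|\<mu> m. u x) \<le> L m n" "L m n \<le> (LINT x|\<mu> m. u x) + 1 / Suc n"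
      using layer_integral_bounds[of u n] u(2) by (auto simp: space_mu[OF m])
  qed
  have L: "L ?m n = (1 - t) * L m n + t * L m' n" for n
    unfolding L_def conv(2) sum_distrib_left sum.distrib[symmetric]
    by (intro sum.cong refl) (simp only: distrib_left mult.left_commute)
  have "\<bar>?I'' - ((1 - t) * ?I + t * ?I')\<bar> \<le> e" if e: "0 < e" for e
  proof -
    obtain n where n: "1 / real (Suc n) < e" using nat_approx_posE[OF e] by blast
    have 1: "(1 - t) * ?I \<le> (1 - t) * L m n" "t * ?I' \<le> t * L m' n"
      "(1 - t) * L m n \<le> (1 - t) * (?I + 1 / Suc n)" "t * L m' n \<le> t * (?I' + 1 / Suc n)"
      using t bounds m by (auto intro!: mult_left_mono)
    have "(1 - t) * (?I + d) + t * (?I' + d) = (1 - t) * ?I + t * ?I' + d" for d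
      by (simp add: algebra_simps)
    note 2 = this[of "1 / real (Suc n)"]
    have "\<bar>?I'' - ((1 - t) * ?I + t * ?I')\<bar> \<le> 1 / real (Suc n)"
      using 1 2 bounds[OF conv(1), of n] L[of n] by linarith
    then show ?thesis using n by simp
  qed
  then have "\<bar>?I'' - ((1 - t) * ?I + t * ?I')\<bar> \<le> 0" by (rule field_le_epsilon) simp
  then show ?thesis by simp
qed

definition dirac :: "'a \<Rightarrow> 'a set \<Rightarrow> real" where
  "dirac z A = (if z \<in> A then 1 else 0)"

lemma dirac_fa_prob: "z \<in> K \<Longrightarrow> dirac z \<in> fa_prob K"
  by (auto simp: fa_prob_def dirac_def)

lemma K_integral_dirac:
  assumes z: "z \<in> K" and h: "h \<in> borel_measurable (\<mu> (dirac z))"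
  shows "K_integral h (dirac z) = h z"
proof -
  note m = dirac_fa_prob[OF z]
  interpret prob_space "\<mu> (dirac z)" using m by (rule prob_space_mu)
  have cl: "closedin T {z}" using Hausdorff_T z K_subset by (intro closedin_Hausdorff_singleton) auto
  then have "1 \<le> prob {z}"
    using regularization.measure_closed_ge[OF regularization[OF m] cl] by (simp add: dirac_def)
  then have "prob {z} = 1" using prob_le_1 by (intro antisym) auto
  then have "AE x in \<mu> (dirac z). x \<in> {z}"
    using prob_eq_1 regularization.closed_sets[OF regularization[OF m] cl] by blast
  then have "AE x in \<mu> (dirac z). h x = h z" by eventually_elim simp
  then have "(LINT x|\<mu> (dirac z). h x) = (LINT x|\<mu> (dirac z). h z)"
    using h by (intro integral_cong_AE) auto
  then show ?thesis using K_integral_eq[OF m h] by (simp add: prob_space)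
qed

end

section \<open>Existence and uniqueness of barycenters in the dual ball\<close>

context scalar_banach_space
begin

lemma eval_continuous_affine: "continuous_affine T (\<lambda>\<phi>. blinfun_apply \<phi> x)"
  unfolding continuous_affine_def using continuous_eval
  by (simp add: blinfun.add_left blinfun.scaleR_left)

text \<open>The unknown point has to satisfy one equation for each continuous real affine function.
  The inequality required by \<open>convexlike_solution\<close> holds because a continuous
  combination of such functions attains a minimum, which is at most its integral against a
  probability.\<close>

lemma barycenter_exists:
  assumes \<mu>: "radon_probability T \<mu>"
  shows "\<exists>x\<in>topspace T. \<forall>h. continuous_affine T h \<longrightarrow> (LINT y|\<mu>. h y) = h x"
proof -
  interpret prob_space \<mu> using \<mu> by (simp add: radon_probability_def)
  have space: "space \<mu> = topspace T" using \<mu> by (simp add: radon_probability_def radon_measure_def)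
  define J where "J = {u. continuous_map T euclideanreal u \<and>
    (\<forall>x\<in>topspace T. \<forall>y\<in>topspace T. \<forall>t\<in>{0..1}. u ((1 - t) *\<^sub>R x + t *\<^sub>R y) = (1 - t) * u x + t * u y)}"
  have int: "integrable \<mu> u" if "continuous_map T euclideanreal u" for u
    using radon_integrable_continuous[OF \<mu> compact_ball that] .
  have ne: "topspace T \<noteq> {}" using zero_in_ball topspace_ball by blast
  have "\<exists>x\<in>topspace T. \<forall>u\<in>J. u x = (LINT y|\<mu>. u y)"
  proof (rule convexlike_solution[OF compact_ball ne])
    show "continuous_map T euclideanreal u" if "u \<in> J" for u using that by (simp add: J_def)
    show "\<exists>z\<in>topspace T. \<forall>u\<in>J. u z = (1 - t) * u x + t * u y"
      if "x \<in> topspace T" "y \<in> topspace T" "0 < t" "t \<le> 1" for x y t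
      using that convex_ball[of x y t]
      by (intro bexI[of _ "(1 - t) *\<^sub>R x + t *\<^sub>R y"]) (auto simp: J_def topspace_ball)
    fix I and c :: "_ \<Rightarrow> real" assume I: "finite I" "I \<subseteq> J"
    define g where "g x = (\<Sum>u\<in>I. c u * u x)" for x
    have cg: "continuous_map T euclideanreal g"
      unfolding g_def using I by (intro continuous_map_sum continuous_map_real_mult) (auto simp: J_def)
    then have "compact (g ` topspace T)"
      using compact_ball image_compactin[of T "topspace T" euclideanreal g] by (simp add: compact_space_def)
    then obtain y where y: "y \<in> topspace T" "\<And>x. x \<in> topspace T \<Longrightarrow> g y \<le> g x"
      using compact_attains_inf[of "g ` topspace T"] ne by auto
    have "(LINT x|\<mu>. g y) \<le> (LINT x|\<mu>. g x)"
      using int[OF cg] y(2) space by (intro integral_mono) auto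
    also have "\<dots> = (\<Sum>u\<in>I. c u * (LINT x|\<mu>. u x))"
    proof -
      have "integrable \<mu> u" if "u \<in> I" for u using that I(2) by (intro int) (auto simp: J_def)
      then show ?thesis unfolding g_def by (subst Bochner_Integration.integral_sum) auto
    qed
    finally show "\<exists>y\<in>topspace T. (\<Sum>u\<in>I. c u * u y) \<le> (\<Sum>u\<in>I. c u * (LINT y|\<mu>. u y))"
      using y(1) by (intro bexI[of _ y]) (simp_all add: g_def prob_space)
  qed
  then obtain x where x: "x \<in> topspace T" "\<And>u. u \<in> J \<Longrightarrow> u x = (LINT y|\<mu>. u y)" by blast
  have "(LINT y|\<mu>. h y) = h x" if h: "continuous_affine T h" for h
  proof -
    have hc: "continuous_map T euclidean h" using h by (simp add: continuous_affine_def)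
    then have hi: "integrable \<mu> h" using radon_integrable_continuous[OF \<mu> compact_ball] by blast
    have "continuous_map T euclideanreal (\<lambda>y. Re (h y))" "continuous_map T euclideanreal (\<lambda>y. Im (h y))"
      using continuous_map_compose[OF hc, of euclidean Re] continuous_map_compose[OF hc, of euclidean Im]
      by (simp_all add: comp_def continuous_on_Re continuous_on_Im)
    then have "(\<lambda>y. Re (h y)) \<in> J" "(\<lambda>y. Im (h y)) \<in> J"
      using h unfolding J_def continuous_affine_def by auto
    then have "Re (h x) = (LINT y|\<mu>. Re (h y))" "Im (h x) = (LINT y|\<mu>. Im (h y))" using x(2) by blast+
    then show ?thesis using hi by (intro complex_eqI) simp_all
  qed
  then show ?thesis using x(1) by blast
qed

text \<open>Evaluations at vectors are continuous affine and separate points, so the definite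
  description in \<open>barycenter\<close> denotes.\<close>

lemma barycenter_ball:
  assumes \<mu>: "radon_probability T \<mu>"
  shows "barycenter T \<mu> \<in> topspace T"
    and "continuous_affine T h \<Longrightarrow> (LINT y|\<mu>. h y) = h (barycenter T \<mu>)"
proof -
  let ?P = "\<lambda>x. x \<in> topspace T \<and> (\<forall>h. continuous_affine T h \<longrightarrow> (LINT y|\<mu>. h y) = h x)"
  have "\<exists>!x. ?P x"
  proof (rule ex_ex1I)
    show "\<exists>x. ?P x" using barycenter_exists[OF \<mu>] by blast
    fix x y assume "?P x" "?P y"
    then have "blinfun_apply x e = blinfun_apply y e" for e using eval_continuous_affine[of e] by metis
    then show "x = y" by (rule blinfun_eqI)
  qed
  then have "?P (barycenter T \<mu>)" unfolding barycenter_def by (rule theI')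
  then show "barycenter T \<mu> \<in> topspace T" "continuous_affine T h \<Longrightarrow> (LINT y|\<mu>. h y) = h (barycenter T \<mu>)"
    by blast+
qed

abbreviation "ext_closure \<equiv> weak_star K smul closure_of {\<phi>. \<phi> extreme_point_of dual_ball K smul}"

lemma ball_closed_weak_star: "closedin (weak_star K smul) (dual_ball K smul)"
proof (rule compactin_imp_closedin)
  show "Hausdorff_space (weak_star K smul)"
    unfolding weak_star_def by (intro Hausdorff_space_subtopology Hausdorff_strong_operator_topology)
  have "dual_ball K smul \<subseteq> topspace (weak_star K smul)"
    by (auto simp: weak_star_def strong_operator_topology_topspace dual_ball_def)
  then show "compactin (weak_star K smul) (dual_ball K smul)"
    using compact_ball by (simp add: ball_top_def compactin_subspace)
qed

lemma ext_closure_subset: "ext_closure \<subseteq> dual_ball K smul"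
  by (rule closure_of_minimal[OF _ ball_closed_weak_star]) (auto simp: extreme_point_of_def)

lemma ext_closure_closed: "closedin T ext_closure"
  unfolding ball_top_def using ext_closure_subset
  by (intro closedin_subset_topspace closedin_closure_of)

lemma ext_closure_top_eq: "ext_closure_top K smul = subtopology T ext_closure"
  using ext_closure_subset
  by (simp add: ext_closure_top_def ball_top_def subtopology_subtopology Int_absorb1)

lemma extreme_in_closure: "\<phi> extreme_point_of dual_ball K smul \<Longrightarrow> \<phi> \<in> ext_closure"
  using closure_of_subset[of "{\<phi>. \<phi> extreme_point_of dual_ball K smul}" "weak_star K smul"]
  by (auto simp: extreme_point_of_def weak_star_def strong_operator_topology_topspace dual_ball_def)

section \<open>The resultant map from finitely additive probabilities onto the dual ball\<close>

interpretation R: regular_family T ext_closure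
  using compact_ball Hausdorff_ball ext_closure_closed by unfold_locales

definition resultant :: "(('e \<Rightarrow>\<^sub>L complex) set \<Rightarrow> real) \<Rightarrow> 'e \<Rightarrow>\<^sub>L complex" where
  "resultant m = barycenter T (regular_measure T m)"

lemma resultant_in_ball: "m \<in> fa_prob ext_closure \<Longrightarrow> resultant m \<in> dual_ball K smul"
  using barycenter_ball(1)[OF R.radon_mu] by (simp add: resultant_def topspace_ball[symmetric] del: topspace_ball)

lemma eval_measurable:
  "m \<in> fa_prob ext_closure \<Longrightarrow> (\<lambda>\<phi>. blinfun_apply \<phi> x) \<in> borel_measurable (regular_measure T m)"
  by (rule borel_measurable_integrable[OF radon_integrable_continuous[OF R.radon_mu compact_ball continuous_eval]])

lemma resultant_eval:
  assumes "m \<in> fa_prob ext_closure"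
  shows "blinfun_apply (resultant m) x = (LINT \<phi>|regular_measure T m. blinfun_apply \<phi> x)"
  unfolding resultant_def using barycenter_ball(2)[OF R.radon_mu[OF assms] eval_continuous_affine] by simp

text \<open>Each coordinate of the resultant is the integral of a continuous evaluation, so
  continuity is the transfer lemma for open sets.\<close>

lemma continuous_resultant: "continuous_map (fa_top ext_closure) T resultant"
proof (rule continuous_map_into_ball)
  show "resultant ` topspace (fa_top ext_closure) \<subseteq> dual_ball K smul" using resultant_in_ball by auto
  fix x
  have "(\<lambda>\<phi>. blinfun_apply \<phi> x) \<in> preimage_class (subtopology T ext_closure) (Collect (openin (subtopology T ext_closure)))"
    using continuous_map_from_subtopology[OF continuous_eval[of x]]
    unfolding continuous_map_eq_preimage_class[symmetric] by simp
  moreover have "norm (blinfun_apply \<phi> x) \<le> norm x" if "\<phi> \<in> ext_closure" for \<phi>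
  proof -
    have "norm \<phi> \<le> 1" using that ext_closure_subset by (auto simp: dual_ball_def)
    then show ?thesis using norm_blinfun[of \<phi> x] mult_right_mono[of "norm \<phi>" 1 "norm x"] by simp
  qed
  ultimately have "R.K_integral (\<lambda>\<phi>. blinfun_apply \<phi> x) \<in> preimage_class (fa_top ext_closure) (Collect (openin (fa_top ext_closure)))"
    using sigma_lattice_openin[of "fa_top ext_closure"]
    by (intro R.K_integral_preimage_class[OF _ R.transfers_openin]) auto
  then have "continuous_map (fa_top ext_closure) euclidean (R.K_integral (\<lambda>\<phi>. blinfun_apply \<phi> x))"
    unfolding continuous_map_eq_preimage_class[symmetric] by simp
  then show "continuous_map (fa_top ext_closure) euclidean (\<lambda>m. blinfun_apply (resultant m) x)"
    by (rule continuous_map_eq) (simp add: resultant_eval R.K_integral_eq[OF _ eval_measurable])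
qed

text \<open>Reduced to \<open>integral_convex\<close> by rescaling the real part into
  \<open>[0,1]\<close>; adding 1 in \<open>N\<close> keeps it positive for
  \<open>x = 0\<close>.\<close>

lemma resultant_convex:
  assumes m: "m \<in> fa_prob ext_closure" "m' \<in> fa_prob ext_closure" and t: "0 \<le> t" "t \<le> 1"
  shows "Re (blinfun_apply (resultant (\<lambda>A. (1 - t) * m A + t * m' A)) x) =
    (1 - t) * Re (blinfun_apply (resultant m) x) + t * Re (blinfun_apply (resultant m') x)"
proof -
  define N where "N = norm x + 1"
  have N: "0 < N" by (simp add: N_def add_nonneg_pos)
  define u where "u \<phi> = 1 / 2 + Re (blinfun_apply \<phi> x) / (2 * N)" for \<phi> :: "'e \<Rightarrow>\<^sub>L complex"
  have cu: "continuous_map T euclideanreal u"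
  proof -
    have "continuous_on UNIV (\<lambda>z. 1 / 2 + Re z / (2 * N))" using N by (intro continuous_intros) auto
    then show ?thesis
      using continuous_map_compose[OF continuous_eval[of x], of euclidean "\<lambda>z. 1 / 2 + Re z / (2 * N)"]
      by (simp add: comp_def u_def[abs_def])
  qed
  have "0 \<le> u \<phi> \<and> u \<phi> \<le> 1" if "\<phi> \<in> topspace T" for \<phi>
  proof -
    have "norm \<phi> \<le> 1" using that by (auto simp: topspace_ball dual_ball_def)
    then have "norm (blinfun_apply \<phi> x) \<le> norm x"
      using norm_blinfun[of \<phi> x] mult_right_mono[of "norm \<phi>" 1 "norm x"] by simp
    then have "\<bar>Re (blinfun_apply \<phi> x)\<bar> \<le> N" using abs_Re_le_cmod[of "blinfun_apply \<phi> x"] by (simp add: N_def)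
    then have "- N \<le> Re (blinfun_apply \<phi> x)" "Re (blinfun_apply \<phi> x) \<le> N" by auto
    then show ?thesis using N by (auto simp: u_def field_simps)
  qed
  from R.integral_convex[OF m t cu this]
  have conv: "(LINT x|regular_measure T (\<lambda>A. (1 - t) * m A + t * m' A). u x) =
    (1 - t) * (LINT x|regular_measure T m. u x) + t * (LINT x|regular_measure T m'. u x)" .
  have Iu: "(LINT \<phi>|regular_measure T m. u \<phi>) = 1 / 2 + Re (blinfun_apply (resultant m) x) / (2 * N)"
    if m: "m \<in> fa_prob ext_closure" for m
  proof -
    interpret prob_space "regular_measure T m" using m by (rule R.prob_space_mu)
    have i: "integrable (regular_measure T m) (\<lambda>\<phi>. blinfun_apply \<phi> x)"
      using radon_integrable_continuous[OF R.radon_mu[OF m] compact_ball continuous_eval] .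
    show ?thesis
      unfolding u_def resultant_eval[OF m] using i by (simp add: prob_space)
  qed
  have cancel: "a = (1 - t) * b + t * c"
    if "1 / 2 + a / (2 * N) = (1 - t) * (1 / 2 + b / (2 * N)) + t * (1 / 2 + c / (2 * N))" for a b c
  proof -
    have "(1 - t) * (1 / 2 + b / (2 * N)) + t * (1 / 2 + c / (2 * N)) = 1 / 2 + ((1 - t) * b + t * c) / (2 * N)"
      by (simp add: algebra_simps add_divide_distrib diff_divide_distrib)
    then show ?thesis using that N by simp
  qed
  have "1 / 2 + Re (blinfun_apply (resultant (\<lambda>A. (1 - t) * m A + t * m' A)) x) / (2 * N) =
      (1 - t) * (1 / 2 + Re (blinfun_apply (resultant m) x) / (2 * N)) +
      t * (1 / 2 + Re (blinfun_apply (resultant m') x) / (2 * N))"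
    using conv Iu m inner_content_convex(1)[OF m t compact_ball Hausdorff_ball ext_closure_closed] by simp
  then show ?thesis by (rule cancel)
qed

lemma resultant_dirac:
  assumes "z \<in> ext_closure"
  shows "resultant (R.dirac z) = z"
proof (rule blinfun_eqI)
  fix x
  note m = R.dirac_fa_prob[OF assms]
  show "blinfun_apply (resultant (R.dirac z)) x = blinfun_apply z x"
    using R.K_integral_dirac[OF assms eval_measurable[OF m]] R.K_integral_eq[OF m eval_measurable[OF m]]
    by (simp add: resultant_eval[OF m])
qed

text \<open>An integral form of Krein-Milman. A real combination of the real parts of evaluations is
  again one evaluation, at a combined vector; \<open>extreme_minimum\<close> supplies an extreme
  point whose value does not exceed that at \<open>x\<close>, and its Dirac measure satisfies the
  inequality of \<open>convexlike_solution\<close>.\<close>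

lemma resultant_onto: "resultant ` topspace (fa_top ext_closure) = topspace T"
proof
  show "resultant ` topspace (fa_top ext_closure) \<subseteq> topspace T"
    using resultant_in_ball by (auto simp: topspace_ball)
  show "topspace T \<subseteq> resultant ` topspace (fa_top ext_closure)"
  proof
    fix x assume "x \<in> topspace T"
    then have x: "x \<in> dual_ball K smul" by (simp add: topspace_ball)
    have "\<exists>m\<in>topspace (fa_top ext_closure). \<forall>e\<in>UNIV. Re (blinfun_apply (resultant m) e) = Re (blinfun_apply x e)"
    proof (rule convexlike_solution[OF compact_space_fa_top])
      obtain z where "z extreme_point_of dual_ball K smul" using extreme_minimum[OF zero_in_ball] by blast
      then show "topspace (fa_top ext_closure) \<noteq> {}" using R.dirac_fa_prob extreme_in_closure by auto
      fix e
      show "continuous_map (fa_top ext_closure) euclideanreal (\<lambda>m. Re (blinfun_apply (resultant m) e))"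
        using continuous_map_compose[OF continuous_map_compose[OF continuous_resultant continuous_eval[of e]], of euclidean Re]
        by (simp add: comp_def continuous_on_Re)
    next
      fix m m' and t :: real assume "m \<in> topspace (fa_top ext_closure)" "m' \<in> topspace (fa_top ext_closure)" "0 < t" "t \<le> 1"
      then show "\<exists>z\<in>topspace (fa_top ext_closure). \<forall>e\<in>UNIV. Re (blinfun_apply (resultant z) e) =
          (1 - t) * Re (blinfun_apply (resultant m) e) + t * Re (blinfun_apply (resultant m') e)"
        using resultant_convex[of m m' t]
          inner_content_convex(1)[of m ext_closure m' t, OF _ _ _ _ compact_ball Hausdorff_ball ext_closure_closed]
        by (intro bexI[of _ "\<lambda>A. (1 - t) * m A + t * m' A"]) auto
    next
      fix I :: "'e set" and c :: "'e \<Rightarrow> real"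
      have comb: "(\<Sum>e\<in>I. c e * Re (blinfun_apply \<psi> e)) = Re (blinfun_apply \<psi> (\<Sum>e\<in>I. c e *\<^sub>R e))" for \<psi> :: "'e \<Rightarrow>\<^sub>L complex"
        by (simp add: blinfun.sum_right blinfun.scaleR_right)
      obtain z where z: "z extreme_point_of dual_ball K smul"
          "Re (blinfun_apply z (\<Sum>e\<in>I. c e *\<^sub>R e)) \<le> Re (blinfun_apply x (\<Sum>e\<in>I. c e *\<^sub>R e))"
        using extreme_minimum[OF x] by blast
      note zE = extreme_in_closure[OF z(1)]
      show "\<exists>m\<in>topspace (fa_top ext_closure). (\<Sum>e\<in>I. c e * Re (blinfun_apply (resultant m) e)) \<le>
          (\<Sum>e\<in>I. c e * Re (blinfun_apply x e))"
        unfolding comb using z(2) R.dirac_fa_prob[OF zE] resultant_dirac[OF zE]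
        by (intro bexI[of _ "R.dirac z"]) auto
    qed
    then obtain m where m: "m \<in> fa_prob ext_closure" "\<And>e. Re (blinfun_apply (resultant m) e) = Re (blinfun_apply x e)"
      by auto
    have "resultant m = x" using resultant_in_ball[OF m(1)] x m(2) by (rule dual_ball_eqI)
    then show "x \<in> resultant ` topspace (fa_top ext_closure)" using m(1) by auto
  qed
qed

text \<open>The point where strong affinity is used: the left side sees only the restriction of
  \<open>f\<close> to the closure of the extreme points, the right side its values on the
  ball.\<close>

lemma strongly_affine_K_integral:
  assumes f: "strongly_affine T f" and m: "m \<in> fa_prob ext_closure"
  shows "R.K_integral f m = f (resultant m)"
proof -
  have "radon_measure T (regular_measure T m)" using R.radon_mu[OF m] by (simp add: radon_probability_def)
  then have "f \<in> borel_measurable (regular_measure T m)"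
    using f by (simp add: strongly_affine_def universally_measurable_def)
  moreover have "(LINT y|regular_measure T m. f y) = f (resultant m)"
    using f R.radon_mu[OF m] unfolding strongly_affine_def resultant_def by blast
  ultimately show ?thesis using R.K_integral_eq[OF m] by simp
qed

section \<open>Extension from the closure of the extreme points to the ball\<close>

lemma bidual_bounded:
  assumes "f \<in> bidual_space K smul"
  obtains M where "\<And>\<phi>. \<phi> \<in> dual_ball K smul \<Longrightarrow> norm (f \<phi>) \<le> M"
proof -
  obtain C where C: "\<And>\<phi>. \<phi> \<in> dual_space K smul \<Longrightarrow> cmod (f \<phi>) \<le> C * norm \<phi>"
    using assms unfolding bidual_space_def by blast
  have "norm (f \<phi>) \<le> \<bar>C\<bar>" if "\<phi> \<in> dual_ball K smul" for \<phi>
  proof -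
    have "cmod (f \<phi>) \<le> C * norm \<phi>" using that C by (auto simp: dual_ball_def)
    also have "\<dots> \<le> \<bar>C\<bar> * 1" using that by (intro mult_mono) (auto simp: dual_ball_def)
    finally show ?thesis by simp
  qed
  then show ?thesis by (rule that)
qed

lemma K_integral_resultant_hierarchy:
  assumes f: "f \<in> bidual_space K smul" "strongly_affine T f"
    and \<Sigma>': "sigma_lattice (fa_prob ext_closure) \<Sigma>'" and tr: "R.transfers \<Sigma> \<Sigma>'" and \<alpha>: "\<gamma> \<le> \<alpha>"
    and h: "f \<in> limit_hierarchy (topspace (ext_closure_top K smul)) \<gamma> (preimage_class (ext_closure_top K smul) \<Sigma>) \<alpha>"
  shows "f \<circ> resultant \<in> limit_hierarchy (fa_prob ext_closure) \<gamma> (preimage_class (fa_top ext_closure) \<Sigma>') \<alpha>"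
proof -
  obtain M where M: "\<And>\<phi>. \<phi> \<in> dual_ball K smul \<Longrightarrow> norm (f \<phi>) \<le> M" using bidual_bounded[OF f(1)] by blast
  have "f \<in> limit_hierarchy ext_closure \<gamma> (preimage_class (subtopology T ext_closure) \<Sigma>) \<alpha>"
    using h R.topspace_K by (simp add: ext_closure_top_eq)
  then have "R.K_integral f \<in> limit_hierarchy (fa_prob ext_closure) \<gamma> (preimage_class (fa_top ext_closure) \<Sigma>') \<alpha>"
    using M ext_closure_subset by (intro R.K_integral_limit_hierarchy[OF \<Sigma>' tr \<alpha>]) blast+
  then show ?thesis
  proof (rule limit_hierarchy_cong[OF \<alpha>])
    show "(f \<circ> resultant) m = R.K_integral f m" if "m \<in> fa_prob ext_closure" for m
      using strongly_affine_K_integral[OF f(2) that] by simp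
    show "h' \<in> preimage_class (fa_top ext_closure) \<Sigma>'"
      if "h \<in> preimage_class (fa_top ext_closure) \<Sigma>'" "\<And>m. m \<in> fa_prob ext_closure \<Longrightarrow> h' m = h m" for h h'
      using that by (intro preimage_class_cong[OF that(1)]) simp
  qed
qed

lemma Hf_extension:
  assumes f: "f \<in> bidual_space K smul" "strongly_affine T f" and \<alpha>: "1 \<le> \<alpha>"
    and h: "f \<in> Hf \<alpha> (ext_closure_top K smul)"
  shows "f \<in> Hf \<alpha> T"
proof (rule Hf_descent[OF compact_space_fa_top Hausdorff_ball continuous_resultant resultant_onto \<alpha>])
  have "f \<circ> resultant \<in> limit_hierarchy (fa_prob ext_closure) 1
      (preimage_class (fa_top ext_closure) (Sigma2 (Hs (fa_top ext_closure)))) \<alpha>"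
    using h sigma_lattice_Sigma2[OF algebra_Hs[of "fa_top ext_closure"]]
    by (intro K_integral_resultant_hierarchy[OF f _ R.transfers_Hs \<alpha>]) (simp_all add: Hf_def ext_closure_top_eq)
  then show "f \<circ> resultant \<in> Hf \<alpha> (fa_top ext_closure)" by (simp add: Hf_def)
qed simp

lemma Bof_extension:
  assumes f: "f \<in> bidual_space K smul" "strongly_affine T f" and \<alpha>: "1 \<le> \<alpha>"
    and h: "f \<in> Bof \<alpha> (ext_closure_top K smul)"
  shows "f \<in> Bof \<alpha> T"
proof (rule Bof_descent[OF compact_space_fa_top Hausdorff_ball continuous_resultant resultant_onto \<alpha>])
  have "f \<circ> resultant \<in> limit_hierarchy (fa_prob ext_closure) 1
      (preimage_class (fa_top ext_closure) (Sigma2 (Bos (fa_top ext_closure)))) \<alpha>"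
    using h sigma_lattice_Sigma2[OF algebra_Bos[of "fa_top ext_closure"]]
    by (intro K_integral_resultant_hierarchy[OF f _ R.transfers_Bos \<alpha>]) (simp_all add: Bof_def ext_closure_top_eq)
  then show "f \<circ> resultant \<in> Bof \<alpha> (fa_top ext_closure)" by (simp add: Bof_def)
qed simp

lemma Baire_class_resultant:
  assumes f: "f \<in> bidual_space K smul" "strongly_affine T f"
    and h: "f \<in> Baire_class \<alpha> (ext_closure_top K smul)"
  shows "f \<circ> resultant \<in> Baire_class \<alpha> (fa_top ext_closure)"
proof -
  have "f \<circ> resultant \<in> limit_hierarchy (fa_prob ext_closure) 0
      (preimage_class (fa_top ext_closure) (Collect (openin (fa_top ext_closure)))) \<alpha>"
    using h sigma_lattice_openin[of "fa_top ext_closure"] omega1_zero_le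
    by (intro K_integral_resultant_hierarchy[OF f _ R.transfers_openin])
      (simp_all add: Baire_class_def ext_closure_top_eq continuous_map_eq_preimage_class)
  then show ?thesis unfolding Baire_class_def continuous_map_eq_preimage_class by simp
qed

end

section \<open>Baire functions depend on countably many coordinates\<close>

text \<open>On a closed subset of \<open>X \<times> \<nat>\<^sup>\<nat>\<close> projecting onto \<open>X\<close> a Baire function becomes continuous: the second
  coordinate records moduli of convergence.\<close>

definition continuity_carrier :: "'a topology \<Rightarrow> ('a \<Rightarrow> complex) \<Rightarrow> ('a \<times> (nat \<Rightarrow> nat)) set \<Rightarrow> bool" where
  "continuity_carrier X g Z \<longleftrightarrow> closedin (prod_topology X euclidean) Z \<and>
     (\<forall>x\<in>topspace X. \<exists>p. (x, p) \<in> Z) \<and>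
     continuous_map (subtopology (prod_topology X euclidean) Z) euclidean (g \<circ> fst)"

lemma continuous_coordinate: "continuous_on UNIV (\<lambda>p::nat \<Rightarrow> nat. p j)"
  by (rule continuous_on_product_coordinates)

text \<open>A single sequence codes infinitely many: row 0 holds a Cauchy modulus for the values
  \<open>h n x\<close>, row \<open>Suc n\<close> a code for the continuity of \<open>h n\<close>.
  Near a point of the new carrier the modulus at \<open>k\<close> is constant, so one continuous
  \<open>h N\<close> approximates \<open>g\<close> there within \<open>(1/2) ^ k\<close>.\<close>

lemma continuity_carrier_limit:
  fixes h :: "nat \<Rightarrow> 'a \<Rightarrow> complex"
  assumes Z: "\<And>n. continuity_carrier X (h n) (Z n)"
    and lim: "\<And>x. x \<in> topspace X \<Longrightarrow> (\<lambda>n. h n x) \<longlonglongrightarrow> g x"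
  shows "\<exists>Z. continuity_carrier X g Z"
proof -
  let ?P = "prod_topology X (euclidean :: (nat \<Rightarrow> nat) topology)"
  define sh where "sh n z = (fst z, \<lambda>k. snd z (prod_encode (Suc n, k)))" for n and z :: "'a \<times> (nat \<Rightarrow> nat)"
  define q where "q k z = snd z (prod_encode (0, k))" for k and z :: "'a \<times> (nat \<Rightarrow> nat)"
  have csh: "continuous_map ?P ?P (sh n)" for n
  proof -
    have "continuous_on UNIV (\<lambda>p::nat \<Rightarrow> nat. \<lambda>k. p (prod_encode (Suc n, k)))"
      by (intro continuous_on_coordinatewise_then_product continuous_coordinate)
    then have "continuous_map ?P euclidean (\<lambda>z k. snd z (prod_encode (Suc n, k)))"
      using continuous_map_compose[OF continuous_map_snd[of X euclidean], of euclidean "\<lambda>p k. p (prod_encode (Suc n, k))"]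
      by (simp add: comp_def)
    then show ?thesis unfolding sh_def by (intro continuous_map_pairedI continuous_map_fst)
  qed
  have cq: "continuous_map ?P euclidean (q k)" for k
    using continuous_map_compose[OF continuous_map_snd[of X euclidean], of euclidean "\<lambda>p. p (prod_encode (0, k))"]
      continuous_coordinate by (simp add: comp_def q_def[abs_def])
  define W where "W = {z \<in> topspace ?P. \<forall>n. sh n z \<in> Z n}"
  have "W = (\<Inter>n. {z \<in> topspace ?P. sh n z \<in> Z n})" by (auto simp: W_def)
  also have "closedin ?P \<dots>"
    using Z csh by (intro closedin_INT closedin_continuous_map_preimage) (auto simp: continuity_carrier_def)
  finally have W: "closedin ?P W" .
  let ?W = "subtopology ?P W"
  have ch: "continuous_map ?W euclidean (\<lambda>z. h n (fst z))" for n
  proof -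
    have "continuous_map ?W (subtopology ?P (Z n)) (sh n)"
      using continuous_map_from_subtopology[OF csh] by (auto simp: continuous_map_in_subtopology W_def)
    from continuous_map_compose[OF this, of euclidean "h n \<circ> fst"] Z[of n]
    show ?thesis by (simp add: comp_def continuity_carrier_def sh_def)
  qed
  have cqW: "continuous_map ?W euclidean (q k)" for k
    using cq by (rule continuous_map_from_subtopology)
  have tW: "topspace ?W = W" using closedin_subset[OF W] by auto
  define Z' where "Z' = {z \<in> W. \<forall>k n m. q k z \<le> n \<and> q k z \<le> m \<longrightarrow> dist (h n (fst z)) (h m (fst z)) \<le> (1/2) ^ k}"
  \<comment> \<open>The implication is rewritten as a union of conditions; as the naturals are
    discrete, \<open>n < q k z\<close> is a closed one.\<close>
  have "Z' = W \<inter> (\<Inter>k. \<Inter>n. \<Inter>m. {z \<in> topspace ?W. q k z \<in> {n<..}} \<union> {z \<in> topspace ?W. q k z \<in> {m<..}} \<union>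
      {z \<in> topspace ?W. dist (h n (fst z)) (h m (fst z)) \<in> {..(1/2) ^ k}})"
    unfolding tW by (auto simp: Z'_def not_le[symmetric])
  also have "closedin ?W \<dots>"
  proof (intro closedin_Int closedin_INT closedin_Un)
    show "closedin ?W W" using closedin_topspace[of ?W] by (simp only: tW)
    fix k n m
    have "closedin euclidean {i<..}" for i :: nat by (simp add: closed_def open_discrete)
    then have "closedin ?W {z \<in> topspace ?W. q k z \<in> {i<..}}" for i
      by (rule closedin_continuous_map_preimage[OF cqW])
    then show "closedin ?W {z \<in> topspace ?W. q k z \<in> {n<..}}" "closedin ?W {z \<in> topspace ?W. q k z \<in> {m<..}}"
      by simp_all
    have "continuous_map ?W euclidean (\<lambda>z. (h n (fst z), h m (fst z)))"
      using ch[of n] ch[of m] by (simp add: continuous_map_pairedI flip: prod_topology_euclidean)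
    moreover have "continuous_on UNIV (\<lambda>p::complex \<times> complex. dist (fst p) (snd p))" by (intro continuous_intros)
    ultimately have "continuous_map ?W euclidean (\<lambda>z. dist (h n (fst z)) (h m (fst z)))"
      using continuous_map_compose[of ?W euclidean "\<lambda>z. (h n (fst z), h m (fst z))" euclidean "\<lambda>p. dist (fst p) (snd p)"]
      by (simp add: comp_def)
    then show "closedin ?W {z \<in> topspace ?W. dist (h n (fst z)) (h m (fst z)) \<in> {..(1/2) ^ k}}"
      by (rule closedin_continuous_map_preimage) simp
  qed auto
  finally have Z'W: "closedin ?W Z'" .
  then have Z'P: "closedin ?P Z'" using W by (rule closedin_trans_full)
  let ?Z = "subtopology ?P Z'"
  have sub: "Z' \<subseteq> W" by (auto simp: Z'_def)
  have tZ: "topspace ?Z = Z'" using closedin_subset[OF Z'P] by auto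
  have ZW: "?Z = subtopology ?W Z'" using sub by (simp add: subtopology_subtopology Int_absorb1)
  have near: "dist (h n (fst z)) (g (fst z)) \<le> (1/2) ^ k" if "z \<in> Z'" "q k z \<le> n" for z k n
  proof -
    have "fst z \<in> topspace X" using that(1) closedin_subset[OF Z'P] by auto
    then have "(\<lambda>m. dist (h n (fst z)) (h m (fst z))) \<longlonglongrightarrow> dist (h n (fst z)) (g (fst z))"
      using lim by (intro tendsto_dist tendsto_const)
    then show ?thesis
      using that by (intro LIMSEQ_le_const2[OF _ exI[of _ "q k z"]]) (auto simp: Z'_def)
  qed
  have "continuous_map ?Z euclidean (g \<circ> fst)"
    unfolding mtopology_is_euclidean[symmetric] Met_TC.continuous_map_to_metric
  proof (intro ballI allI impI)
    fix z0 and \<epsilon> :: real assume z0: "z0 \<in> topspace ?Z" and \<epsilon>: "0 < \<epsilon>"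
    have z0Z: "z0 \<in> Z'" using z0 tZ by simp
    obtain k where k: "(1/2) ^ k < \<epsilon> / 3" using real_arch_pow_inv[of "\<epsilon> / 3" "1/2"] \<epsilon> by auto
    define N where "N = q k z0"
    have chZ: "continuous_map ?Z euclidean (\<lambda>z. h N (fst z))" and cqZ: "continuous_map ?Z euclidean (q k)"
      unfolding ZW using ch cqW by (auto intro: continuous_map_from_subtopology)
    \<comment> \<open>On this neighbourhood the modulus keeps its value \<open>N\<close> at
      \<open>z0\<close>, so \<open>h N\<close> is close to \<open>g\<close> at every point of it,
      not just at \<open>z0\<close>.\<close>
    let ?O = "{z \<in> topspace ?Z. q k z \<in> {N}} \<inter> {z \<in> topspace ?Z. h N (fst z) \<in> ball (h N (fst z0)) (\<epsilon> / 3)}"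
    have "openin ?Z ?O"
      using chZ cqZ by (intro openin_Int openin_continuous_map_preimage) (auto simp: open_discrete)
    moreover have "z0 \<in> ?O" using z0 \<epsilon> by (simp add: N_def)
    moreover have "(g \<circ> fst) z \<in> Met_TC.mball ((g \<circ> fst) z0) \<epsilon>" if z: "z \<in> ?O" for z
    proof -
      have zZ: "z \<in> Z'" using z tZ by simp
      have "dist (h N (fst z)) (g (fst z)) \<le> (1/2) ^ k" using z by (intro near[OF zZ]) auto
      moreover have "dist (h N (fst z0)) (g (fst z0)) \<le> (1/2) ^ k" by (intro near[OF z0Z]) (simp add: N_def)
      moreover have "dist (h N (fst z0)) (h N (fst z)) < \<epsilon> / 3" using z by simp
      moreover have "dist (g (fst z0)) (g (fst z)) \<le> dist (h N (fst z0)) (g (fst z0)) +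
          dist (h N (fst z0)) (h N (fst z)) + dist (h N (fst z)) (g (fst z))"
        using dist_triangle[of "g (fst z0)" "g (fst z)" "h N (fst z0)"]
          dist_triangle[of "h N (fst z0)" "g (fst z)" "h N (fst z)"] by (simp add: dist_commute)
      ultimately show ?thesis using k by simp
    qed
    ultimately show "\<exists>U. openin ?Z U \<and> z0 \<in> U \<and> (\<forall>y\<in>U. (g \<circ> fst) y \<in> Met_TC.mball ((g \<circ> fst) z0) \<epsilon>)"
      by blast
  qed
  moreover have "\<exists>p. (x, p) \<in> Z'" if x: "x \<in> topspace X" for x
  proof -
    have "\<forall>n. \<exists>p. (x, p) \<in> Z n" using Z x by (auto simp: continuity_carrier_def)
    from choice[OF this] obtain p where p: "\<And>n. (x, p n) \<in> Z n" by auto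
    have "Cauchy (\<lambda>n. h n x)" using lim[OF x] by (rule LIMSEQ_imp_Cauchy)
    then have "\<exists>M. \<forall>m\<ge>M. \<forall>n\<ge>M. dist (h m x) (h n x) < (1/2) ^ k" for k :: nat
      by (rule metric_CauchyD) simp
    then have "\<forall>k::nat. \<exists>M. \<forall>m\<ge>M. \<forall>n\<ge>M. dist (h m x) (h n x) < (1/2) ^ k" by (rule allI)
    from choice[OF this] obtain r where r: "\<And>k m n. r k \<le> m \<Longrightarrow> r k \<le> n \<Longrightarrow> dist (h m x) (h n x) < (1/2) ^ k"
      by auto
    \<comment> \<open>The moduli \<open>r k\<close> and the codes \<open>p n\<close> are interleaved
      so that \<open>q\<close> and \<open>sh\<close> recover them.\<close>
    define s where "s j = (case prod_decode j of (0, k) \<Rightarrow> r k | (Suc n, k) \<Rightarrow> p n k)" for j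
    have "sh n (x, s) = (x, p n)" for n by (simp add: sh_def s_def)
    then have "(x, s) \<in> W" using x p by (simp add: W_def)
    moreover have "q k (x, s) = r k" for k by (simp add: q_def s_def)
    ultimately have "(x, s) \<in> Z'" using r by (auto simp: Z'_def intro: less_imp_le)
    then show ?thesis by blast
  qed
  ultimately show ?thesis using Z'P by (auto simp: continuity_carrier_def)
qed

lemma Baire_class_continuity_carrier:
  assumes "g \<in> Baire_class \<alpha> X"
  shows "\<exists>Z. continuity_carrier X g Z"
  using omega1_zero_le[of \<alpha>] assms[unfolded Baire_class_def]
proof (induction rule: limit_hierarchy_induct)
  case (base h)
  then have "continuous_map (prod_topology X euclidean) euclidean (h \<circ> fst)"
    using continuous_map_compose[OF continuous_map_fst[of X euclidean], of euclidean h] by simp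
  moreover have "closedin (prod_topology X euclidean) (topspace (prod_topology X euclidean))"
    by (rule closedin_topspace)
  ultimately have "continuity_carrier X h (topspace (prod_topology X euclidean))"
    unfolding continuity_carrier_def subtopology_topspace by (intro conjI) auto
  then show ?case by blast
next
  case (step \<alpha> h g)
  have "\<forall>n. \<exists>Z. continuity_carrier X (h n) Z" using step(3) by blast
  from choice[OF this] obtain Z where "\<And>n. continuity_carrier X (h n) (Z n)" by auto
  then show ?case using step(2) by (rule continuity_carrier_limit)
qed

lemma Lindelof_space_euclidean: "Lindelof_space (euclidean :: 'a::second_countable_topology topology)"
  unfolding Lindelof_space_alt
proof (intro allI impI)
  fix \<U> :: "'a set set" assume "(\<forall>U\<in>\<U>. openin euclidean U) \<and> topspace euclidean \<subseteq> \<Union>\<U>"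
  then have *: "\<And>U. U \<in> \<U> \<Longrightarrow> open U" "\<Union>\<U> = UNIV" by auto
  obtain \<V> where "\<V> \<subseteq> \<U>" "countable \<V>" "\<Union>\<V> = \<Union>\<U>" using Lindelof[OF *(1)] by blast
  then show "\<exists>\<V>. countable \<V> \<and> \<V> \<subseteq> \<U> \<and> topspace euclidean \<subseteq> \<Union>\<V>" using *(2) by auto
qed

lemma Lindelof_space_compact_prod:
  assumes X: "compact_space X" and Y: "Lindelof_space Y"
  shows "Lindelof_space (prod_topology X Y)"
proof (rule Lindelof_space_proper_map_preimage[OF _ Y])
  show "proper_map (prod_topology X Y) Y snd"
    unfolding proper_map_def
  proof (intro conjI ballI)
    show "closed_map (prod_topology X Y) Y snd" using X by (rule closed_map_snd)
    fix y assume y: "y \<in> topspace Y"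
    have "{x \<in> topspace (prod_topology X Y). snd x = y} = topspace X \<times> {y}" using y by auto
    moreover have "compactin (prod_topology X Y) (topspace X \<times> {y})"
      using X y by (simp add: compactin_Times compact_space_def)
    ultimately show "compactin (prod_topology X Y) {x \<in> topspace (prod_topology X Y). snd x = y}" by simp
  qed
qed

text \<open>Pairs with \<open>g\<close>-values at distance at least \<open>1 / Suc k\<close> need
  not form a closed subset of \<open>X \<times> X\<close>, but they do after adding codes from the
  carrier. That subset of a Lindelof space is covered by the open conditions
  \<open>d i x \<noteq> d i y\<close>, of which countably many suffice for each
  \<open>k\<close>.\<close>

lemma countable_determination:
  fixes d :: "'i \<Rightarrow> 'a \<Rightarrow> complex"
  assumes X: "compact_space X" and Z: "continuity_carrier X g Z"
    and d: "\<And>i. i \<in> I \<Longrightarrow> continuous_map X euclidean (d i)"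
    and sep: "\<And>x y. x \<in> topspace X \<Longrightarrow> y \<in> topspace X \<Longrightarrow> g x \<noteq> g y \<Longrightarrow> \<exists>i\<in>I. d i x \<noteq> d i y"
  shows "\<exists>J\<subseteq>I. countable J \<and>
    (\<forall>x\<in>topspace X. \<forall>y\<in>topspace X. g x \<noteq> g y \<longrightarrow> (\<exists>i\<in>J. d i x \<noteq> d i y))"
proof -
  let ?P = "prod_topology X (euclidean :: (nat \<Rightarrow> nat) topology)"
  \<comment> \<open>Both points and both codes are regrouped as compact times second countable,
    which makes the product Lindelof.\<close>
  let ?Q = "prod_topology (prod_topology X X) (euclidean :: ((nat \<Rightarrow> nat) \<times> (nat \<Rightarrow> nat)) topology)"
  have L: "Lindelof_space ?Q"
    using X by (intro Lindelof_space_compact_prod Lindelof_space_euclidean) (simp add: compact_space_prod_topology)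
  define a where "a w = (fst (fst w), fst (snd w))" for w :: "('a \<times> 'a) \<times> (nat \<Rightarrow> nat) \<times> (nat \<Rightarrow> nat)"
  define b where "b w = (snd (fst w), snd (snd w))" for w :: "('a \<times> 'a) \<times> (nat \<Rightarrow> nat) \<times> (nat \<Rightarrow> nat)"
  have cf: "continuous_map ?Q X (\<lambda>w. fst (fst w))" "continuous_map ?Q X (\<lambda>w. snd (fst w))"
    using continuous_map_compose[OF continuous_map_fst[of "prod_topology X X" euclidean] continuous_map_fst[of X X]]
      continuous_map_compose[OF continuous_map_fst[of "prod_topology X X" euclidean] continuous_map_snd[of X X]]
    by (simp_all add: comp_def)
  have cs: "continuous_map ?Q euclidean (\<lambda>w. fst (snd w))" "continuous_map ?Q euclidean (\<lambda>w. snd (snd w))"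
    using continuous_map_compose[OF continuous_map_snd[of "prod_topology X X" euclidean], of euclidean fst]
      continuous_map_compose[OF continuous_map_snd[of "prod_topology X X" euclidean], of euclidean snd]
    by (simp_all add: comp_def continuous_on_fst continuous_on_snd)
  have ca: "continuous_map ?Q ?P a" and cb: "continuous_map ?Q ?P b"
    unfolding a_def b_def using cf cs by (auto intro: continuous_map_pairedI)
  have clZ: "closedin ?P Z" using Z by (simp add: continuity_carrier_def)
  define V where "V = {w \<in> topspace ?Q. a w \<in> Z} \<inter> {w \<in> topspace ?Q. b w \<in> Z}"
  have V: "closedin ?Q V"
    unfolding V_def using clZ ca cb by (intro closedin_Int closedin_continuous_map_preimage)
  let ?V = "subtopology ?Q V"
  have tV: "topspace ?V = V" using closedin_subset[OF V] by auto
  have "continuous_map ?V (subtopology ?P Z) a" "continuous_map ?V (subtopology ?P Z) b"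
    using continuous_map_from_subtopology[OF ca] continuous_map_from_subtopology[OF cb]
    by (auto simp: continuous_map_in_subtopology V_def)
  note ab = this
  have "continuous_map (subtopology ?P Z) euclidean (g \<circ> fst)" using Z by (simp add: continuity_carrier_def)
  from continuous_map_compose[OF ab(1) this] continuous_map_compose[OF ab(2) this]
  have "continuous_map ?V euclidean (\<lambda>w. g (fst (fst w)))" "continuous_map ?V euclidean (\<lambda>w. g (snd (fst w)))"
    by (simp_all add: comp_def a_def b_def)
  then have "continuous_map ?V euclidean (\<lambda>w. (g (fst (fst w)), g (snd (fst w))))"
    by (simp add: continuous_map_pairedI flip: prod_topology_euclidean)
  moreover have "continuous_on UNIV (\<lambda>p::complex \<times> complex. dist (fst p) (snd p))" by (intro continuous_intros)
  ultimately have cd: "continuous_map ?V euclidean (\<lambda>w. dist (g (fst (fst w))) (g (snd (fst w))))"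
    using continuous_map_compose[of ?V euclidean "\<lambda>w. (g (fst (fst w)), g (snd (fst w)))" euclidean "\<lambda>p. dist (fst p) (snd p)"]
    by (simp add: comp_def)
  define C where "C k = {w \<in> topspace ?V. dist (g (fst (fst w))) (g (snd (fst w))) \<in> {1 / Suc k..}}" for k :: nat
  have C: "closedin ?Q (C k)" for k
  proof (rule closedin_trans_full[OF _ V])
    show "closedin ?V (C k)" unfolding C_def using cd by (rule closedin_continuous_map_preimage) simp
  qed
  define U where "U i = {w \<in> topspace ?Q. d i (fst (fst w)) \<noteq> d i (snd (fst w))}" for i
  have U: "openin ?Q (U i)" if "i \<in> I" for i
  proof -
    have "continuous_map ?Q euclidean (\<lambda>w. d i (fst (fst w)))" "continuous_map ?Q euclidean (\<lambda>w. d i (snd (fst w)))"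
      using continuous_map_compose[OF cf(1) d[OF that]] continuous_map_compose[OF cf(2) d[OF that]]
      by (simp_all add: comp_def)
    then have "continuous_map ?Q euclidean (\<lambda>w. d i (fst (fst w)) - d i (snd (fst w)))"
      by (intro continuous_map_diff)
    from openin_continuous_map_preimage[OF this, of "- {0}"]
    show ?thesis by (simp add: U_def open_Compl)
  qed
  have "\<exists>J\<subseteq>I. countable J \<and> C k \<subseteq> (\<Union>i\<in>J. U i)" for k
  proof -
    have "C k \<subseteq> (\<Union>i\<in>I. U i)"
    proof
      fix w assume w: "w \<in> C k"
      then have wQ: "w \<in> topspace ?Q" using closedin_subset[OF C] by blast
      then have xy: "fst (fst w) \<in> topspace X" "snd (fst w) \<in> topspace X" by auto
      have "1 / Suc k \<le> dist (g (fst (fst w))) (g (snd (fst w)))" using w by (simp add: C_def)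
      moreover have "0 < 1 / real (Suc k)" by simp
      ultimately have "g (fst (fst w)) \<noteq> g (snd (fst w))" by auto
      then obtain i where "i \<in> I" "d i (fst (fst w)) \<noteq> d i (snd (fst w))" using sep[OF xy] by blast
      then show "w \<in> (\<Union>i\<in>I. U i)" using wQ by (auto simp: U_def)
    qed
    moreover have "openin ?Q (topspace ?Q - C k)" using C by (intro openin_diff openin_topspace)
    ultimately have "(\<forall>W\<in>insert (topspace ?Q - C k) (U ` I). openin ?Q W) \<and>
        topspace ?Q \<subseteq> \<Union>(insert (topspace ?Q - C k) (U ` I))" using U by auto
    then have "\<exists>\<V>. countable \<V> \<and> \<V> \<subseteq> insert (topspace ?Q - C k) (U ` I) \<and> topspace ?Q \<subseteq> \<Union>\<V>"
      by (rule L[unfolded Lindelof_space_alt, THEN spec, THEN mp])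
    then obtain \<V> where \<V>: "countable \<V>" "\<V> \<subseteq> insert (topspace ?Q - C k) (U ` I)" "topspace ?Q \<subseteq> \<Union>\<V>" by blast
    have "countable (\<V> - {topspace ?Q - C k})" "\<V> - {topspace ?Q - C k} \<subseteq> U ` I" using \<V> by auto
    then obtain J where J: "countable J" "J \<subseteq> I" "\<V> - {topspace ?Q - C k} = U ` J"
      using countable_subset_image by metis
    have "C k \<subseteq> (\<Union>i\<in>J. U i)"
    proof
      fix w assume w: "w \<in> C k"
      then have "w \<in> topspace ?Q" using closedin_subset[OF C] by blast
      then obtain W where "W \<in> \<V>" "w \<in> W" using \<V>(3) by blast
      moreover from this w have "W \<noteq> topspace ?Q - C k" by blast
      ultimately have "W \<in> U ` J" using J(3) by blast
      then show "w \<in> (\<Union>i\<in>J. U i)" using \<open>w \<in> W\<close> by blast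
    qed
    then show ?thesis using J by blast
  qed
  then have "\<forall>k. \<exists>J. J \<subseteq> I \<and> countable J \<and> C k \<subseteq> (\<Union>i\<in>J. U i)" by blast
  from choice[OF this] obtain J where J: "\<And>k. J k \<subseteq> I" "\<And>k. countable (J k)" "\<And>k. C k \<subseteq> (\<Union>i\<in>J k. U i)"
    by auto
  show ?thesis
  proof (intro exI[of _ "\<Union>k. J k"] conjI ballI impI)
    fix x y assume xy: "x \<in> topspace X" "y \<in> topspace X" "g x \<noteq> g y"
    have "\<exists>p. (x, p) \<in> Z" "\<exists>p. (y, p) \<in> Z" using Z xy unfolding continuity_carrier_def by blast+
    then obtain p p' where p: "(x, p) \<in> Z" "(y, p') \<in> Z" by blast
    obtain k where "1 / Suc k < dist (g x) (g y)" using nat_approx_posE[of "dist (g x) (g y)"] xy(3) by auto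
    then have "((x, y), (p, p')) \<in> C k"
      using p xy by (simp add: C_def tV) (simp add: V_def a_def b_def)
    then have "((x, y), (p, p')) \<in> (\<Union>i\<in>J k. U i)" using J(3) by (rule subsetD[rotated])
    then obtain i where "i \<in> J k" "((x, y), (p, p')) \<in> U i" by (rule UN_E)
    then show "\<exists>i\<in>\<Union>k. J k. d i x \<noteq> d i y" by (intro bexI[of _ i]) (auto simp: U_def)
  qed (use J in auto)
qed

section \<open>Comparison of the hierarchies\<close>

lemma limit_hierarchy_subtopology:
  fixes Y :: "'a topology"
  assumes "\<gamma> \<le> \<alpha>" "f \<in> limit_hierarchy (topspace Y) \<gamma> (preimage_class Y \<Sigma>) \<alpha>"
    and \<Sigma>: "\<And>A. A \<in> \<Sigma> \<Longrightarrow> A \<inter> S \<in> \<Sigma>'"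
  shows "f \<in> limit_hierarchy (topspace (subtopology Y S)) \<gamma> (preimage_class (subtopology Y S) \<Sigma>') \<alpha>"
proof (rule limit_hierarchy_mono[OF assms(1,2)])
  show "preimage_class Y \<Sigma> \<subseteq> preimage_class (subtopology Y S) \<Sigma>'"
    unfolding preimage_class_def
  proof safe
    fix h :: "'a \<Rightarrow> complex" and U :: "complex set" assume "\<forall>U. open U \<longrightarrow> {x \<in> topspace Y. h x \<in> U} \<in> \<Sigma>" "open U"
    then have "{x \<in> topspace Y. h x \<in> U} \<inter> S \<in> \<Sigma>'" using \<Sigma> by blast
    moreover have "{x \<in> topspace Y. h x \<in> U} \<inter> S = {x \<in> topspace (subtopology Y S). h x \<in> U}" by auto
    ultimately show "{x \<in> topspace (subtopology Y S). h x \<in> U} \<in> \<Sigma>'" by simp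
  qed
qed simp

lemma Sigma2_Int:
  assumes "A \<in> Sigma2 \<F>" "\<And>B. B \<in> \<F> \<Longrightarrow> B \<inter> S \<in> \<F>'"
  shows "A \<inter> S \<in> Sigma2 \<F>'"
proof -
  obtain \<C> where \<C>: "countable \<C>" "\<C> \<subseteq> \<F>" "A = \<Union>\<C>" using assms(1) by (auto simp: Sigma2_def)
  have "A \<inter> S = (\<Union>B\<in>\<C>. B \<inter> S)" using \<C>(3) by auto
  also have "\<dots> \<in> Sigma2 \<F>'" using \<C> assms(2) by (intro Sigma2_UN) auto
  finally show ?thesis .
qed

lemma Bos_subtopology: "A \<in> Bos Y \<Longrightarrow> A \<inter> S \<in> Bos (subtopology Y S)"
proof (erule Bos_induct)
  let ?Y = "subtopology Y S"
  interpret algebra "topspace ?Y" "Bos ?Y" by (rule algebra_Bos)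
  show "U \<inter> S \<in> Bos ?Y" if "openin Y U" for U
    using that by (intro Bos_openin openin_subtopology_Int)
  show "algebra (topspace Y) {A. A \<subseteq> topspace Y \<and> A \<inter> S \<in> Bos ?Y}"
    unfolding algebra_iff_Un
  proof (intro conjI ballI)
    fix A assume A: "A \<in> {A. A \<subseteq> topspace Y \<and> A \<inter> S \<in> Bos ?Y}"
    have "(topspace Y - A) \<inter> S = topspace ?Y - A \<inter> S" by auto
    also have "\<dots> \<in> Bos ?Y" using A by (intro compl_sets) simp
    finally show "topspace Y - A \<in> {A. A \<subseteq> topspace Y \<and> A \<inter> S \<in> Bos ?Y}" by simp
  next
    fix A B assume "A \<in> {A. A \<subseteq> topspace Y \<and> A \<inter> S \<in> Bos ?Y}" "B \<in> {A. A \<subseteq> topspace Y \<and> A \<inter> S \<in> Bos ?Y}"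
    then show "A \<union> B \<in> {A. A \<subseteq> topspace Y \<and> A \<inter> S \<in> Bos ?Y}" by (auto simp: Int_Un_distrib2)
  qed auto
qed

lemma resolvable_subtopology:
  assumes A: "resolvable_in Y A"
  shows "resolvable_in (subtopology Y S) (A \<inter> S)"
  unfolding resolvable_in_def
proof (intro conjI allI impI)
  show "A \<inter> S \<subseteq> topspace (subtopology Y S)" using A by (auto simp: resolvable_in_def)
  fix B assume B: "B \<subseteq> topspace (subtopology Y S) \<and> B \<noteq> {}"
  then have BS: "B \<subseteq> S" "B \<subseteq> topspace Y" "B \<noteq> {}" by auto
  have eq: "subtopology (subtopology Y S) B = subtopology Y B"
    using BS by (simp add: subtopology_subtopology Int_absorb1)
  obtain U where U: "openin (subtopology Y B) U" "U \<noteq> {}" "U \<subseteq> A \<or> U \<inter> A = {}"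
    using A BS unfolding resolvable_in_def by blast
  moreover have "U \<subseteq> S" using openin_subset[OF U(1)] BS by auto
  ultimately show "\<exists>U. openin (subtopology (subtopology Y S) B) U \<and> U \<noteq> {} \<and> (U \<subseteq> A \<inter> S \<or> U \<inter> (A \<inter> S) = {})"
    unfolding eq by (intro exI[of _ U]) auto
qed

lemma Hf_subtopology: "1 \<le> \<alpha> \<Longrightarrow> f \<in> Hf \<alpha> Y \<Longrightarrow> f \<in> Hf \<alpha> (subtopology Y S)"
  unfolding Hf_def
  by (erule (1) limit_hierarchy_subtopology) (auto simp: Hs_def intro!: Sigma2_Int resolvable_subtopology)

lemma Bof_subtopology: "1 \<le> \<alpha> \<Longrightarrow> f \<in> Bof \<alpha> Y \<Longrightarrow> f \<in> Bof \<alpha> (subtopology Y S)"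
  unfolding Bof_def
  by (erule (1) limit_hierarchy_subtopology) (auto intro!: Sigma2_Int Bos_subtopology)

lemma Baire_class_subtopology: "f \<in> Baire_class \<alpha> Y \<Longrightarrow> f \<in> Baire_class \<alpha> (subtopology Y S)"
  unfolding Baire_class_def continuous_map_eq_preimage_class
  by (rule limit_hierarchy_subtopology[OF omega1_zero_le])
    (auto intro: openin_subtopology_Int)

section \<open>The Baire classes inside the \<open>Bof\<close> classes\<close>

lemma zero_less_one_omega1: "0 < (1::omega1)"
  using omega1_one_le_iff[of 1] by simp

text \<open>A limit lies in an open \<open>U\<close> iff, for some \<open>k\<close>, the
  approximants eventually stay at distance at least \<open>1 / Suc k\<close> from the complement.
  This exhibits the preimage as a countable union of closed sets.\<close>

lemma Baire_one_subset_Bof_one: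
  assumes U: "g \<in> limit_hierarchy (topspace Y) 0 {h. continuous_map Y euclidean h} 1"
  shows "g \<in> preimage_class Y (Sigma2 (Bos Y))"
proof -
  obtain h where h: "\<And>n::nat. \<exists>\<beta>. 0 \<le> \<beta> \<and> \<beta> < 1 \<and> h n \<in> limit_hierarchy (topspace Y) 0 {h. continuous_map Y euclidean h} \<beta>"
      "\<And>x. x \<in> topspace Y \<Longrightarrow> (\<lambda>n. h n x) \<longlonglongrightarrow> g x"
    using U unfolding limit_hierarchy_iff[OF zero_less_one_omega1] by blast
  have cont: "continuous_map Y euclidean (h n)" for n
  proof -
    obtain \<beta> where \<beta>: "\<beta> < 1" "h n \<in> limit_hierarchy (topspace Y) 0 {h. continuous_map Y euclidean h} \<beta>"
      using h(1)[of n] by blast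
    have "\<beta> = 0" using \<beta>(1) omega1_one_le_iff[of \<beta>] omega1_zero_le[of \<beta>] by (meson antisym leD leI)
    then show ?thesis using \<beta>(2) by simp
  qed
  interpret algebra "topspace Y" "Bos Y" by (rule algebra_Bos)
  have closed_Bos: "F \<in> Bos Y" if "closedin Y F" for F
  proof -
    have "topspace Y - F \<in> Bos Y" using that by (intro Bos_openin) auto
    from compl_sets[OF this] show ?thesis using closedin_subset[OF that] by (simp add: double_diff)
  qed
  show ?thesis
    unfolding preimage_class_def
  proof safe
    fix U :: "complex set" assume U: "open U"
    show "{x \<in> topspace Y. g x \<in> U} \<in> Sigma2 (Bos Y)"
    \<comment> \<open>\<open>infdist\<close> to the empty set is 0 by convention, so it detects
      membership in \<open>U\<close> only when the complement is nonempty.\<close>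
    proof (cases "U = UNIV")
      case True
      then show ?thesis using subsetD[OF subset_Sigma2 top] by simp
    next
      case False
      then have ne: "- U \<noteq> {}" by auto
      define C where "C k = {z. 1 / Suc k \<le> infdist z (- U)}" for k :: nat
      have C: "closed (C k)" for k
        unfolding C_def by (intro closed_Collect_le continuous_intros)
      have inU: "z \<in> U \<longleftrightarrow> 0 < infdist z (- U)" for z
        using in_closed_iff_infdist_zero[OF _ ne, of z] U infdist_nonneg[of z "- U"]
        by (auto simp: closed_Compl less_le)
      define F where "F k n = (\<Inter>m\<in>{n..}. {x \<in> topspace Y. h m x \<in> C k})" for k n :: nat
      have F: "closedin Y (F k n)" for k n
        unfolding F_def using C cont by (intro closedin_INT closedin_continuous_map_preimage) auto
      have "{x \<in> topspace Y. g x \<in> U} = (\<Union>p. F (fst p) (snd p))"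
      proof (intro set_eqI iffI)
        fix x assume "x \<in> {x \<in> topspace Y. g x \<in> U}"
        then have x: "x \<in> topspace Y" "0 < infdist (g x) (- U)" using inU by auto
        obtain k where k: "1 / Suc k < infdist (g x) (- U)" using nat_approx_posE[OF x(2)] by blast
        have "(\<lambda>n. infdist (h n x) (- U)) \<longlonglongrightarrow> infdist (g x) (- U)"
          using h(2)[OF x(1)] by (rule tendsto_infdist)
        from order_tendstoD(1)[OF this k] obtain n where "\<And>m. n \<le> m \<Longrightarrow> 1 / Suc k < infdist (h m x) (- U)"
          by (auto simp: eventually_sequentially)
        then have "x \<in> F k n" using x(1) by (auto simp: F_def C_def intro: less_imp_le)
        then show "x \<in> (\<Union>p. F (fst p) (snd p))" by (intro UN_I[of "(k, n)"]) auto
      next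
        fix x assume "x \<in> (\<Union>p. F (fst p) (snd p))"
        then obtain k n where x: "x \<in> F k n" by auto
        then have xY: "x \<in> topspace Y" by (auto simp: F_def)
        have "g x \<in> C k"
          using C[of k] x by (intro Lim_in_closed_set[OF _ _ _ h(2)[OF xY]]) (auto simp: F_def eventually_sequentially)
        moreover have "0 < 1 / real (Suc k)" by simp
        ultimately show "x \<in> {x \<in> topspace Y. g x \<in> U}"
          using xY inU[of "g x"] by (auto simp: C_def intro: less_le_trans)
      qed
      also have "\<dots> \<in> Sigma2 (Bos Y)" using F closed_Bos by (intro Sigma2_UN) auto
      finally show ?thesis .
    qed
  qed
qed

lemma Baire_class_subset_Bof:
  assumes "1 \<le> \<alpha>" "g \<in> Baire_class \<alpha> Y"
  shows "g \<in> Bof \<alpha> Y"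
  using assms Baire_one_subset_Bof_one[of _ Y] unfolding Baire_class_def Bof_def
  by (subst (asm) limit_hierarchy_zero_one) (auto intro: limit_hierarchy_mono[OF assms(1)])

section \<open>The Lebesgue--Hausdorff theorem\<close>

text \<open>The reduction principle for two F-sigma sets written as increasing closed unions: a
  point goes to whichever sequence reaches it earlier. Ties go to \<open>D\<close>, hence
  \<open>i<n\<close> in \<open>D\<close> but \<open>i\<le>n\<close> in \<open>E\<close>.\<close>

lemma fsigma_gdelta_separation:
  assumes A: "fsigma_in Y A" and B: "fsigma_in Y B" and cover: "A \<union> B = topspace Y"
    and Y: "metrizable_space Y"
  shows "\<exists>D. fsigma_in Y D \<and> fsigma_in Y (topspace Y - D) \<and> D \<subseteq> A \<and> topspace Y - D \<subseteq> B"
proof -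
  obtain P where P': "\<forall>n. closedin Y (P n)" "\<forall>n. P n \<subseteq> P (Suc n)" "\<Union>(range P) = A"
    using A unfolding fsigma_in_ascending by (elim exE conjE)
  obtain R where R': "\<forall>n. closedin Y (R n)" "\<forall>n. R n \<subseteq> R (Suc n)" "\<Union>(range R) = B"
    using B unfolding fsigma_in_ascending by (elim exE conjE)
  note P = spec[OF P'(1)] P'(3) and R = spec[OF R'(1)] R'(3)
  define D where "D = (\<Union>n. P n - (\<Union>i<n. R i))"
  define E where "E = (\<Union>n. R n - (\<Union>i\<le>n. P i))"
  have diff: "fsigma_in Y (F - G)" if "closedin Y F" "closedin Y G" for F G
  proof -
    have "fsigma_in Y (F \<inter> (topspace Y - G))"
      using that Y by (intro fsigma_in_Int closed_imp_fsigma_in open_imp_fsigma_in) auto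
    moreover have "F \<inter> (topspace Y - G) = F - G" using closedin_subset[OF that(1)] by blast
    ultimately show ?thesis by simp
  qed
  have "fsigma_in Y D" "fsigma_in Y E"
    unfolding D_def E_def using P(1) R(1) by (intro fsigma_in_Union; force intro!: diff closedin_Union)+
  moreover have "topspace Y - D = E"
  proof (intro set_eqI iffI)
    fix x assume x: "x \<in> topspace Y - D"
    have "\<exists>n. x \<in> R n"
    proof (rule ccontr)
      assume *: "\<nexists>n. x \<in> R n"
      then have "x \<in> A" using x cover R(2) by blast
      then obtain n where "x \<in> P n" using P(2) by blast
      then show False using x * by (auto simp: D_def)
    qed
    then obtain n where n: "x \<in> R n" "\<forall>i<n. x \<notin> R i" unfolding exists_least_iff[of "\<lambda>n. x \<in> R n"] by blast
    have "x \<notin> P i" if "i \<le> n" for i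
    proof
      assume "x \<in> P i"
      then have "x \<in> P i - (\<Union>j<i. R j)" using n(2) that by auto
      then show False using x by (auto simp: D_def)
    qed
    then show "x \<in> E" using n(1) by (auto simp: E_def)
  next
    fix x assume "x \<in> E"
    then obtain n where n: "x \<in> R n" "\<And>i. i \<le> n \<Longrightarrow> x \<notin> P i" by (auto simp: E_def)
    have "x \<notin> D"
    proof
      assume "x \<in> D"
      then obtain k where k: "x \<in> P k" "\<And>i. i < k \<Longrightarrow> x \<notin> R i" by (auto simp: D_def)
      have "n < k" using n(2) k(1) by (metis leI)
      then show False using k(2) n(1) by blast
    qed
    then show "x \<in> topspace Y - D" using n(1) closedin_subset[OF R(1)] by blast
  qed
  moreover have "D \<subseteq> A" "E \<subseteq> B" using P(2) R(2) by (auto simp: D_def E_def)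
  ultimately show ?thesis by auto
qed

text \<open>Urysohn functions separate the closed stages of \<open>D\<close> from those of its
  complement; at each point they are eventually constant.\<close>

lemma indicator_limit_continuous:
  assumes Y: "metrizable_space Y" and D: "fsigma_in Y D" "fsigma_in Y (topspace Y - D)"
  shows "\<exists>\<kappa>::nat \<Rightarrow> 'a \<Rightarrow> real. (\<forall>n. continuous_map Y euclideanreal (\<kappa> n) \<and> (\<forall>x\<in>topspace Y. \<kappa> n x \<in> {0..1})) \<and>
    (\<forall>x\<in>topspace Y. (\<lambda>n. \<kappa> n x) \<longlonglongrightarrow> indicator D x)"
proof -
  obtain P where P': "\<forall>n. closedin Y (P n)" "\<forall>n. P n \<subseteq> P (Suc n)" "\<Union>(range P) = D"
    using D(1) unfolding fsigma_in_ascending by (elim exE conjE)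
  obtain R where R': "\<forall>n. closedin Y (R n)" "\<forall>n. R n \<subseteq> R (Suc n)" "\<Union>(range R) = topspace Y - D"
    using D(2) unfolding fsigma_in_ascending by (elim exE conjE)
  note P = spec[OF P'(1)] spec[OF P'(2)] P'(3) and R = spec[OF R'(1)] spec[OF R'(2)] R'(3)
  have "\<forall>n. \<exists>f. continuous_map Y (top_of_set {0..1::real}) f \<and> f ` R n \<subseteq> {0} \<and> f ` P n \<subseteq> {1}"
  proof
    fix n
    have "disjnt (R n) (P n)" using P(3) R(3) by (auto simp: disjnt_def)
    then obtain f where "continuous_map Y (top_of_set {0..1::real}) f" "f ` R n \<subseteq> {0}" "f ` P n \<subseteq> {1}"
      using Urysohn_lemma[OF metrizable_imp_normal_space[OF Y] R(1)[of n] P(1)[of n], of 0 1] by auto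
    then show "\<exists>f. continuous_map Y (top_of_set {0..1::real}) f \<and> f ` R n \<subseteq> {0} \<and> f ` P n \<subseteq> {1}" by blast
  qed
  from choice[OF this] obtain \<kappa> where \<kappa>': "\<forall>n. continuous_map Y (top_of_set {0..1::real}) (\<kappa> n) \<and>
    \<kappa> n ` R n \<subseteq> {0} \<and> \<kappa> n ` P n \<subseteq> {1}" by (elim exE)
  then have \<kappa>: "continuous_map Y (top_of_set {0..1::real}) (\<kappa> n)" "\<kappa> n ` R n \<subseteq> {0}" "\<kappa> n ` P n \<subseteq> {1}" for n
    by blast+
  have mono: "P n \<subseteq> P m" "R n \<subseteq> R m" if "n \<le> m" for n m
    using lift_Suc_mono_le[of P, OF P(2) that] lift_Suc_mono_le[of R, OF R(2) that] by auto
  show ?thesis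
  proof (intro exI[of _ \<kappa>] conjI allI ballI)
    show "continuous_map Y euclideanreal (\<kappa> n)" for n
      using \<kappa>(1) by (simp add: continuous_map_in_subtopology)
    show "\<kappa> n x \<in> {0..1}" if "x \<in> topspace Y" for n x
      using \<kappa>(1)[of n] that by (auto simp: continuous_map_in_subtopology)
    fix x assume x: "x \<in> topspace Y"
    show "(\<lambda>n. \<kappa> n x) \<longlonglongrightarrow> indicator D x"
    proof (cases "x \<in> D")
      case True
      then obtain n where n: "x \<in> P n" using P(3) by blast
      have "\<kappa> m x = 1" if "n \<le> m" for m using \<kappa>(3)[of m] mono(1)[OF that] n by blast
      then have "eventually (\<lambda>m. \<kappa> m x = indicator D x) sequentially"
        using True by (auto simp: eventually_sequentially)
      then show ?thesis by (rule tendsto_eventually)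
    next
      case False
      then obtain n where n: "x \<in> R n" using R(3) x by blast
      have "\<kappa> m x = 0" if "n \<le> m" for m using \<kappa>(2)[of m] mono(2)[OF that] n by blast
      then have "eventually (\<lambda>m. \<kappa> m x = indicator D x) sequentially"
        using False by (auto simp: eventually_sequentially)
      then show ?thesis by (rule tendsto_eventually)
    qed
  qed
qed

text \<open>The function is expanded as \<open>\<Sum>k. 1/3 (2/3)\<^sup>k 1\<^bsub>D k\<^esub>\<close> with ambiguous sets \<open>D k\<close>.\<close>

lemma fsigma_measurable_limit_continuous:
  fixes u :: "'a \<Rightarrow> real"
  assumes Y: "metrizable_space Y"
    and u: "\<And>t. fsigma_in Y {x \<in> topspace Y. t < u x}" "\<And>t. fsigma_in Y {x \<in> topspace Y. u x < t}"
      "\<And>x. x \<in> topspace Y \<Longrightarrow> u x \<in> {0..1}"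
  shows "\<exists>w. (\<forall>n. continuous_map Y euclideanreal (w n)) \<and> (\<forall>x\<in>topspace Y. (\<lambda>n. w n x) \<longlonglongrightarrow> u x)"
proof -
  define P where "P v \<longleftrightarrow> (\<forall>t. fsigma_in Y {x \<in> topspace Y. t < v x}) \<and>
    (\<forall>t. fsigma_in Y {x \<in> topspace Y. v x < t}) \<and> (\<forall>x\<in>topspace Y. v x \<in> {0..1})" for v :: "'a \<Rightarrow> real"
  define step where "step v v' \<longleftrightarrow> (\<exists>D. fsigma_in Y D \<and> fsigma_in Y (topspace Y - D) \<and>
    (\<forall>x\<in>topspace Y. v x = (1/3) * indicator D x + (2/3) * v' x))" for v v' :: "'a \<Rightarrow> real"
  have ex: "\<exists>v'. P v' \<and> step v v'" if v: "P v" for v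
  proof -
    have 1: "{x \<in> topspace Y. 1/3 < v x} \<union> {x \<in> topspace Y. v x < 2/3} = topspace Y" by auto
    have 2: "fsigma_in Y {x \<in> topspace Y. 1/3 < v x}" "fsigma_in Y {x \<in> topspace Y. v x < 2/3}"
      using v unfolding P_def by blast+
    have "\<exists>D. fsigma_in Y D \<and> fsigma_in Y (topspace Y - D) \<and> D \<subseteq> {x \<in> topspace Y. 1/3 < v x} \<and>
        topspace Y - D \<subseteq> {x \<in> topspace Y. v x < 2/3}"
      using 2 1 Y by (rule fsigma_gdelta_separation)
    then obtain D where D: "fsigma_in Y D" "fsigma_in Y (topspace Y - D)" "D \<subseteq> {x \<in> topspace Y. 1/3 < v x}"
        "topspace Y - D \<subseteq> {x \<in> topspace Y. v x < 2/3}" by blast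
    \<comment> \<open>On \<open>D\<close> the value of \<open>v\<close> exceeds 1/3 and off
      \<open>D\<close> it is below 2/3, so removing a third of the indicator leaves a function with
      values in \<open>[0,2/3]\<close>; the factor 3/2 restores \<open>[0,1]\<close>.\<close>
    define v' where "v' x = (3/2) * (v x - (1/3) * indicator D x)" for x
    have DY: "D \<subseteq> topspace Y" using D(3) by blast
    have "P v'"
      unfolding P_def
    proof (intro conjI allI ballI)
      fix t
      have "{x \<in> topspace Y. t < v' x} = (D \<inter> {x \<in> topspace Y. (2/3) * t + 1/3 < v x}) \<union>
          ((topspace Y - D) \<inter> {x \<in> topspace Y. (2/3) * t < v x})"
        using DY by (auto simp: v'_def indicator_def)
      moreover have "fsigma_in Y \<dots>"
        using v D(1,2) unfolding P_def by (intro fsigma_in_Un fsigma_in_Int) blast+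
      ultimately show "fsigma_in Y {x \<in> topspace Y. t < v' x}" by (simp only:)
      have "{x \<in> topspace Y. v' x < t} = (D \<inter> {x \<in> topspace Y. v x < (2/3) * t + 1/3}) \<union>
          ((topspace Y - D) \<inter> {x \<in> topspace Y. v x < (2/3) * t})"
        using DY by (auto simp: v'_def indicator_def)
      moreover have "fsigma_in Y \<dots>"
        using v D(1,2) unfolding P_def by (intro fsigma_in_Un fsigma_in_Int) blast+
      ultimately show "fsigma_in Y {x \<in> topspace Y. v' x < t}" by (simp only:)
    next
      fix x assume x: "x \<in> topspace Y"
      then have "0 \<le> v x" "v x \<le> 1" using v by (auto simp: P_def)
      then show "v' x \<in> {0..1}" using D(3,4) x by (cases "x \<in> D") (auto simp: v'_def)
    qed
    moreover have "step v v'" unfolding step_def v'_def using D(1,2) by (intro exI[of _ D]) (simp add: algebra_simps)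
    ultimately show ?thesis by blast
  qed
  have "P u" using u by (simp add: P_def)
  have "\<exists>v. \<forall>n. (P (v n) \<and> (n = 0 \<longrightarrow> v n = u)) \<and> step (v n) (v (Suc n))"
  proof (rule dependent_nat_choice)
    show "\<exists>x. P x \<and> (0 = 0 \<longrightarrow> x = u)" using \<open>P u\<close> by blast
    show "\<exists>y. (P y \<and> (Suc n = 0 \<longrightarrow> y = u)) \<and> step x y" if "P x \<and> (n = 0 \<longrightarrow> x = u)" for x n
      using ex[of x] that by simp
  qed
  then obtain v where v: "\<And>n. P (v n)" "v 0 = u" "\<And>n. step (v n) (v (Suc n))" by blast
  have "\<forall>n. \<exists>D. fsigma_in Y D \<and> fsigma_in Y (topspace Y - D) \<and>
    (\<forall>x\<in>topspace Y. v n x = (1/3) * indicator D x + (2/3) * v (Suc n) x)"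
    using v(3) unfolding step_def by blast
  from choice[OF this] obtain D where D: "\<And>n. fsigma_in Y (D n)" "\<And>n. fsigma_in Y (topspace Y - D n)"
    "\<And>n x. x \<in> topspace Y \<Longrightarrow> v n x = (1/3) * indicator (D n) x + (2/3) * v (Suc n) x" by auto
  have "\<forall>k. \<exists>\<kappa>::nat \<Rightarrow> 'a \<Rightarrow> real. (\<forall>n. continuous_map Y euclideanreal (\<kappa> n) \<and> (\<forall>x\<in>topspace Y. \<kappa> n x \<in> {0..1})) \<and>
    (\<forall>x\<in>topspace Y. (\<lambda>n. \<kappa> n x) \<longlonglongrightarrow> indicator (D k) x)"
    using indicator_limit_continuous[OF Y D(1,2)] by blast
  from choice[OF this] obtain \<kappa> :: "nat \<Rightarrow> nat \<Rightarrow> 'a \<Rightarrow> real" where \<kappa>: "\<And>k n. continuous_map Y euclideanreal (\<kappa> k n)"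
    "\<And>k n x. x \<in> topspace Y \<Longrightarrow> \<kappa> k n x \<in> {0..1}"
    "\<And>k x. x \<in> topspace Y \<Longrightarrow> (\<lambda>n. \<kappa> k n x) \<longlonglongrightarrow> indicator (D k) x" by blast
  define c where "c k = (1/3) * (2/3::real) ^ k" for k :: nat
  have c: "summable c" unfolding c_def by (intro summable_mult summable_geometric) simp
  have c0: "0 \<le> c k" for k by (simp add: c_def)
  define w where "w n x = (\<Sum>k<n. c k * \<kappa> k n x)" for n x
  have "continuous_map Y euclideanreal (w n)" for n
    unfolding w_def using \<kappa>(1) by (intro continuous_map_sum continuous_map_real_mult) auto
  moreover have "(\<lambda>n. w n x) \<longlonglongrightarrow> u x" if x: "x \<in> topspace Y" for x
  proof -
    have part: "u x = (\<Sum>k<n. c k * indicator (D k) x) + (2/3) ^ n * v n x" for n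
    proof (induction n)
      case (Suc n)
      then show ?case using D(3)[OF x, of n] by (simp add: c_def algebra_simps)
    qed (simp add: v(2))
    have "(\<lambda>n. (2/3::real) ^ n * v n x) \<longlonglongrightarrow> 0"
    proof (rule Lim_null_comparison)
      have "0 \<le> v n x" "v n x \<le> 1" for n using v(1)[of n] x by (auto simp: P_def)
      then show "eventually (\<lambda>n. norm ((2/3::real) ^ n * v n x) \<le> (2/3) ^ n) sequentially"
        by (simp add: abs_mult mult_left_le)
    qed (intro LIMSEQ_realpow_zero; simp)
    then have "(\<lambda>n. u x - (2/3::real) ^ n * v n x) \<longlonglongrightarrow> u x - 0" by (intro tendsto_diff tendsto_const)
    moreover have "u x - (2/3::real) ^ n * v n x = (\<Sum>k<n. c k * indicator (D k) x)" for n using part[of n] by simp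
    ultimately have "(\<lambda>k. c k * indicator (D k) x) sums u x" by (simp add: sums_def)
    then have sum: "(\<Sum>k. c k * indicator (D k) x) = u x" by (rule sums_unique[symmetric])
    \<comment> \<open>The partial sums become full series with zero tails, so that Tannery's theorem
      with the summable majorant \<open>c\<close> permits termwise limits although the number of
      terms and the approximants vary together.\<close>
    define a where "a k n = (if k < n then c k * \<kappa> k n x else 0)" for k n
    have "(\<lambda>n. \<Sum>k. a k n) \<longlonglongrightarrow> (\<Sum>k. c k * indicator (D k) x)"
    proof (rule conjunct2[OF conjunct2[OF tannerys_theorem[where M = c]]])
      fix k
      have "(\<lambda>n. c k * \<kappa> k n x) \<longlonglongrightarrow> c k * indicator (D k) x" using \<kappa>(3)[OF x] by (intro tendsto_mult tendsto_const)
      moreover have "eventually (\<lambda>n. c k * \<kappa> k n x = a k n) sequentially"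
        using eventually_gt_at_top[of k] by eventually_elim (simp add: a_def)
      ultimately show "(\<lambda>n. a k n) \<longlonglongrightarrow> c k * indicator (D k) x" by (rule Lim_transform_eventually)
    next
      have "norm (a k n) \<le> c k" for k n
        using \<kappa>(2)[OF x, of k n] c0[of k] by (auto simp: a_def abs_mult mult_left_le)
      then show "eventually (\<lambda>(k, n). norm (a k n) \<le> c k) (at_top \<times>\<^sub>F sequentially)"
        by (intro always_eventually) auto
    qed (use c in auto)
    moreover have "(\<Sum>k. a k n) = w n x" for n
    proof -
      have "(\<Sum>k. a k n) = (\<Sum>k<n. a k n)" by (rule suminf_finite) (auto simp: a_def)
      then show ?thesis by (simp add: a_def w_def)
    qed
    ultimately show ?thesis by (simp add: sum)
  qed
  ultimately show ?thesis by blast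
qed

text \<open>In a metrizable space the sets that are both F-sigma and G-delta form an algebra
  containing the open sets.\<close>

lemma Sigma2_Bos_fsigma:
  assumes Y: "metrizable_space Y" and A: "A \<in> Sigma2 (Bos Y)"
  shows "fsigma_in Y A"
proof -
  have "fsigma_in Y B \<and> gdelta_in Y B" if "B \<in> Bos Y" for B
    using that
  proof (rule Bos_induct)
    show "fsigma_in Y U \<and> gdelta_in Y U" if "openin Y U" for U
      using that Y by (simp add: open_imp_fsigma_in open_imp_gdelta_in)
    have "topspace Y - (topspace Y - A) = A" if "A \<subseteq> topspace Y" for A using that by blast
    then show "algebra (topspace Y) {A. A \<subseteq> topspace Y \<and> fsigma_in Y A \<and> gdelta_in Y A}"
      unfolding algebra_iff_Un
      by (auto simp: gdelta_in_fsigma_in fsigma_in_Un Diff_Un fsigma_in_Int)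
  qed
  moreover obtain \<C> where "countable \<C>" "\<C> \<subseteq> Bos Y" "A = \<Union>\<C>" using A by (auto simp: Sigma2_def)
  ultimately show ?thesis using fsigma_in_Union[of \<C> Y] by blast
qed

lemma bounded_Bof_one_Baire_one:
  assumes Y: "metrizable_space Y" and h: "h \<in> preimage_class Y (Sigma2 (Bos Y))"
    and M: "\<And>x. x \<in> topspace Y \<Longrightarrow> cmod (h x) \<le> M"
  shows "h \<in> limit_hierarchy (topspace Y) 0 {g. continuous_map Y euclidean g} 1"
proof -
  define N where "N = max 1 M"
  have N: "0 < N" "\<And>x. x \<in> topspace Y \<Longrightarrow> cmod (h x) \<le> N" using M by (auto simp: N_def le_max_iff_disj)
  have pre: "fsigma_in Y {x \<in> topspace Y. h x \<in> U}" if "open U" for U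
    using h that Sigma2_Bos_fsigma[OF Y] unfolding preimage_class_def by blast
  have real: "\<exists>w. (\<forall>n. continuous_map Y euclideanreal (w n)) \<and> (\<forall>x\<in>topspace Y. (\<lambda>n. w n x) \<longlonglongrightarrow> p (h x))"
    if p: "continuous_on UNIV p" "\<And>z. \<bar>p z\<bar> \<le> cmod z" for p :: "complex \<Rightarrow> real"
  proof -
    define u where "u x = 1 / 2 + p (h x) / (2 * N)" for x
    have cp: "continuous_on UNIV (\<lambda>z. 1 / 2 + p z / (2 * N))"
      using p(1) N(1) by (intro continuous_intros) auto
    have "\<exists>w. (\<forall>n. continuous_map Y euclideanreal (w n)) \<and> (\<forall>x\<in>topspace Y. (\<lambda>n. w n x) \<longlonglongrightarrow> u x)"
    proof (rule fsigma_measurable_limit_continuous[OF Y])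
      fix t
      have "open {z. t < 1 / 2 + p z / (2 * N)}" using cp by (intro open_Collect_less continuous_on_const)
      from pre[OF this] show "fsigma_in Y {x \<in> topspace Y. t < u x}" by (simp add: u_def)
      have "open {z. 1 / 2 + p z / (2 * N) < t}" using cp by (intro open_Collect_less continuous_on_const)
      from pre[OF this] show "fsigma_in Y {x \<in> topspace Y. u x < t}" by (simp add: u_def)
    next
      fix x assume "x \<in> topspace Y"
      then have "\<bar>p (h x)\<bar> \<le> N" using N(2) p(2) order_trans by blast
      then have "- N \<le> p (h x)" "p (h x) \<le> N" by auto
      then show "u x \<in> {0..1}" using N(1) by (auto simp: u_def field_simps)
    qed
    then obtain w where w: "\<And>n. continuous_map Y euclideanreal (w n)" "\<And>x. x \<in> topspace Y \<Longrightarrow> (\<lambda>n. w n x) \<longlonglongrightarrow> u x"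
      by blast
    have "(\<lambda>n. (2 * N) * (w n x - 1 / 2)) \<longlonglongrightarrow> (2 * N) * (u x - 1 / 2)" if "x \<in> topspace Y" for x
      using w(2)[OF that] by (intro tendsto_mult tendsto_diff tendsto_const)
    moreover have "(2 * N) * (u x - 1 / 2) = p (h x)" for x using N(1) by (simp add: u_def)
    moreover have "continuous_map Y euclideanreal (\<lambda>x. (2 * N) * (w n x - 1 / 2))" for n
      using w(1) by (intro continuous_map_real_mult continuous_map_diff) auto
    ultimately show ?thesis by (intro exI[of _ "\<lambda>n x. (2 * N) * (w n x - 1 / 2)"]) simp
  qed
  obtain a where a: "\<And>n. continuous_map Y euclideanreal (a n)" "\<And>x. x \<in> topspace Y \<Longrightarrow> (\<lambda>n. a n x) \<longlonglongrightarrow> Re (h x)"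
    using real[of Re] by (auto simp: abs_Re_le_cmod continuous_on_Re)
  obtain b where b: "\<And>n. continuous_map Y euclideanreal (b n)" "\<And>x. x \<in> topspace Y \<Longrightarrow> (\<lambda>n. b n x) \<longlonglongrightarrow> Im (h x)"
    using real[of Im] by (auto simp: abs_Im_le_cmod continuous_on_Im)
  have "continuous_map Y euclidean (\<lambda>x. Complex (a n x) (b n x))" for n
  proof -
    have "continuous_map Y euclidean (\<lambda>x. (a n x, b n x))"
      using a(1)[of n] b(1)[of n] by (simp add: continuous_map_pairedI flip: prod_topology_euclidean)
    moreover have "continuous_on UNIV (\<lambda>p::real \<times> real. Complex (fst p) (snd p))"
      unfolding Complex_eq by (intro continuous_intros)
    ultimately show ?thesis
      using continuous_map_compose[of Y euclidean "\<lambda>x. (a n x, b n x)" euclidean "\<lambda>p. Complex (fst p) (snd p)"]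
      by (simp add: comp_def)
  qed
  moreover have "(\<lambda>n. Complex (a n x) (b n x)) \<longlonglongrightarrow> h x" if "x \<in> topspace Y" for x
    using tendsto_Complex[OF a(2)[OF that] b(2)[OF that]] by simp
  ultimately show ?thesis
    unfolding limit_hierarchy_iff[OF zero_less_one_omega1]
    using zero_less_one_omega1 by (intro exI[of _ "\<lambda>n x. Complex (a n x) (b n x)"]) (auto intro!: exI[of _ 0])
qed

text \<open>Truncation bounds the base functions by the bound of \<open>g\<close>, so the
  Lebesgue-Hausdorff theorem is required only for bounded functions; the rest is the comparison of
  hierarchies starting at 0 and at 1.\<close>

lemma bounded_Bof_metrizable_Baire_class:
  assumes Y: "metrizable_space Y" and \<alpha>: "1 \<le> \<alpha>" and g: "g \<in> Bof \<alpha> Y"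
    and M: "\<And>x. x \<in> topspace Y \<Longrightarrow> cmod (g x) \<le> M"
  shows "g \<in> Baire_class \<alpha> Y"
proof -
  define N where "N = max 0 M"
  have N: "0 \<le> N" "\<And>x. x \<in> topspace Y \<Longrightarrow> cmod (g x) \<le> N" using M by (auto simp: N_def le_max_iff_disj)
  have "g \<in> limit_hierarchy (topspace Y) 1 {h \<in> preimage_class Y (Sigma2 (Bos Y)). \<forall>x\<in>topspace Y. cmod (h x) \<le> N} \<alpha>"
    using \<alpha> g N unfolding Bof_def by (intro limit_hierarchy_preimage_class_truncate)
  moreover have "{h \<in> preimage_class Y (Sigma2 (Bos Y)). \<forall>x\<in>topspace Y. cmod (h x) \<le> N} \<subseteq>
      limit_hierarchy (topspace Y) 0 {g. continuous_map Y euclidean g} 1"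
    using bounded_Bof_one_Baire_one[OF Y] by blast
  ultimately have "g \<in> limit_hierarchy (topspace Y) 1 (limit_hierarchy (topspace Y) 0 {g. continuous_map Y euclidean g} 1) \<alpha>"
    using limit_hierarchy_mono[OF \<alpha> _ order_refl] by blast
  then show ?thesis unfolding Baire_class_def limit_hierarchy_zero_one[OF \<alpha>] .
qed

section \<open>The Baire classes on the dual ball\<close>

context scalar_banach_space
begin

text \<open>At level 0 the resultant map is a quotient map. Otherwise countable determination is
  applied on the parameter space, where \<open>f \<circ> resultant\<close> is already known to be of
  the class; it produces countably many vectors whose evaluations map the ball onto a metrizable
  \<open>S\<close>. \<open>Bof_descent\<close> goes directly from the parameter space to
  \<open>S\<close>, and continuous maps bring the Baire class back to the ball.\<close>

lemma Baire_class_extension: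
  assumes f: "f \<in> bidual_space K smul" "strongly_affine T f"
    and h: "f \<in> Baire_class \<alpha> (ext_closure_top K smul)"
  shows "f \<in> Baire_class \<alpha> T"
proof -
  let ?X = "fa_top ext_closure"
  have \<Phi>: "f \<circ> resultant \<in> Baire_class \<alpha> ?X" using f h by (rule Baire_class_resultant)
  show ?thesis
  proof (cases "1 \<le> \<alpha>")
    case False
    then have \<alpha>: "\<alpha> = 0" using omega1_one_le_iff[of \<alpha>] omega1_zero_le[of \<alpha>] by auto
    have "quotient_map ?X T resultant"
      using continuous_imp_quotient_map[OF continuous_resultant compact_space_fa_top Hausdorff_ball resultant_onto] .
    moreover have "continuous_map ?X euclidean (f \<circ> resultant)" using \<Phi> by (simp add: Baire_class_def \<alpha>)
    ultimately have "continuous_map T euclidean f" by (rule continuous_compose_quotient_map)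
    then show ?thesis by (simp add: Baire_class_def \<alpha>)
  next
    case True
    obtain M where M: "\<And>\<phi>. \<phi> \<in> dual_ball K smul \<Longrightarrow> norm (f \<phi>) \<le> M" using bidual_bounded[OF f(1)] by blast
    obtain Z where Z: "continuity_carrier ?X (f \<circ> resultant) Z" using Baire_class_continuity_carrier[OF \<Phi>] by blast
    have "\<exists>J\<subseteq>UNIV. countable J \<and> (\<forall>m\<in>topspace ?X. \<forall>m'\<in>topspace ?X. (f \<circ> resultant) m \<noteq> (f \<circ> resultant) m' \<longrightarrow>
        (\<exists>e\<in>J. blinfun_apply (resultant m) e \<noteq> blinfun_apply (resultant m') e))"
    proof (rule countable_determination[OF compact_space_fa_top Z])
      show "continuous_map ?X euclidean (\<lambda>m. blinfun_apply (resultant m) e)" for e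
        using continuous_map_compose[OF continuous_resultant continuous_eval[of e]] by (simp add: comp_def)
      show "\<exists>e\<in>UNIV. blinfun_apply (resultant m) e \<noteq> blinfun_apply (resultant m') e"
        if "(f \<circ> resultant) m \<noteq> (f \<circ> resultant) m'" for m m'
      proof (rule ccontr)
        assume "\<not> ?thesis"
        then have "resultant m = resultant m'" by (intro blinfun_eqI) auto
        then show False using that by simp
      qed
    qed
    then obtain J where J: "countable J" "\<And>m m'. m \<in> topspace ?X \<Longrightarrow> m' \<in> topspace ?X \<Longrightarrow>
        f (resultant m) \<noteq> f (resultant m') \<Longrightarrow> \<exists>e\<in>J. blinfun_apply (resultant m) e \<noteq> blinfun_apply (resultant m') e"
      by auto
    \<comment> \<open>Inserting 0 makes the enumeration meaningful for empty \<open>J\<close>; a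
      further evaluation does no harm to separation.\<close>
    define d where "d = from_nat_into (insert 0 J)"
    have d: "J \<subseteq> range d" using J(1) by (simp add: d_def range_from_nat_into subset_insertI)
    define q where "q \<phi> = (\<lambda>n. blinfun_apply \<phi> (d n))" for \<phi> :: "'e \<Rightarrow>\<^sub>L complex"
    have det: "f \<phi> = f \<psi>" if \<phi>\<psi>: "\<phi> \<in> topspace T" "\<psi> \<in> topspace T" and eq: "q \<phi> = q \<psi>" for \<phi> \<psi>
    proof (rule ccontr)
      assume ne: "f \<phi> \<noteq> f \<psi>"
      obtain m m' where m: "m \<in> topspace ?X" "m' \<in> topspace ?X" "\<phi> = resultant m" "\<psi> = resultant m'"
        using \<phi>\<psi> unfolding resultant_onto[symmetric] by blast
      then obtain e where "e \<in> J" "blinfun_apply \<phi> e \<noteq> blinfun_apply \<psi> e" using J(2)[of m m'] ne by auto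
      moreover from this obtain n where "e = d n" using d by blast
      ultimately show False using fun_cong[OF eq, of n] by (simp add: q_def)
    qed
    define S where "S = q ` topspace T"
    have qc: "continuous_map T (top_of_set S) q"
    proof -
      have "continuous_map T (product_topology (\<lambda>_. euclidean) UNIV) q"
        using continuous_eval by (simp add: continuous_map_componentwise_UNIV q_def)
      then show ?thesis by (auto simp: continuous_map_in_subtopology S_def euclidean_product_topology)
    qed
    \<comment> \<open>The choice among preimages of \<open>y\<close> is immaterial by
      \<open>det\<close>: \<open>f\<close> depends only on the countably many coordinates in
      \<open>q\<close>.\<close>
    define \<psi> where "\<psi> y = f (SOME \<phi>. \<phi> \<in> topspace T \<and> q \<phi> = y)" for y
    have \<psi>: "\<psi> (q \<phi>) = f \<phi>" if "\<phi> \<in> topspace T" for \<phi>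
    proof -
      have "\<exists>\<phi>'. \<phi>' \<in> topspace T \<and> q \<phi>' = q \<phi>" using that by blast
      from someI_ex[OF this] show ?thesis unfolding \<psi>_def using det that by blast
    qed
    have "\<psi> \<in> Bof \<alpha> (top_of_set S)"
    proof (rule Bof_descent[OF compact_space_fa_top _ continuous_map_compose[OF continuous_resultant qc] _ True])
      show "Hausdorff_space (top_of_set S)"
        by (intro Hausdorff_space_subtopology) simp
      show "(q \<circ> resultant) ` topspace ?X = topspace (top_of_set S)"
        unfolding image_comp[symmetric] resultant_onto by (simp add: S_def)
      show "f \<circ> resultant \<in> Bof \<alpha> ?X" using True \<Phi> by (rule Baire_class_subset_Bof)
      show "\<psi> ((q \<circ> resultant) m) = (f \<circ> resultant) m" if "m \<in> topspace ?X" for m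
        using \<psi>[of "resultant m"] that resultant_onto by auto
    qed
    moreover have "cmod (\<psi> y) \<le> M" if "y \<in> topspace (top_of_set S)" for y
      using that \<psi> M by (auto simp: S_def topspace_ball)
    moreover have "metrizable_space (top_of_set S)"
      by (intro metrizable_space_subtopology metrizable_space_euclidean)
    ultimately have "\<psi> \<in> Baire_class \<alpha> (top_of_set S)"
      using True by (intro bounded_Bof_metrizable_Baire_class)
    then have "\<psi> \<circ> q \<in> Baire_class \<alpha> T"
      unfolding Baire_class_def
    proof (rule limit_hierarchy_compose[OF omega1_zero_le])
      show "q ` topspace T \<subseteq> topspace (top_of_set S)" by (simp add: S_def)
      show "h \<circ> q \<in> {g. continuous_map T euclidean g}" if "h \<in> {g. continuous_map (top_of_set S) euclidean g}" for h
        using continuous_map_compose[OF qc, of euclidean h] that unfolding mem_Collect_eq by blast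
    qed
    then show ?thesis
      unfolding Baire_class_def
    proof (rule limit_hierarchy_cong[OF omega1_zero_le])
      show "f \<phi> = (\<psi> \<circ> q) \<phi>" if "\<phi> \<in> topspace T" for \<phi> using \<psi>[OF that] by simp
      show "h' \<in> {g. continuous_map T euclidean g}"
        if "h \<in> {g. continuous_map T euclidean g}" "\<And>x. x \<in> topspace T \<Longrightarrow> h' x = h x" for h h'
        using that by (auto elim: continuous_map_eq)
    qed
  qed
qed

end

theorem theorem1p1:
  fixes K :: "complex set"
    and smul :: "complex \<Rightarrow> 'e::banach \<Rightarrow> 'e"
    and f :: "('e \<Rightarrow>\<^sub>L complex) \<Rightarrow> complex"
  assumes "scalar_banach_space K smul"
    and "f \<in> bidual_space K smul"
    and "strongly_affine (ball_top K smul) f"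
  shows "(\<forall>\<alpha>::omega1. 1 \<le> \<alpha> \<longrightarrow>
            (f \<in> Hf \<alpha> (ext_closure_top K smul) \<longleftrightarrow> f \<in> Hf \<alpha> (ball_top K smul))) \<and>
         (\<forall>\<alpha>::omega1. 1 \<le> \<alpha> \<longrightarrow>
            (f \<in> Bof \<alpha> (ext_closure_top K smul) \<longleftrightarrow> f \<in> Bof \<alpha> (ball_top K smul))) \<and>
         (\<forall>\<alpha>::omega1.
            (f \<in> Baire_class \<alpha> (ext_closure_top K smul) \<longleftrightarrow> f \<in> Baire_class \<alpha> (ball_top K smul)))"
proof -
  interpret scalar_banach_space K smul by fact
  note f = assms(2,3)
  show ?thesis
  proof (intro conjI allI impI)
    fix \<alpha> :: omega1
    show "f \<in> Hf \<alpha> (ext_closure_top K smul) \<longleftrightarrow> f \<in> Hf \<alpha> (ball_top K smul)" if "1 \<le> \<alpha>"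
      using Hf_extension[OF f that] Hf_subtopology[OF that, of f T ext_closure]
      by (auto simp: ext_closure_top_eq)
    show "f \<in> Bof \<alpha> (ext_closure_top K smul) \<longleftrightarrow> f \<in> Bof \<alpha> (ball_top K smul)" if "1 \<le> \<alpha>"
      using Bof_extension[OF f that] Bof_subtopology[OF that, of f T ext_closure]
      by (auto simp: ext_closure_top_eq)
    show "f \<in> Baire_class \<alpha> (ext_closure_top K smul) \<longleftrightarrow> f \<in> Baire_class \<alpha> (ball_top K smul)"
      using Baire_class_extension[OF f] Baire_class_subtopology[of f \<alpha> T ext_closure]
      by (auto simp: ext_closure_top_eq)
  qed
qed

end
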